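(* There exists a polynomial-time $10$-approximation algorithm for the $(L,U,\emptyset,p)$-Center problem.
   Context: An instance of $(L,U,\emptyset,p)$-Center consists of a finite vertex set $V$, a symmetric distance function $d:V\times V\to\mathbb{R}_{\ge0}$ satisfying the triangle inequality, an integer $p\ge0$, and integers $0\le L\le U$. A feasible solution is a triple $(C,F,\phi)$ with $C\subseteq V$, $|C|\ge p$, $F\subseteq V$ a set of open centers of arbitrary size (each vertex opened at most once), and $\phi:C\to F$ with $L\le|\phi^{-1}(u)|\le U$ for each $u\in F$; its value is $\max_{v\in C}d(v,\phi(v))$, to be minimized. A $\rho$-approximation algorithm outputs, on every instance having a feasible solution, a feasible solution of value at most $\rho$ times the optimum. *)

theory Defs
  imports Complex_Main "HOL-Library.Log_Nat" "HOL-Computational_Algebra.Polynomial"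
begin

section \<open>The center problem with lower and upper bounds and outliers\<close>

definition center_instance ::
    "'a set \<Rightarrow> ('a \<Rightarrow> 'a \<Rightarrow> real) \<Rightarrow> nat \<Rightarrow> nat \<Rightarrow> bool" where
  "center_instance V d L U \<longleftrightarrow>
     finite V \<and>
     (\<forall>u\<in>V. \<forall>v\<in>V. 0 \<le> d u v) \<and>
     (\<forall>u\<in>V. \<forall>v\<in>V. d u v = d v u) \<and>
     (\<forall>u\<in>V. \<forall>v\<in>V. \<forall>w\<in>V. d u w \<le> d u v + d v w) \<and>
     L \<le> U"

definition feasible ::
    "'a set \<Rightarrow> nat \<Rightarrow> nat \<Rightarrow> nat \<Rightarrow> 'a set \<Rightarrow> 'a set \<Rightarrow> ('a \<Rightarrow> 'a) \<Rightarrow> bool" where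
  "feasible V L U p C F \<phi> \<longleftrightarrow>
     C \<subseteq> V \<and> p \<le> card C \<and> F \<subseteq> V \<and> \<phi> ` C \<subseteq> F \<and>
     (\<forall>u\<in>F. L \<le> card {v \<in> C. \<phi> v = u} \<and> card {v \<in> C. \<phi> v = u} \<le> U)"

text \<open>A solution that serves no vertex, which is possible only for \<open>p = 0\<close>, has value \<open>0\<close>.\<close>

definition sol_value :: "('a \<Rightarrow> 'a \<Rightarrow> real) \<Rightarrow> 'a set \<Rightarrow> ('a \<Rightarrow> 'a) \<Rightarrow> real" where
  "sol_value d C \<phi> = (if C = {} then 0 else Max ((\<lambda>v. d v (\<phi> v)) ` C))"

text \<open>Over a finite vertex set only finitely many values occur, so the infimum is attained
  whenever a feasible solution exists.\<close>

definition opt_value ::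
    "'a set \<Rightarrow> ('a \<Rightarrow> 'a \<Rightarrow> real) \<Rightarrow> nat \<Rightarrow> nat \<Rightarrow> nat \<Rightarrow> real" where
  "opt_value V d L U p = Inf {sol_value d C \<phi> | C F \<phi>. feasible V L U p C F \<phi>}"


section \<open>Programs and running time\<close>

text \<open>
  Random access machines in structured form: while programs over arrays of natural numbers and
  arrays of real numbers. A scalar is an array used at index \<open>0\<close> only. Every assignment and every
  test costs one unit; expressions occur in the program text, so evaluating one takes a number of
  primitive operations bounded by a constant of the program.

  Numbers of both sorts can only be added, subtracted and compared, and constants are rational.
  In \<open>t\<close> steps the bit length of a number thus grows by at most \<open>O(t)\<close>, so that on rational
  distances the unit-cost measure agrees up to a polynomial with Turing machine time. Unit-cost
  multiplication or arbitrary real constants would destroy this. Real numbers influence the rest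
  of the computation only through comparisons; there is no rounding to natural numbers.
\<close>

type_synonym vname = string

datatype nexp =
    NConst nat
  | NGet vname nexp
  | NPlus nexp nexp
  | NMinus nexp nexp

datatype rexp =
    RConst rat
  | RGet vname nexp
  | RPlus rexp rexp
  | RMinus rexp rexp

datatype bexp =
    NLess nexp nexp
  | RLess rexp rexp
  | Neg bexp
  | Conj bexp bexp

datatype com =
    Skip
  | NSet vname nexp nexp
  | RSet vname nexp rexp
  | Seq com com
  | Cond bexp com com
  | While bexp com

record state =
  nats :: "vname \<Rightarrow> nat \<Rightarrow> nat"
  reals :: "vname \<Rightarrow> nat \<Rightarrow> real"

text \<open>Subtraction of natural numbers is truncated at \<open>0\<close>.\<close>

fun nval :: "nexp \<Rightarrow> state \<Rightarrow> nat" where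
  "nval (NConst k) s = k"
| "nval (NGet a e) s = nats s a (nval e s)"
| "nval (NPlus e f) s = nval e s + nval f s"
| "nval (NMinus e f) s = nval e s - nval f s"

fun rval :: "rexp \<Rightarrow> state \<Rightarrow> real" where
  "rval (RConst q) s = of_rat q"
| "rval (RGet a e) s = reals s a (nval e s)"
| "rval (RPlus e f) s = rval e s + rval f s"
| "rval (RMinus e f) s = rval e s - rval f s"

fun bval :: "bexp \<Rightarrow> state \<Rightarrow> bool" where
  "bval (NLess e f) s \<longleftrightarrow> nval e s < nval f s"
| "bval (RLess e f) s \<longleftrightarrow> rval e s < rval f s"
| "bval (Neg b) s \<longleftrightarrow> \<not> bval b s"
| "bval (Conj b c) s \<longleftrightarrow> bval b s \<and> bval c s"

definition set_nat :: "vname \<Rightarrow> nat \<Rightarrow> nat \<Rightarrow> state \<Rightarrow> state" where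
  "set_nat a i x s = s\<lparr>nats := (nats s)(a := (nats s a)(i := x))\<rparr>"

definition set_real :: "vname \<Rightarrow> nat \<Rightarrow> real \<Rightarrow> state \<Rightarrow> state" where
  "set_real a i x s = s\<lparr>reals := (reals s)(a := (reals s a)(i := x))\<rparr>"

text \<open>\<open>exec c s t s'\<close>: started in \<open>s\<close>, program \<open>c\<close> halts in \<open>s'\<close> after \<open>t\<close> steps.\<close>

inductive exec :: "com \<Rightarrow> state \<Rightarrow> nat \<Rightarrow> state \<Rightarrow> bool" where
  exec_Skip: "exec Skip s 1 s"
| exec_NSet: "exec (NSet a i e) s 1 (set_nat a (nval i s) (nval e s) s)"
| exec_RSet: "exec (RSet a i e) s 1 (set_real a (nval i s) (rval e s) s)"
| exec_Seq: "exec c1 s t1 s' \<Longrightarrow> exec c2 s' t2 s'' \<Longrightarrow> exec (Seq c1 c2) s (t1 + t2) s''"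
| exec_CondT: "bval b s \<Longrightarrow> exec c1 s t s' \<Longrightarrow> exec (Cond b c1 c2) s (Suc t) s'"
| exec_CondF: "\<not> bval b s \<Longrightarrow> exec c2 s t s' \<Longrightarrow> exec (Cond b c1 c2) s (Suc t) s'"
| exec_WhileF: "\<not> bval b s \<Longrightarrow> exec (While b c) s 1 s"
| exec_WhileT: "bval b s \<Longrightarrow> exec c s t1 s' \<Longrightarrow> exec (While b c) s' t2 s'' \<Longrightarrow>
    exec (While b c) s (Suc (t1 + t2)) s''"

inductive_cases exec_SkipE: "exec Skip s t s'"
inductive_cases exec_NSetE: "exec (NSet a i e) s t s'"
inductive_cases exec_RSetE: "exec (RSet a i e) s t s'"
inductive_cases exec_SeqE: "exec (Seq c1 c2) s t s'"
inductive_cases exec_CondE: "exec (Cond b c1 c2) s t s'"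
inductive_cases exec_WhileE: "exec (While b c) s t s'"

lemma exec_deterministic:
  "exec c s t s' \<Longrightarrow> exec c s u s'' \<Longrightarrow> u = t \<and> s'' = s'"
proof (induction arbitrary: u s'' rule: exec.induct)
  case exec_Skip then show ?case by (auto elim: exec_SkipE)
next
  case exec_NSet then show ?case by (auto elim: exec_NSetE)
next
  case exec_RSet then show ?case by (auto elim: exec_RSetE)
next
  case exec_Seq then show ?case by (blast elim: exec_SeqE)
next
  case exec_CondT then show ?case by (blast elim: exec_CondE)
next
  case exec_CondF then show ?case by (blast elim: exec_CondE)
next
  case exec_WhileF then show ?case by (auto elim: exec_WhileE)
next
  case (exec_WhileT b s c t1 s' t2 s3)
  from exec_WhileT.prems exec_WhileT.hyps(1) obtain u1 s1 u2 where
    "u = Suc (u1 + u2)" "exec c s u1 s1" "exec (While b c) s1 u2 s''"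
    by (auto elim: exec_WhileE)
  with exec_WhileT.IH show ?case by blast
qed


section \<open>Approximation algorithms for the center problem\<close>

text \<open>The vertices of an input with \<open>n\<close> vertices are \<open>0, \<dots>, n - 1\<close>, and the distance
  matrix is stored row by row.\<close>

definition input_state ::
    "nat \<Rightarrow> (nat \<Rightarrow> nat \<Rightarrow> real) \<Rightarrow> nat \<Rightarrow> nat \<Rightarrow> nat \<Rightarrow> state" where
  "input_state n d L U p =
     \<lparr>nats = (\<lambda>a i.
        if i \<noteq> 0 then 0
        else if a = ''n'' then n
        else if a = ''L'' then L
        else if a = ''U'' then U
        else if a = ''p'' then p
        else 0),
      reals = (\<lambda>a i.
        if a = ''d'' \<and> i < n * n then d (i div n) (i mod n) else 0)\<rparr>"

text \<open>A real number counts as one unit of input, a natural number as its binary length.\<close>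

definition input_size :: "nat \<Rightarrow> nat \<Rightarrow> nat \<Rightarrow> nat \<Rightarrow> nat" where
  "input_size n L U p = n * n + floorlog 2 L + floorlog 2 U + floorlog 2 p"

definition out_served :: "nat \<Rightarrow> state \<Rightarrow> nat set" where
  "out_served n s = {v. v < n \<and> nats s ''C'' v \<noteq> 0}"

definition out_centers :: "nat \<Rightarrow> state \<Rightarrow> nat set" where
  "out_centers n s = {u. u < n \<and> nats s ''F'' u \<noteq> 0}"

definition out_assignment :: "state \<Rightarrow> nat \<Rightarrow> nat" where
  "out_assignment s = nats s ''phi''"

definition polynomial_time :: "com \<Rightarrow> bool" where
  "polynomial_time c \<longleftrightarrow>
     (\<exists>q :: nat poly. \<forall>n d L U p. center_instance {..<n} d L U \<longrightarrow>
        (\<exists>t s. exec c (input_state n d L U p) t s \<and> t \<le> poly q (input_size n L U p)))"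

definition approximation_algorithm :: "real \<Rightarrow> com \<Rightarrow> bool" where
  "approximation_algorithm \<rho> c \<longleftrightarrow>
     (\<forall>n d L U p. center_instance {..<n} d L U \<longrightarrow>
        (\<exists>C F \<phi>. feasible {..<n} L U p C F \<phi>) \<longrightarrow>
        (\<exists>t s. exec c (input_state n d L U p) t s \<and>
           feasible {..<n} L U p (out_served n s) (out_centers n s) (out_assignment s) \<and>
           sol_value d (out_served n s) (out_assignment s) \<le> \<rho> * opt_value {..<n} d L U p))"

end

theory Submission
  imports Defs
begin

text \<open>
  Guess the optimal value \<open>r\<close> among the pairwise distances and replace a lower bound \<open>0\<close> by \<open>1\<close>. Call
  a vertex dense if at least \<open>L\<close> vertices lie within \<open>r\<close> of it; only dense vertices can be open
  centers. Greedily pick dense vertices at pairwise distance more than \<open>2r\<close>, always preferring one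
  within \<open>4r\<close> of an earlier pick, which becomes its parent. This gives a forest of clusters: a vertex
  joins the cluster of the pick within \<open>r\<close> of it, if any, and otherwise that of the first pick within
  \<open>3r\<close>. Every star of an optimal solution lives in the clusters of a single tree, so a tree with \<open>M\<close>
  vertices contributes at most \<open>min M (\<lfloor>M / L\<rfloor> U)\<close> to the optimum.

  This many vertices can be served. Working upwards, let every cluster form as many stars of size
  \<open>L\<close> as possible and hand its remainder, fewer than \<open>L\<close> vertices, to its parent; then distribute the
  remainder at the root over the stars of the whole tree, up to size \<open>U\<close>. Only the net number of
  vertices crossing a tree edge is moved. A cluster then sends away fewer than \<open>L\<close> vertices, so these
  can be taken from the \<open>r\<close>-ball around its pick, and no vertex crosses more than one edge. Hence
  all vertices of a pool lie within \<open>r + 4r\<close> of its pick, and any star with its center in the same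
  pool has radius at most \<open>10r\<close>. No flow computation is needed.
\<close>

section \<open>Programs with bounded loops\<close>

text \<open>The radii come from an open center \<open>w\<close> of an optimal solution. It is dense,
  so some pick lies within 2r of it, and its star lies within 3r of that pick; the home picks of the
  star are then within 3r + r = 4r of \<open>w\<close>. A pick becomes a root only when every dense
  vertex that has no earlier pick within 2r is more than 4r from all earlier picks. Hence the trees
  are blocks of consecutive picks, and no star can straddle two blocks.

  The obstacle to attaining the bound is that sending remainders up and shares back down could
  exhaust a cluster and carry one vertex over several edges. Let \<open>T i\<close> and
  \<open>X i\<close> be what the edge above \<open>i\<close> carries up and down. The
  \<open>X\<close> of the children of \<open>i\<close> sum to at most \<open>X i\<close>. After
  cancellation on each edge, cluster \<open>i\<close> therefore sends at most \<open>X i\<close>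
  down plus max(\<open>T i\<close> - \<open>X i\<close>, 0) up, that is at most
  max(\<open>T i\<close>, \<open>X i\<close>) < \<open>l\<close> in all. Its own ball already holds
  \<open>l\<close> vertices, so the edges can be processed in any order, without waiting for
  arrivals.\<close>

text \<open>The only loops run exactly \<open>n\<close> times. Hence such a program denotes a total function on states, and
  its running time is bounded by a polynomial in \<open>n\<close> that can be read off from the program text.\<close>

datatype prog =
    PSkip
  | PN vname nexp nexp
  | PR vname nexp rexp
  | PSeq prog prog (infixr ";;" 60)
  | PIf bexp prog prog
  | PFor vname prog

abbreviation scal :: "vname \<Rightarrow> nexp" where "scal a \<equiv> NGet a (NConst 0)"
abbreviation scalR :: "vname \<Rightarrow> rexp" where "scalR a \<equiv> RGet a (NConst 0)"

fun com_of :: "prog \<Rightarrow> com" where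
  "com_of PSkip = Skip"
| "com_of (PN a i e) = NSet a i e"
| "com_of (PR a i e) = RSet a i e"
| "com_of (p ;; q) = Seq (com_of p) (com_of q)"
| "com_of (PIf b p q) = Cond b (com_of p) (com_of q)"
| "com_of (PFor x p) = Seq (NSet x (NConst 0) (NConst 0))
     (While (NLess (scal x) (scal ''n''))
        (Seq (com_of p) (NSet x (NConst 0) (NPlus (scal x) (NConst 1)))))"

text \<open>The counter holds the number of completed rounds by construction. Since
  \<open>well_formed\<close> forbids the body to write \<open>x\<close>, the increment in
  \<open>com_of\<close> stores the same value.\<close>

primrec iterate :: "(state \<Rightarrow> state) \<Rightarrow> vname \<Rightarrow> state \<Rightarrow> nat \<Rightarrow> state" where
  "iterate f x s 0 = set_nat x 0 0 s"
| "iterate f x s (Suc k) = set_nat x 0 (Suc k) (f (iterate f x s k))"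

fun sem :: "prog \<Rightarrow> state \<Rightarrow> state" where
  "sem PSkip s = s"
| "sem (PN a i e) s = set_nat a (nval i s) (nval e s) s"
| "sem (PR a i e) s = set_real a (nval i s) (rval e s) s"
| "sem (p ;; q) s = sem q (sem p s)"
| "sem (PIf b p q) s = (if bval b s then sem p s else sem q s)"
| "sem (PFor x p) s = iterate (sem p) x s (nats s ''n'' 0)"

fun writes :: "prog \<Rightarrow> vname set" where
  "writes PSkip = {}"
| "writes (PN a i e) = {a}"
| "writes (PR a i e) = {}"
| "writes (p ;; q) = writes p \<union> writes q"
| "writes (PIf b p q) = writes p \<union> writes q"
| "writes (PFor x p) = insert x (writes p)"

fun writesR :: "prog \<Rightarrow> vname set" where
  "writesR PSkip = {}"
| "writesR (PN a i e) = {}"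
| "writesR (PR a i e) = {a}"
| "writesR (p ;; q) = writesR p \<union> writesR q"
| "writesR (PIf b p q) = writesR p \<union> writesR q"
| "writesR (PFor x p) = writesR p"

fun well_formed :: "prog \<Rightarrow> bool" where
  "well_formed (p ;; q) \<longleftrightarrow> well_formed p \<and> well_formed q"
| "well_formed (PIf b p q) \<longleftrightarrow> well_formed p \<and> well_formed q"
| "well_formed (PFor x p) \<longleftrightarrow> well_formed p \<and> x \<noteq> ''n'' \<and> x \<notin> writes p"
| "well_formed (PN a i e) \<longleftrightarrow> a \<noteq> ''n''"
| "well_formed _ \<longleftrightarrow> True"

text \<open>The outer 2 of a loop pays for initialising the counter and for the failing last test,
  the inner 2 for the test and the increment of each round; \<open>[:0, 1:]\<close> is the number of
  rounds \<open>n\<close>. The costs of branches are added rather than maximised so that the bound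
  stays a polynomial.\<close>

fun cost :: "prog \<Rightarrow> nat poly" where
  "cost (p ;; q) = cost p + cost q"
| "cost (PIf b p q) = 1 + cost p + cost q"
| "cost (PFor x p) = 2 + [:0, 1:] * (cost p + 2)"
| "cost _ = 1"

section \<open>Frame rules, agreement with the machine semantics, and running time\<close>

lemma nats_set_nat [simp]: "nats (set_nat a i x s) = (nats s)(a := (nats s a)(i := x))"
  and reals_set_nat [simp]: "reals (set_nat a i x s) = reals s"
  and nats_set_real [simp]: "nats (set_real a i y s) = nats s"
  and reals_set_real [simp]: "reals (set_real a i y s) = (reals s)(a := (reals s a)(i := y))"
  by (simp_all add: set_nat_def set_real_def)

lemma nats_iterate:
  assumes "\<And>s. nats (f s) a = nats s a" "a \<noteq> x"
  shows "nats (iterate f x s k) a = nats s a"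
  using assms by (induction k) auto

lemma reals_iterate:
  assumes "\<And>s. reals (f s) a = reals s a"
  shows "reals (iterate f x s k) a = reals s a"
  using assms by (induction k) auto

lemma nats_sem: "a \<notin> writes p \<Longrightarrow> nats (sem p s) a = nats s a"
  by (induction p arbitrary: s) (auto intro!: nats_iterate)

lemma reals_sem: "a \<notin> writesR p \<Longrightarrow> reals (sem p s) a = reals s a"
  by (induction p arbitrary: s) (auto intro!: reals_iterate)

lemma iterate_counter: "nats (iterate f x s k) x 0 = k"
  by (cases k) auto

lemma well_formed_n: "well_formed p \<Longrightarrow> ''n'' \<notin> writes p"
  by (induction p) auto

text \<open>Induction on the number \<open>m\<close> of rounds still to run, because the big-step
  rule for loops unfolds at the front. One bound \<open>T\<close> serves all rounds since no
  well-formed body changes \<open>n\<close>.\<close>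

lemma exec_while_iterate:
  assumes body: "\<And>s. nats s ''n'' 0 = N \<Longrightarrow> \<exists>t. exec (com_of p) s t (sem p s) \<and> t \<le> T"
    and wf: "well_formed (PFor x p)" and n: "nats s ''n'' 0 = N" and "k + m = N"
  shows "\<exists>t. exec (While (NLess (scal x) (scal ''n''))
      (Seq (com_of p) (NSet x (NConst 0) (NPlus (scal x) (NConst 1)))))
      (iterate (sem p) x s k) t (iterate (sem p) x s N) \<and> t \<le> m * (T + 2) + 1"
  using \<open>k + m = N\<close>
proof (induction m arbitrary: k)
  case 0
  have "nats (iterate (sem p) x s N) ''n'' 0 = N"
    using wf n by (subst nats_iterate) (auto simp: nats_sem well_formed_n)
  then have "\<not> bval (NLess (scal x) (scal ''n'')) (iterate (sem p) x s N)"
    by (simp add: iterate_counter)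
  from exec_WhileF[OF this] show ?case
    using 0 by (intro exI[of _ 1]) simp
next
  case (Suc m)
  let ?s = "iterate (sem p) x s k"
  have nk: "nats ?s ''n'' 0 = N"
    using wf n by (subst nats_iterate) (auto simp: nats_sem well_formed_n)
  obtain t where t: "exec (com_of p) ?s t (sem p ?s)" "t \<le> T"
    using body[OF nk] by blast
  have x: "nats (sem p ?s) x 0 = k"
    using wf by (simp add: nats_sem iterate_counter)
  have inc: "exec (NSet x (NConst 0) (NPlus (scal x) (NConst 1))) (sem p ?s) 1
      (iterate (sem p) x s (Suc k))"
    using exec_NSet[of x "NConst 0" "NPlus (scal x) (NConst 1)" "sem p ?s"] x by simp
  obtain t' where t': "exec (While (NLess (scal x) (scal ''n''))
      (Seq (com_of p) (NSet x (NConst 0) (NPlus (scal x) (NConst 1)))))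
      (iterate (sem p) x s (Suc k)) t' (iterate (sem p) x s N)" "t' \<le> m * (T + 2) + 1"
    using Suc.IH[of "Suc k"] Suc.prems by auto
  have "bval (NLess (scal x) (scal ''n'')) ?s"
    using Suc.prems nk by (simp add: iterate_counter)
  from exec_WhileT[OF this exec_Seq[OF t(1) inc] t'(1)] t(2) t'(2) show ?case
    by (intro exI conjI) auto
qed

lemma exec_sem:
  "well_formed p \<Longrightarrow> \<exists>t. exec (com_of p) s t (sem p s) \<and> t \<le> poly (cost p) (nats s ''n'' 0)"
proof (induction p arbitrary: s)
  case PSkip
  then show ?case by (auto intro: exec.intros)
next
  case (PN a i e)
  then show ?case by (auto intro: exec.intros)
next
  case (PR a i e)
  then show ?case by (auto intro: exec.intros)
next
  case (PSeq p q)
  obtain t1 where t1: "exec (com_of p) s t1 (sem p s)" "t1 \<le> poly (cost p) (nats s ''n'' 0)"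
    using PSeq by fastforce
  obtain t2 where t2: "exec (com_of q) (sem p s) t2 (sem q (sem p s))"
      "t2 \<le> poly (cost q) (nats (sem p s) ''n'' 0)"
    using PSeq by fastforce
  have "nats (sem p s) ''n'' 0 = nats s ''n'' 0"
    using PSeq.prems by (simp add: nats_sem well_formed_n)
  then have "t1 + t2 \<le> poly (cost (p ;; q)) (nats s ''n'' 0)" using t1 t2 by simp
  then show ?case using exec_Seq[OF t1(1) t2(1)] by auto
next
  case (PIf b p q)
  show ?case
  proof (cases "bval b s")
    case True
    obtain t where "exec (com_of p) s t (sem p s)" "t \<le> poly (cost p) (nats s ''n'' 0)"
      using PIf by fastforce
    then show ?thesis using True by (intro exI[of _ "Suc t"]) (auto intro: exec_CondT)
  next
    case False
    obtain t where "exec (com_of q) s t (sem q s)" "t \<le> poly (cost q) (nats s ''n'' 0)"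
      using PIf by fastforce
    then show ?thesis using False by (intro exI[of _ "Suc t"]) (auto intro: exec_CondF)
  qed
next
  case (PFor x p)
  let ?N = "nats s ''n'' 0"
  have "\<exists>t. exec (com_of p) s' t (sem p s') \<and> t \<le> poly (cost p) ?N"
    if "nats s' ''n'' 0 = ?N" for s'
    using PFor.IH[of s'] PFor.prems that by auto
  from exec_while_iterate[OF this PFor.prems refl, of s 0 ?N] obtain t where
    t: "exec (While (NLess (scal x) (scal ''n''))
      (Seq (com_of p) (NSet x (NConst 0) (NPlus (scal x) (NConst 1)))))
      (set_nat x 0 0 s) t (iterate (sem p) x s ?N)" "t \<le> ?N * (poly (cost p) ?N + 2) + 1"
    by auto
  have "exec (NSet x (NConst 0) (NConst 0)) s 1 (set_nat x 0 0 s)"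
    using exec_NSet[of x "NConst 0" "NConst 0" s] by simp
  from exec_Seq[OF this t(1)] t(2) show ?case
    by (intro exI conjI) auto
qed

lemma poly_nat_mono: "m \<le> k \<Longrightarrow> poly q m \<le> poly q (k :: nat)"
  by (induction q) (auto intro: add_mono mult_mono)

text \<open>Loop counts depend on \<open>n\<close> alone, and \<open>n\<close> is at most
  \<open>n * n\<close>; the magnitudes of \<open>L\<close>, \<open>U\<close> and \<open>p\<close> do
  not enter. The bound holds on infeasible inputs as well.\<close>

lemma polynomial_time_prog:
  assumes "well_formed p"
  shows "polynomial_time (com_of p)"
  unfolding polynomial_time_def
proof (intro exI[of _ "cost p"] allI impI)
  fix n d L U q
  let ?s = "input_state n d L U q"
  obtain t where t: "exec (com_of p) ?s t (sem p ?s)" "t \<le> poly (cost p) (nats ?s ''n'' 0)"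
    using exec_sem[OF assms] by blast
  have "nats ?s ''n'' 0 \<le> input_size n L U q"
    using le_square[of n] by (simp add: input_state_def input_size_def trans_le_add1)
  from poly_nat_mono[OF this] t
  show "\<exists>t s. exec (com_of p) ?s t s \<and> t \<le> poly (cost p) (input_size n L U q)"
    by (meson le_trans)
qed

text \<open>An invariant rule with the frame conditions built in: \<open>I\<close> needs to speak
  only of what the body writes, and every other array can be read off from the initial state
  \<open>s\<close>.\<close>

lemma sem_PFor_induct:
  assumes "\<And>k s'. k < N \<Longrightarrow> I k s' \<Longrightarrow> nats s' x 0 = k \<Longrightarrow>
      (\<And>a. a \<noteq> x \<Longrightarrow> a \<notin> writes p \<Longrightarrow> nats s' a = nats s a) \<Longrightarrow>
      (\<And>a. a \<notin> writesR p \<Longrightarrow> reals s' a = reals s a) \<Longrightarrow>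
      I (Suc k) (set_nat x 0 (Suc k) (sem p s'))"
    and "I 0 (set_nat x 0 0 s)" and "nats s ''n'' 0 = N"
  shows "I N (sem (PFor x p) s)"
proof -
  have "k \<le> N \<Longrightarrow> I k (iterate (sem p) x s k)" for k
  proof (induction k)
    case 0
    then show ?case using assms(2) by simp
  next
    case (Suc k)
    then have "I k (iterate (sem p) x s k)" by simp
    from assms(1)[OF _ this] Suc.prems show ?case
      by (simp add: iterate_counter nats_iterate nats_sem reals_iterate reals_sem)
  qed
  then show ?thesis using assms(3) by simp
qed

section \<open>Clustering and the bound on the optimum\<close>

fun root_of :: "(nat \<Rightarrow> nat) \<Rightarrow> nat \<Rightarrow> nat" where
  "root_of par 0 = 0"
| "root_of par (Suc i) = (if par (Suc i) = 0 then Suc i else root_of par i)"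

lemma root_of_le: "root_of par i \<le> i"
  by (induction i) auto

lemma root_of_greatest: "j \<le> i \<Longrightarrow> par j = 0 \<Longrightarrow> j \<le> root_of par i"
  by (induction i) (auto simp: le_Suc_eq)

lemma root_of_root: "par 0 = 0 \<Longrightarrow> par (root_of par i) = 0"
  by (induction i) auto

lemma root_of_id: "par i = 0 \<Longrightarrow> root_of par i = i"
  by (cases i) auto

text \<open>\<open>root_of\<close> does not follow parent links; it is the last parentless index up
  to \<open>i\<close>. Its classes are therefore intervals, and this lemma is the resulting
  convexity. That the parent links stay inside an interval is a property of the greedy order, shown
  in \<open>root_of_par\<close>.\<close>

lemma root_of_eq:
  assumes "par 0 = 0" "root_of par i \<le> j" "j \<le> i"
  shows "root_of par j = root_of par i"
proof (rule antisym)
  show "root_of par j \<le> root_of par i"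
    using assms root_of_le[of par j] root_of_root[of par j] root_of_greatest[of "root_of par j" i par]
    by simp
  show "root_of par i \<le> root_of par j"
    using assms root_of_root[of par i] root_of_greatest[of "root_of par i" j par] by simp
qed

definition children :: "nat \<Rightarrow> (nat \<Rightarrow> nat) \<Rightarrow> nat \<Rightarrow> nat set" where
  "children K par i = {c. c < K \<and> par c = Suc i}"

definition component :: "nat \<Rightarrow> (nat \<Rightarrow> nat) \<Rightarrow> nat \<Rightarrow> nat set" where
  "component K par k = {i. i < K \<and> root_of par i = k}"

lemma finite_children [simp]: "finite (children K par i)"
  and finite_component [simp]: "finite (component K par k)"
  by (simp_all add: children_def component_def)

section \<open>Greedy clustering at a fixed radius\<close>

locale radius_instance =
  fixes n l U :: nat and d :: "nat \<Rightarrow> nat \<Rightarrow> real" and r :: real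
  assumes sym: "u < n \<Longrightarrow> v < n \<Longrightarrow> d u v = d v u"
    and tri: "u < n \<Longrightarrow> v < n \<Longrightarrow> w < n \<Longrightarrow> d u w \<le> d u v + d v w"
    and r_nonneg: "0 \<le> r" and l_pos: "0 < l" and l_le: "l \<le> U"
begin

definition dense :: "nat \<Rightarrow> bool" where
  "dense u \<longleftrightarrow> u < n \<and> l \<le> card {v. v < n \<and> d u v \<le> r}"

lemma dense_less: "dense u \<Longrightarrow> u < n"
  by (simp add: dense_def)

text \<open>The distance axioms do not make \<open>d u u\<close> zero. The bound comes from walking
  to a vertex of the ball and back; the ball is nonempty as \<open>0 < l\<close>. It guarantees that
  a pick covers itself.\<close>

lemma dense_self:
  assumes "dense u"
  shows "d u u \<le> 2 * r"
proof -
  have "{v. v < n \<and> d u v \<le> r} \<noteq> {}"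
  proof
    assume "{v. v < n \<and> d u v \<le> r} = {}"
    then have "card {v. v < n \<and> d u v \<le> r} = 0" by (simp only: card.empty)
    then show False using assms l_pos unfolding dense_def by linarith
  qed
  then obtain v where "v < n" "d u v \<le> r" by auto
  then show ?thesis using tri[of u v u] sym[of u v] dense_less[OF assms] by simp
qed

end

text \<open>The state of the greedy clustering after \<open>K\<close> rounds. The entries of \<open>par\<close>, \<open>near\<close> and \<open>home\<close>
  are indices shifted by one, so that \<open>0\<close> stands for ``none''.\<close>

locale clustering = radius_instance +
  fixes K :: nat and ctr par cov near home ball :: "nat \<Rightarrow> nat"
  assumes ctr_dense: "i < K \<Longrightarrow> dense (ctr i)"
    and ctr_sep: "i < K \<Longrightarrow> j < i \<Longrightarrow> 2 * r < d (ctr j) (ctr i)"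
    and cov_0: "v < n \<Longrightarrow> cov v = 0 \<longleftrightarrow> (\<forall>i<K. 2 * r < d (ctr i) v)"
    and near_0: "v < n \<Longrightarrow> near v = 0 \<Longrightarrow> i < K \<Longrightarrow> 4 * r < d (ctr i) v"
    and near_Suc: "v < n \<Longrightarrow> near v = Suc i \<Longrightarrow> i < K \<and> d (ctr i) v \<le> 4 * r"
    and par_Suc: "i < K \<Longrightarrow> par i = Suc j \<Longrightarrow> j < i \<and> d (ctr j) (ctr i) \<le> 4 * r"
    and par_0: "k < K \<Longrightarrow> par k = 0 \<Longrightarrow> dense w \<Longrightarrow>
        (\<exists>j<k. d (ctr j) w \<le> 2 * r) \<or> (\<forall>j<k. 4 * r < d (ctr j) w)"
    and home_0: "v < n \<Longrightarrow> home v = 0 \<Longrightarrow> j < K \<Longrightarrow> 3 * r < d (ctr j) v"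
    and home_Suc: "v < n \<Longrightarrow> home v = Suc i \<Longrightarrow> i < K \<and> d (ctr i) v \<le> 3 * r"
    and ball_1: "v < n \<Longrightarrow> ball v \<noteq> 0 \<Longrightarrow> \<exists>i. home v = Suc i \<and> d (ctr i) v \<le> r"
    and ball_0: "v < n \<Longrightarrow> ball v = 0 \<Longrightarrow> j < K \<Longrightarrow> r < d (ctr j) v"
    and ball_0_first: "v < n \<Longrightarrow> ball v = 0 \<Longrightarrow> home v = Suc i \<Longrightarrow> j < i \<Longrightarrow> 3 * r < d (ctr j) v"

lemma (in radius_instance) clustering_empty:
  assumes "\<And>v. v < n \<Longrightarrow> cov v = 0 \<and> near v = 0 \<and> home v = 0 \<and> ball v = 0"
  shows "clustering n l U d r 0 ctr par cov near home ball"
  by unfold_locales (use assms in auto)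

context clustering
begin

text \<open>The premise \<open>first\<close> is the preference rule: a parentless pick is made only
  if no uncovered dense vertex has an earlier pick within 4r, which is what \<open>par_0\<close>
  records for a new root. Since \<open>near\<close> is overwritten, the parent is the latest pick
  within 4r. In contrast \<open>home\<close> keeps the earliest pick within 3r, except that the new
  \<open>r\<close>-ball claims all its vertices.\<close>

lemma clustering_extend:
  assumes u: "dense u" "cov u = 0"
    and first: "near u = 0 \<Longrightarrow> (\<forall>w. dense w \<longrightarrow> cov w = 0 \<longrightarrow> near w = 0)"
    and cov': "\<And>v. v < n \<Longrightarrow> cov' v = (if d u v \<le> 2 * r then 1 else cov v)"
    and near': "\<And>v. v < n \<Longrightarrow> near' v = (if d u v \<le> 4 * r then Suc K else near v)"
    and home': "\<And>v. v < n \<Longrightarrow> home' v = (if d u v \<le> r then Suc K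
       else if home v = 0 \<and> d u v \<le> 3 * r then Suc K else home v)"
    and ball': "\<And>v. v < n \<Longrightarrow> ball' v = (if d u v \<le> r then 1 else ball v)"
  shows "clustering n l U d r (Suc K) (ctr(K := u)) (par(K := near u)) cov' near' home' ball'"
proof -
  have un: "u < n" using u dense_less by blast
  have c1: "\<forall>i<Suc K. dense ((ctr(K := u)) i)"
    using ctr_dense u by (simp add: less_Suc_eq)
  have c2: "\<forall>i<Suc K. \<forall>j<i. 2 * r < d ((ctr(K := u)) j) ((ctr(K := u)) i)"
    using ctr_sep cov_0[OF un] u by (auto simp: less_Suc_eq)
  have c3: "\<forall>v<n. cov' v = 0 \<longleftrightarrow> (\<forall>i<Suc K. 2 * r < d ((ctr(K := u)) i) v)"
    using cov_0 cov' by (auto simp: less_Suc_eq)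
  have c4: "\<forall>v<n. near' v = 0 \<longrightarrow> (\<forall>i<Suc K. 4 * r < d ((ctr(K := u)) i) v)"
    using near_0 near' by (auto simp: less_Suc_eq split: if_splits)
  have c5: "\<forall>v<n. \<forall>i. near' v = Suc i \<longrightarrow> i < Suc K \<and> d ((ctr(K := u)) i) v \<le> 4 * r"
  proof (intro allI impI)
    fix v i assume v: "v < n" "near' v = Suc i"
    show "i < Suc K \<and> d ((ctr(K := u)) i) v \<le> 4 * r"
    proof (cases "d u v \<le> 4 * r")
      case True
      then show ?thesis using near' v by simp
    next
      case False
      then show ?thesis using near'[OF v(1)] near_Suc[OF v(1), of i] v by simp
    qed
  qed
  have c6: "\<forall>i<Suc K. \<forall>j. (par(K := near u)) i = Suc j \<longrightarrow>
      j < i \<and> d ((ctr(K := u)) j) ((ctr(K := u)) i) \<le> 4 * r"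
  proof (intro allI impI)
    fix i j assume i: "i < Suc K" "(par(K := near u)) i = Suc j"
    show "j < i \<and> d ((ctr(K := u)) j) ((ctr(K := u)) i) \<le> 4 * r"
    proof (cases "i = K")
      case True
      then show ?thesis using near_Suc[OF un, of j] i by simp
    next
      case False
      then show ?thesis using par_Suc[of i j] i by auto
    qed
  qed
  have c7: "\<forall>k<Suc K. (par(K := near u)) k = 0 \<longrightarrow> (\<forall>w. dense w \<longrightarrow>
        (\<exists>j<k. d ((ctr(K := u)) j) w \<le> 2 * r) \<or> (\<forall>j<k. 4 * r < d ((ctr(K := u)) j) w))"
  proof (intro allI impI)
    fix k w assume k: "k < Suc K" "(par(K := near u)) k = 0" and w: "dense w"
    show "(\<exists>j<k. d ((ctr(K := u)) j) w \<le> 2 * r) \<or> (\<forall>j<k. 4 * r < d ((ctr(K := u)) j) w)"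
    proof (cases "k = K")
      case True
      have "w < n" using w dense_less by blast
      show ?thesis
      proof (cases "cov w = 0")
        case 1: True
        then have "near w = 0" using first k True w by simp
        then show ?thesis using near_0[OF \<open>w < n\<close>] True by simp
      next
        case False
        then show ?thesis using cov_0[OF \<open>w < n\<close>] True by (auto simp: not_less)
      qed
    next
      case False
      then have k': "k < K" "par k = 0" using k by auto
      then have "(ctr(K := u)) j = ctr j" if "j < k" for j using that by simp
      then show ?thesis using par_0[OF k' w] by metis
    qed
  qed
  have c8: "\<forall>v<n. home' v = 0 \<longrightarrow> (\<forall>j<Suc K. 3 * r < d ((ctr(K := u)) j) v)"
    using home_0 home' r_nonneg by (auto simp: less_Suc_eq split: if_splits)
  have c9: "\<forall>v<n. \<forall>i. home' v = Suc i \<longrightarrow> i < Suc K \<and> d ((ctr(K := u)) i) v \<le> 3 * r"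
  proof (intro allI impI)
    fix v i assume v: "v < n" "home' v = Suc i"
    show "i < Suc K \<and> d ((ctr(K := u)) i) v \<le> 3 * r"
    proof (cases "home' v = home v")
      case True
      then show ?thesis using home_Suc[OF v(1), of i] v by simp
    next
      case False
      then show ?thesis using home'[OF v(1)] v r_nonneg by (auto split: if_splits)
    qed
  qed
  have c10: "\<forall>v<n. ball' v \<noteq> 0 \<longrightarrow> (\<exists>i. home' v = Suc i \<and> d ((ctr(K := u)) i) v \<le> r)"
  proof (intro allI impI)
    fix v assume v: "v < n" "ball' v \<noteq> 0"
    show "\<exists>i. home' v = Suc i \<and> d ((ctr(K := u)) i) v \<le> r"
    proof (cases "d u v \<le> r")
      case True
      then show ?thesis using home' v by auto
    next
      case False
      then have "ball v \<noteq> 0" using ball' v by simp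
      then obtain i where i: "home v = Suc i" "d (ctr i) v \<le> r"
        using ball_1 v by blast
      then have "i < K" using home_Suc v by blast
      then show ?thesis using i home'[OF v(1)] False by auto
    qed
  qed
  have c11: "\<forall>v<n. ball' v = 0 \<longrightarrow> (\<forall>j<Suc K. r < d ((ctr(K := u)) j) v)"
    using ball_0 ball' by (auto simp: less_Suc_eq split: if_splits)
  have c12: "\<forall>v<n. \<forall>i. ball' v = 0 \<longrightarrow> home' v = Suc i \<longrightarrow> (\<forall>j<i. 3 * r < d ((ctr(K := u)) j) v)"
  proof (intro allI impI)
    fix v i j assume v: "v < n" "ball' v = 0" "home' v = Suc i" "j < i"
    have b: "ball v = 0" "\<not> d u v \<le> r" using ball' v by (auto split: if_splits)
    show "3 * r < d ((ctr(K := u)) j) v"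
    proof (cases "home v = 0 \<and> d u v \<le> 3 * r")
      case True
      then have "i = K" using home' v b by simp
      then show ?thesis using True home_0 v by simp
    next
      case False
      then have h: "home v = Suc i" using home'[OF v(1)] v b by auto
      then have "i < K" using home_Suc v by blast
      then show ?thesis using ball_0_first[OF v(1) b(1) h] v by simp
    qed
  qed
  show ?thesis
    by unfold_locales (fact c1[rule_format] c2[rule_format] c3[rule_format] c4[rule_format]
      c5[rule_format] c6[rule_format] c7[rule_format] c8[rule_format] c9[rule_format]
      c10[rule_format] c11[rule_format] c12[rule_format])+
qed

end

section \<open>Each star of an optimal solution lies in one tree\<close>

locale clustered = clustering +
  assumes covered: "dense w \<Longrightarrow> cov w \<noteq> 0"
begin

lemma ctr_less: "i < K \<Longrightarrow> ctr i < n"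
  using ctr_dense dense_less by blast

lemma dense_near_ctr: "dense w \<Longrightarrow> \<exists>i<K. d (ctr i) w \<le> 2 * r"
  using cov_0[OF dense_less] covered[of w] by (meson not_less)

lemma sep_ne:
  assumes "i < K" "j < K" "d (ctr i) (ctr j) \<le> 2 * r"
  shows "i = j"
  using assms ctr_sep[of i j] ctr_sep[of j i] sym[of "ctr i" "ctr j"] ctr_less
  by (metis linorder_neqE_nat not_less)

text \<open>Two picks within \<open>r\<close> of a common vertex would be within 2r of each other,
  so the balls are disjoint and no other pick can have claimed \<open>v\<close> as a ball
  vertex.\<close>

lemma in_ball:
  assumes "i < K" "v < n" "d (ctr i) v \<le> r"
  shows "home v = Suc i" "ball v \<noteq> 0"
proof -
  show b: "ball v \<noteq> 0" using ball_0[of v i] assms by auto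
  obtain j where j: "home v = Suc j" "d (ctr j) v \<le> r" using ball_1[OF assms(2) b] by blast
  then have "j < K" using home_Suc assms by blast
  have "d (ctr i) (ctr j) \<le> d (ctr i) v + d v (ctr j)"
    using tri ctr_less \<open>j < K\<close> assms by simp
  then have "d (ctr i) (ctr j) \<le> 2 * r"
    using assms j sym[of v "ctr j"] ctr_less[OF \<open>j < K\<close>] by simp
  then show "home v = Suc i" using sep_ne \<open>j < K\<close> assms j by blast
qed

text \<open>This is the stock of movable vertices from which a cluster later covers all that it
  sends away.\<close>

lemma card_ball:
  assumes "i < K"
  shows "l \<le> card {v. v < n \<and> ball v \<noteq> 0 \<and> home v = Suc i}"
proof -
  have "card {v. v < n \<and> d (ctr i) v \<le> r} \<le> card {v. v < n \<and> ball v \<noteq> 0 \<and> home v = Suc i}"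
    by (intro card_mono) (use in_ball[OF assms] in auto)
  then show ?thesis using ctr_dense[OF assms] by (simp add: dense_def)
qed

lemma par_zero: "0 < K \<Longrightarrow> par 0 = 0"
  using par_Suc[of 0] by (cases "par 0") auto

text \<open>When the root of the block of \<open>i\<close> was picked, \<open>ctr i\<close> was not
  covered, by separation. As the new pick had no parent, \<open>par_0\<close> puts all earlier picks
  more than 4r away from \<open>ctr i\<close>; the parent, within 4r, must belong to the
  block.\<close>

lemma root_of_par:
  assumes "i < K" "par i = Suc j"
  shows "root_of par j = root_of par i"
proof -
  let ?k = "root_of par i"
  have p0: "par 0 = 0" using par_zero assms by simp
  have k: "?k < K" "par ?k = 0" using root_of_le[of par i] assms root_of_root[of par i, OF p0] by auto
  have ki: "?k \<le> i" by (rule root_of_le)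
  have "\<not> (\<exists>j<?k. d (ctr j) (ctr i) \<le> 2 * r)"
    using ctr_sep[OF assms(1)] ki by (meson leD less_le_trans)
  then have far: "\<forall>j<?k. 4 * r < d (ctr j) (ctr i)"
    using par_0[OF k ctr_dense[OF assms(1)]] by blast
  have "?k \<le> j" using far par_Suc[OF assms] by (meson leD leI)
  then show ?thesis using root_of_eq[of par, OF p0] par_Suc[OF assms] by simp
qed

text \<open>Let \<open>i\<close> be the first pick within 2r of \<open>w\<close>. A vertex
  \<open>v\<close> of the ball of \<open>w\<close> that lies in no \<open>r\<close>-ball of a pick
  has its home \<open>j\<close> at or before \<open>i\<close>; a vertex that lies in such a ball has
  its home \<open>j\<close> at or after \<open>i\<close>. In both cases \<open>par_0\<close>,
  applied at the root of the later of the two picks, forces the earlier one into the same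
  block.\<close>

lemma dense_component:
  assumes w: "dense w"
  shows "\<exists>k<K. par k = 0 \<and> (\<forall>v<n. d w v \<le> r \<longrightarrow> (\<exists>i. home v = Suc i \<and> i \<in> component K par k))"
proof -
  let ?P = "\<lambda>i. i < K \<and> d (ctr i) w \<le> 2 * r"
  define i where "i = (LEAST i. ?P i)"
  have i: "?P i" unfolding i_def by (rule LeastI_ex) (use dense_near_ctr[OF w] in blast)
  have least: "i \<le> j" if "?P j" for j unfolding i_def using that by (rule Least_le)
  have wn: "w < n" using w dense_less by blast
  have p0: "par 0 = 0" using par_zero i by simp
  let ?k = "root_of par i"
  have k: "?k < K" "par ?k = 0" using root_of_le[of par i] i root_of_root[of par i, OF p0] by auto
  have ki: "?k \<le> i" by (rule root_of_le)
  \<comment> \<open>No pick before the root is within 2r of \<open>w\<close>, since \<open>i\<close>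
    is the first such pick and the root does not exceed \<open>i\<close>. Then \<open>par_0\<close>
    at the root leaves only its second alternative.\<close>
  have far: "4 * r < d (ctr j) w" if "j < ?k" for j
  proof -
    have "\<not> (\<exists>j<?k. d (ctr j) w \<le> 2 * r)"
      using least i ki by (meson leD less_le_trans less_trans)
    then show ?thesis using par_0[OF k w] that by blast
  qed
  have "\<exists>j. home v = Suc j \<and> j \<in> component K par ?k" if v: "v < n" "d w v \<le> r" for v
  proof (cases "ball v = 0")
    case True
    have "d (ctr i) v \<le> 3 * r" using tri[of "ctr i" w v] i v wn ctr_less by force
    then have "home v \<noteq> 0" using home_0[of v i] v i by auto
    then obtain j where j: "home v = Suc j" by (cases "home v") auto
    then have jK: "j < K" "d (ctr j) v \<le> 3 * r" using home_Suc v by auto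
    have "j \<le> i" using ball_0_first[OF v(1) True j, of i] \<open>d (ctr i) v \<le> 3 * r\<close> by force
    have "d (ctr j) w \<le> 4 * r"
      using tri[of "ctr j" v w] sym[of v w] jK v wn ctr_less by force
    then have "?k \<le> j" using far[of j] by force
    then have "root_of par j = ?k" using root_of_eq[of par, OF p0] \<open>j \<le> i\<close> by blast
    then show ?thesis using j jK by (auto simp: component_def)
  next
    case False
    obtain j where j: "home v = Suc j" "d (ctr j) v \<le> r" using ball_1[OF v(1) False] by blast
    have jK: "j < K" using home_Suc v j by blast
    have jw: "d (ctr j) w \<le> 2 * r"
      using tri[of "ctr j" v w] sym[of v w] jK j v wn ctr_less by force
    then have "i \<le> j" using least jK by blast
    have ji: "d (ctr i) (ctr j) \<le> 4 * r"
      using tri[of "ctr i" w "ctr j"] sym[of w "ctr j"] i jw jK wn ctr_less by force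
    \<comment> \<open>Now \<open>j\<close> is the later pick, so \<open>par_0\<close> is used at the
      root of \<open>j\<close> and for the dense vertex \<open>ctr j\<close>, which separation keeps
      uncovered by all earlier picks.\<close>
    let ?k' = "root_of par j"
    have k': "?k' < K" "par ?k' = 0" "?k' \<le> j"
      using root_of_le[of par j] jK root_of_root[of par j, OF p0] by auto
    have "\<not> (\<exists>m<?k'. d (ctr m) (ctr j) \<le> 2 * r)"
      using ctr_sep[OF jK] k' by (meson leD less_le_trans)
    then have "\<forall>m<?k'. 4 * r < d (ctr m) (ctr j)"
      using par_0[OF k'(1,2) ctr_dense[OF jK]] by blast
    then have "?k' \<le> i" using ji by (meson leD leI)
    then have "root_of par i = ?k'" using root_of_eq[of par, OF p0] \<open>i \<le> j\<close> by blast
    then show ?thesis using j jK by (auto simp: component_def)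
  qed
  then show ?thesis using k by blast
qed

lemma root_in_component: "k < K \<Longrightarrow> par k = 0 \<Longrightarrow> k \<in> component K par k"
  by (simp add: component_def root_of_id)

text \<open>Every pick of a tree other than its root is the child of exactly one pick of that tree.
  A conservation law summed over the tree thus telescopes to a term at the root; it is used for both
  \<open>T\<close> and \<open>X\<close>.\<close>

lemma sum_children:
  fixes g :: "nat \<Rightarrow> nat"
  assumes k: "k < K" "par k = 0"
  shows "(\<Sum>i\<in>component K par k. \<Sum>c\<in>children K par i. g c) + g k = (\<Sum>i\<in>component K par k. g i)"
proof -
  let ?S = "component K par k"
  have "(\<Sum>i\<in>?S. \<Sum>c\<in>children K par i. g c) = sum g (\<Union>i\<in>?S. children K par i)"
    by (rule sum.UNION_disjoint[symmetric]) (auto simp: children_def)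
  also have "(\<Union>i\<in>?S. children K par i) = ?S - {k}"
  proof
    show "(\<Union>i\<in>?S. children K par i) \<subseteq> ?S - {k}"
    proof
      fix c assume "c \<in> (\<Union>i\<in>?S. children K par i)"
      then obtain i where "i \<in> ?S" and c: "c < K" "par c = Suc i" by (auto simp: children_def)
      then show "c \<in> ?S - {k}" using root_of_par[OF c] k by (auto simp: component_def)
    qed
    show "?S - {k} \<subseteq> (\<Union>i\<in>?S. children K par i)"
    proof
      fix c assume c: "c \<in> ?S - {k}"
      then have "par c \<noteq> 0" using root_of_id[of par c] by (auto simp: component_def)
      then obtain j where j: "par c = Suc j" by (cases "par c") auto
      then have "j \<in> ?S" using c root_of_par[of c j] par_Suc[of c j] by (auto simp: component_def)
      then show "c \<in> (\<Union>i\<in>?S. children K par i)"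
        using c j by (auto simp: children_def component_def)
    qed
  qed
  finally show ?thesis
    using root_in_component[OF k] sum.remove[of ?S k g] by simp
qed

end

text \<open>Cluster \<open>i\<close> forms \<open>a\<close> stars, where \<open>A i = a * l\<close>, and has the capacity \<open>G i = a * (U - l)\<close> for further
  vertices, of which \<open>x i\<close> is used; \<open>T i\<close> is the remainder it hands to its parent, and \<open>X i\<close> is the sum of
  \<open>x\<close> over its subtree, which flows back.\<close>

locale quotas = clustered +
  fixes T A G x X :: "nat \<Rightarrow> nat"
  assumes T_less: "i < K \<Longrightarrow> T i < l"
    and AG: "i < K \<Longrightarrow> \<exists>a. A i = a * l \<and> G i = a * (U - l)"
    and AT: "i < K \<Longrightarrow> A i + T i = card {v. v < n \<and> home v = Suc i} + (\<Sum>c\<in>children K par i. T c)"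
    and x_le: "i < K \<Longrightarrow> x i \<le> G i"
    and x_sum: "k < K \<Longrightarrow> par k = 0 \<Longrightarrow> \<exists>e. e + sum x (component K par k) = T k \<and>
       (0 < e \<longrightarrow> (\<forall>i\<in>component K par k. x i = G i))"
    and X_eq: "i < K \<Longrightarrow> X i = x i + (\<Sum>c\<in>children K par i. X c)"
begin

section \<open>Upper bound on the number of served vertices\<close>

lemma sum_A:
  assumes k: "k < K" "par k = 0"
  shows "sum A (component K par k) + T k =
    card {v. v < n \<and> (\<exists>i\<in>component K par k. home v = Suc i)}"
proof -
  let ?S = "component K par k"
  have "sum A ?S + sum T ?S = (\<Sum>i\<in>?S. A i + T i)"
    by (simp add: sum.distrib)
  also have "\<dots> = (\<Sum>i\<in>?S. card {v. v < n \<and> home v = Suc i} + (\<Sum>c\<in>children K par i. T c))"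
    by (intro sum.cong refl AT) (simp add: component_def)
  also have "\<dots> = (\<Sum>i\<in>?S. card {v. v < n \<and> home v = Suc i}) + (\<Sum>i\<in>?S. \<Sum>c\<in>children K par i. T c)"
    by (simp add: sum.distrib)
  also have "(\<Sum>i\<in>?S. card {v. v < n \<and> home v = Suc i}) = card (\<Union>i\<in>?S. {v. v < n \<and> home v = Suc i})"
    by (rule card_UN_disjoint[symmetric]) auto
  also have "(\<Union>i\<in>?S. {v. v < n \<and> home v = Suc i}) = {v. v < n \<and> (\<exists>i\<in>?S. home v = Suc i)}"
    by auto
  finally show ?thesis using sum_children[OF k, of T] by simp
qed

text \<open>If the tree forms \<open>m\<close> stars, it has \<open>m * l + T k\<close> vertices
  with \<open>T k < l\<close>, so at most \<open>m\<close> disjoint sets of size at least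
  \<open>l\<close> fit. Either the whole remainder is distributed (\<open>e = 0\<close>) and the
  right-hand side is the number of all vertices of the tree, or every star is full and it is
  \<open>m * U\<close>.\<close>

lemma served_bound_component:
  assumes k: "k < K" "par k = 0" and fin: "finite F"
    and fib: "\<And>u. u \<in> F \<Longrightarrow> l \<le> card (B u) \<and> card (B u) \<le> U"
    and sub: "\<And>u v. u \<in> F \<Longrightarrow> v \<in> B u \<Longrightarrow> v < n \<and> (\<exists>i\<in>component K par k. home v = Suc i)"
    and disj: "\<And>u u'. u \<in> F \<Longrightarrow> u' \<in> F \<Longrightarrow> u \<noteq> u' \<Longrightarrow> B u \<inter> B u' = {}"
  shows "(\<Sum>u\<in>F. card (B u)) \<le> (\<Sum>i\<in>component K par k. A i + x i)"
proof -
  let ?S = "component K par k"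
  have "\<forall>i\<in>?S. \<exists>a. A i = a * l \<and> G i = a * (U - l)"
    using AG by (simp add: component_def)
  then obtain a where a: "\<And>i. i \<in> ?S \<Longrightarrow> A i = a i * l \<and> G i = a i * (U - l)"
    by metis
  define m where "m = sum a ?S"
  have A: "sum A ?S = m * l" and G: "sum G ?S = m * (U - l)"
    using a by (simp_all add: m_def sum_distrib_right)
  have finB: "finite (B u)" if "u \<in> F" for u
    using fib[OF that] l_pos card_ge_0_finite by force
  let ?W = "{v. v < n \<and> (\<exists>i\<in>?S. home v = Suc i)}"
  have "(\<Sum>u\<in>F. card (B u)) = card (\<Union>u\<in>F. B u)"
    by (rule card_UN_disjoint[symmetric]) (use fin finB disj in auto)
  also have "\<dots> \<le> card ?W"
    by (intro card_mono) (use sub in auto)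
  finally have le: "(\<Sum>u\<in>F. card (B u)) \<le> m * l + T k"
    using sum_A[OF k] A by simp
  obtain e where e: "e + sum x ?S = T k" "0 < e \<longrightarrow> (\<forall>i\<in>?S. x i = G i)"
    using x_sum[OF k] by blast
  show ?thesis
  proof (cases "e = 0")
    case True
    then show ?thesis using le e A by (simp add: sum.distrib)
  next
    case False
    then have "sum x ?S = m * (U - l)" using e G by simp
    then have "sum x ?S + sum A ?S = m * (U - l + l)" using A by (simp add: algebra_simps)
    then have tot: "(\<Sum>i\<in>?S. A i + x i) = m * U"
      using l_le by (simp add: sum.distrib)
    have "card F * l \<le> (\<Sum>u\<in>F. card (B u))"
      using sum_mono[of F "\<lambda>_. l" "\<lambda>u. card (B u)"] fib by simp
    also have "\<dots> < Suc m * l"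
      using le T_less[OF k(1)] by simp
    finally have "card F \<le> m" using mult_less_cancel2 by (metis less_Suc_eq_le)
    have "(\<Sum>u\<in>F. card (B u)) \<le> card F * U"
      using sum_mono[of F "\<lambda>u. card (B u)" "\<lambda>_. U"] fib by simp
    also have "\<dots> \<le> m * U" using \<open>card F \<le> m\<close> by simp
    finally show ?thesis using tot by simp
  qed
qed

text \<open>The fibres are grouped by the tree \<kappa> that contains the \<open>r\<close>-ball of
  their center, and the bounds per tree add up. Only centers that serve somebody are considered,
  which is why the lower bound may be taken positive.\<close>

lemma served_bound:
  assumes C: "C \<subseteq> {..<n}" and phi: "\<And>v. v \<in> C \<Longrightarrow> \<phi> v < n \<and> d v (\<phi> v) \<le> r"
    and fib: "\<And>u. u \<in> \<phi> ` C \<Longrightarrow> l \<le> card {v\<in>C. \<phi> v = u} \<and> card {v\<in>C. \<phi> v = u} \<le> U"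
  shows "card C \<le> (\<Sum>i<K. A i + x i)"
proof -
  let ?B = "\<lambda>u. {v\<in>C. \<phi> v = u}"
  let ?R = "{k. k < K \<and> par k = 0}"
  have finC: "finite C" using C finite_subset by blast
  have B: "v < n \<and> d u v \<le> r" if "u \<in> \<phi> ` C" "v \<in> ?B u" for u v
  proof -
    have "v \<in> C" "\<phi> v = u" using that by auto
    then show ?thesis using C phi[of v] sym[of v u] by auto
  qed
  have dense: "dense u" if u: "u \<in> \<phi> ` C" for u
  proof -
    have "card (?B u) \<le> card {v. v < n \<and> d u v \<le> r}"
      using B[OF u] by (intro card_mono) auto
    then show ?thesis using fib[OF u] phi u by (auto simp: dense_def)
  qed
  then have "\<forall>u\<in>\<phi> ` C. \<exists>k. k \<in> ?R \<and>
      (\<forall>v<n. d u v \<le> r \<longrightarrow> (\<exists>i. home v = Suc i \<and> i \<in> component K par k))"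
    using dense_component by blast
  then obtain \<kappa> where \<kappa>: "\<And>u. u \<in> \<phi> ` C \<Longrightarrow> \<kappa> u \<in> ?R"
     "\<And>u v. u \<in> \<phi> ` C \<Longrightarrow> v < n \<Longrightarrow> d u v \<le> r \<Longrightarrow> \<exists>i. home v = Suc i \<and> i \<in> component K par (\<kappa> u)"
    by metis
  have "card C = (\<Sum>u\<in>\<phi> ` C. card (?B u))"
    using finC by (subst card_UN_disjoint[symmetric]) (auto intro!: arg_cong[where f = card])
  also have "\<dots> = (\<Sum>k\<in>?R. \<Sum>u\<in>{u \<in> \<phi> ` C. \<kappa> u = k}. card (?B u))"
    by (rule sum.group[symmetric]) (use finC \<kappa>(1) in auto)
  also have "\<dots> \<le> (\<Sum>k\<in>?R. \<Sum>i\<in>component K par k. A i + x i)"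
  proof (intro sum_mono served_bound_component)
    fix k u v assume "u \<in> {u \<in> \<phi> ` C. \<kappa> u = k}" "v \<in> ?B u"
    then show "v < n \<and> (\<exists>i\<in>component K par k. home v = Suc i)"
      using B[of u v] \<kappa>(2)[of u v] by blast
  qed (use fib finC in auto)
  also have "\<dots> = sum (\<lambda>i. A i + x i) (\<Union>k\<in>?R. component K par k)"
    by (rule sum.UNION_disjoint[symmetric]) (auto simp: component_def)
  also have "\<dots> \<le> (\<Sum>i<K. A i + x i)"
    by (rule sum_mono2) (auto simp: component_def)
  finally show ?thesis .
qed

section \<open>Bounds on what crosses a tree edge\<close>

lemma X_root:
  assumes k: "k < K" "par k = 0"
  shows "X k = sum x (component K par k)"
proof -
  let ?S = "component K par k"
  have "sum X ?S = (\<Sum>i\<in>?S. x i + (\<Sum>c\<in>children K par i. X c))"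
    by (intro sum.cong refl X_eq) (simp add: component_def)
  then show ?thesis using sum_children[OF k, of X] by (simp add: sum.distrib)
qed

lemma sum_X_children: "i < K \<Longrightarrow> (\<Sum>c\<in>children K par i. X c) \<le> X i"
  using X_eq by simp

text \<open>\<open>X\<close> cannot grow away from the root, because the children's shares sum to at
  most that of their parent. At the root it is part of the remainder \<open>T k\<close>, which is
  below \<open>l\<close>.\<close>

lemma X_less: "i < K \<Longrightarrow> X i < l"
proof (induction i rule: less_induct)
  case (less i)
  show ?case
  proof (cases "par i")
    case 0
    then show ?thesis using X_root[OF less.prems 0] x_sum[OF less.prems 0] T_less[OF less.prems]
      by auto
  next
    case (Suc j)
    then have j: "j < i" "j < K" using par_Suc[OF less.prems] less.prems by auto
    have "X i \<le> (\<Sum>c\<in>children K par j. X c)"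
      by (rule member_le_sum) (use Suc less.prems in \<open>auto simp: children_def\<close>)
    then show ?thesis using less.IH[OF j] sum_X_children[OF j(2)] by simp
  qed
qed

text \<open>The children receive at most \<open>X i\<close> in total. If \<open>T i\<close> exceeds
  \<open>X i\<close>, the net amount \<open>T i - X i\<close> sent to the parent only raises this to
  \<open>T i\<close>; either way the sum is bounded by the larger of two numbers below
  \<open>l\<close>.\<close>

lemma outflow_less:
  assumes i: "i < K"
  shows "(\<Sum>c\<in>children K par i. X c - T c) + (if par i = 0 then 0 else T i - X i) < l"
proof -
  have "(\<Sum>c\<in>children K par i. X c - T c) \<le> (\<Sum>c\<in>children K par i. X c)"
    by (rule sum_mono) simp
  also have "\<dots> \<le> X i" using sum_X_children[OF i] .
  finally show ?thesis using X_less[OF i] T_less[OF i] by auto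
qed

end

section \<open>Computing the clusters\<close>

text \<open>Loops have to stay opaque to the simplifier; unfolded into \<open>iterate\<close> they
  would escape the invariant rules.\<close>

declare sem.simps(6) [simp del]

primrec times_r :: "nat \<Rightarrow> rexp" where
  "times_r 0 = RConst 0"
| "times_r (Suc k) = RPlus (times_r k) (scalR ''r'')"

lemma rval_times_r [simp]: "rval (times_r k) s = real k * reals s ''r'' 0"
  by (induction k) (simp_all add: algebra_simps)

text \<open>The machine cannot multiply. The array \<open>row\<close> therefore holds the offsets
  \<open>i * n\<close> of the matrix rows, and multiples of \<open>r\<close> are unrolled into sums
  by \<open>times_r\<close>.\<close>

definition dist_le :: "nat \<Rightarrow> nexp \<Rightarrow> nexp \<Rightarrow> bexp" where
  "dist_le k e f = Neg (RLess (times_r k) (RGet ''d'' (NPlus (NGet ''row'' e) f)))"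

definition Eq :: "nexp \<Rightarrow> nexp \<Rightarrow> bexp" where
  "Eq e f = Conj (Neg (NLess e f)) (Neg (NLess f e))"

lemma bval_Eq [simp]: "bval (Eq e f) s \<longleftrightarrow> nval e s = nval f s"
  by (auto simp: Eq_def)

abbreviation Zero :: nexp where "Zero \<equiv> NConst 0"
abbreviation One :: nexp where "One \<equiv> NConst 1"
abbreviation Pos :: "nexp \<Rightarrow> bexp" where "Pos e \<equiv> NLess Zero e"
abbreviation Pred :: "nexp \<Rightarrow> nexp" where "Pred e \<equiv> NMinus e One"

primrec clear :: "vname list \<Rightarrow> prog" where
  "clear [] = PSkip"
| "clear (a # as) = clear as ;; PFor ''u'' (PN a (scal ''u'') Zero)"

lemma writes_clear: "writes (clear as) \<subseteq> insert ''u'' (set as)"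
  and writesR_clear [simp]: "writesR (clear as) = {}"
  by (induction as) auto

definition density_row :: prog where
  "density_row = PFor ''v'' (PIf (dist_le 1 (scal ''u'') (scal ''v''))
      (PN ''D'' (scal ''u'') (NPlus (NGet ''D'' (scal ''u'')) One)) PSkip)"

definition density :: prog where
  "density = PFor ''u'' density_row"

text \<open>\<open>s\<close> is the chosen vertex plus one. A candidate with \<open>near\<close>
  equal to 0 is accepted only while nothing has been chosen, whereas one with a pick within 4r
  always overwrites; so a choice without parent survives only if all candidates lack one.\<close>

definition select :: prog where
  "select = PN ''s'' Zero Zero ;;
     PFor ''u'' (PIf (Conj (Neg (NLess (NGet ''D'' (scal ''u'')) (scal ''l'')))
         (Conj (Neg (Pos (NGet ''cov'' (scal ''u''))))
           (Neg (Conj (Pos (scal ''s'')) (Neg (Pos (NGet ''near'' (scal ''u''))))))))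
       (PN ''s'' Zero (NPlus (scal ''u'') One)) PSkip)"

text \<open>\<open>K\<close> has been incremented before this runs, so storing it enters the new
  pick with its index already shifted by one.\<close>

definition mark_vertex :: prog where
  "mark_vertex =
     PIf (dist_le 2 (Pred (scal ''s'')) (scal ''v'')) (PN ''cov'' (scal ''v'') One) PSkip ;;
     PIf (dist_le 4 (Pred (scal ''s'')) (scal ''v'')) (PN ''near'' (scal ''v'') (scal ''K'')) PSkip ;;
     PIf (dist_le 1 (Pred (scal ''s'')) (scal ''v''))
       (PN ''home'' (scal ''v'') (scal ''K'') ;; PN ''ball'' (scal ''v'') One)
       (PIf (Conj (Neg (Pos (NGet ''home'' (scal ''v''))))
           (dist_le 3 (Pred (scal ''s'')) (scal ''v'')))
         (PN ''home'' (scal ''v'') (scal ''K'')) PSkip)"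

definition mark :: prog where
  "mark = PFor ''v'' mark_vertex"

definition add_center :: prog where
  "add_center = PN ''ctr'' (scal ''K'') (Pred (scal ''s'')) ;;
     PN ''par'' (scal ''K'') (NGet ''near'' (Pred (scal ''s''))) ;;
     PN ''K'' Zero (NPlus (scal ''K'') One) ;; mark"

definition cluster :: prog where
  "cluster = PN ''K'' Zero Zero ;; PFor ''i'' (select ;; PIf (Pos (scal ''s'')) add_center PSkip)"

context radius_instance
begin

definition ready :: "state \<Rightarrow> bool" where
  "ready s \<longleftrightarrow> nats s ''n'' 0 = n \<and> nats s ''l'' 0 = l \<and> nats s ''U'' 0 = U \<and>
     (\<forall>i<n. nats s ''row'' i = i * n) \<and>
     (\<forall>u<n. \<forall>v<n. reals s ''d'' (u * n + v) = d u v) \<and> reals s ''r'' 0 = r"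

lemma ready_cong:
  assumes "\<And>a. a \<in> {''n'', ''l'', ''U'', ''row''} \<Longrightarrow> nats s' a = nats s a"
    and "reals s' ''d'' = reals s ''d''" "reals s' ''r'' = reals s ''r''"
  shows "ready s' \<longleftrightarrow> ready s"
  using assms by (simp add: ready_def)

lemma ready_set_nat [simp]:
  "a \<notin> {''n'', ''l'', ''U'', ''row''} \<Longrightarrow> ready (set_nat a i y s) \<longleftrightarrow> ready s"
  by (intro ready_cong) auto

lemma ready_sem:
  "{''n'', ''l'', ''U'', ''row''} \<inter> writes p = {} \<Longrightarrow> {''d'', ''r''} \<inter> writesR p = {} \<Longrightarrow>
    ready (sem p s) \<longleftrightarrow> ready s"
  by (intro ready_cong) (auto intro!: nats_sem reals_sem)

lemma readyD:
  assumes "ready s"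
  shows "nats s ''n'' 0 = n" "nats s ''l'' 0 = l" "nats s ''U'' 0 = U"
  using assms by (auto simp: ready_def)

lemma bval_dist_le:
  assumes "ready s" "nval e s < n" "nval f s < n"
  shows "bval (dist_le k e f) s \<longleftrightarrow> d (nval e s) (nval f s) \<le> real k * r"
  using assms by (simp add: dist_le_def ready_def not_less)

lemma loop_induct:
  assumes "ready s" and "{''n'', ''l'', ''U'', ''row''} \<inter> insert x (writes p) = {}" "writesR p = {}"
    and "I 0 (set_nat x 0 0 s)"
    and "\<And>k s'. k < n \<Longrightarrow> I k s' \<Longrightarrow> nats s' x 0 = k \<Longrightarrow> ready s' \<Longrightarrow>
      (\<And>a. a \<noteq> x \<Longrightarrow> a \<notin> writes p \<Longrightarrow> nats s' a = nats s a) \<Longrightarrow>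
      I (Suc k) (set_nat x 0 (Suc k) (sem p s'))"
  shows "I n (sem (PFor x p) s)"
proof (rule sem_PFor_induct[where I = I, OF _ assms(4)])
  show "nats s ''n'' 0 = n" using assms(1) by (simp add: ready_def)
  fix k s' assume *: "k < n" "I k s'" "nats s' x 0 = k"
    "\<And>a. a \<noteq> x \<Longrightarrow> a \<notin> writes p \<Longrightarrow> nats s' a = nats s a"
    "\<And>a. a \<notin> writesR p \<Longrightarrow> reals s' a = reals s a"
  have "ready s' \<longleftrightarrow> ready s"
  proof (rule ready_cong)
    show "nats s' a = nats s a" if "a \<in> {''n'', ''l'', ''U'', ''row''}" for a
      using *(4)[of a] that assms(2) by blast
    show "reals s' ''d'' = reals s ''d''" "reals s' ''r'' = reals s ''r''"
      using *(5) assms(3) by simp_all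
  qed
  then show "I (Suc k) (set_nat x 0 (Suc k) (sem p s'))"
    using assms(1,5) * by blast
qed

lemma ready_clear:
  assumes "{''n'', ''l'', ''U'', ''row''} \<inter> set as = {}"
  shows "ready (sem (clear as) s) \<longleftrightarrow> ready s"
  using assms writes_clear[of as] by (intro ready_sem) auto

lemma sem_clear:
  assumes "ready s" "{''n'', ''l'', ''U'', ''row'', ''u''} \<inter> set as = {}" "a \<in> set as" "u < n"
  shows "nats (sem (clear as) s) a u = 0"
  using assms(2,3)
proof (induction as)
  case (Cons b as)
  have r: "ready (sem (clear as) s)" using Cons.prems assms(1) by (subst ready_clear) auto
  show ?case
  proof (cases "a = b")
    case True
    have "\<forall>u<n. nats (sem (PFor ''u'' (PN b (scal ''u'') Zero)) (sem (clear as) s)) b u = 0"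
      by (rule loop_induct[where I = "\<lambda>k s. \<forall>u<k. nats s b u = 0", OF r])
        (use Cons.prems in \<open>auto simp: less_Suc_eq\<close>)
    then show ?thesis using True \<open>u < n\<close> by simp
  next
    case False
    then have "nats (sem (PFor ''u'' (PN b (scal ''u'') Zero)) (sem (clear as) s)) a =
        nats (sem (clear as) s) a"
      using Cons.prems by (intro nats_sem) auto
    then show ?thesis using Cons False by simp
  qed
qed simp

lemma card_less_Suc:
  "card {v. v < Suc k \<and> P v} = (if P k then Suc (card {v. v < k \<and> P v}) else card {v. v < k \<and> P v})"
proof (cases "P k")
  case True
  then have "{v. v < Suc k \<and> P v} = insert k {v. v < k \<and> P v}" by (auto simp: less_Suc_eq)
  then show ?thesis using True by simp
next
  case False
  then have "{v. v < Suc k \<and> P v} = {v. v < k \<and> P v}" by (auto simp: less_Suc_eq)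
  then show ?thesis using False by simp
qed

lemma sem_density_row:
  assumes "ready s" and u: "nats s ''u'' 0 = u" "u < n" "nats s ''D'' u = 0"
  shows "nats (sem density_row s) ''D'' = (nats s ''D'')(u := card {v. v < n \<and> d u v \<le> r})"
  unfolding density_row_def
proof (rule loop_induct[where I = "\<lambda>k s'. nats s' ''D'' =
    (nats s ''D'')(u := card {v. v < k \<and> d u v \<le> r})", OF assms(1)], goal_cases)
  case (4 k s')
  have "nats s' ''u'' 0 = u" using 4(5)[of "''u''"] u by simp
  then show ?case
    using u 4(1-4) by (simp add: bval_dist_le card_less_Suc)
qed (use u in \<open>simp_all add: fun_upd_idem\<close>)

lemma sem_density:
  assumes "ready s" "\<forall>u<n. nats s ''D'' u = 0"
  shows "\<forall>u<n. nats (sem density s) ''D'' u = card {v. v < n \<and> d u v \<le> r}"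
proof -
  have "\<forall>u<n. nats (sem density s) ''D'' u = (if u < n then card {v. v < n \<and> d u v \<le> r} else 0)"
    unfolding density_def
  proof (rule loop_induct[where I = "\<lambda>k s. \<forall>u<n. nats s ''D'' u =
      (if u < k then card {v. v < n \<and> d u v \<le> r} else 0)", OF assms(1)], goal_cases)
    case (4 k s')
    then have "nats (sem density_row s') ''D'' = (nats s' ''D'')(k := card {v. v < n \<and> d k v \<le> r})"
      by (intro sem_density_row) auto
    then show ?case using 4(2) by (simp add: less_Suc_eq)
  qed (use assms(2) in \<open>simp_all add: density_row_def\<close>)
  then show ?thesis by simp
qed

definition dense_known :: "state \<Rightarrow> bool" where
  "dense_known s \<longleftrightarrow> (\<forall>u<n. nats s ''D'' u = card {v. v < n \<and> d u v \<le> r})"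

lemma sem_select:
  assumes "ready s" and D: "dense_known s"
  defines "cand \<equiv> \<lambda>u. dense u \<and> nats s ''cov'' u = 0"
  shows "case nats (sem select s) ''s'' 0 of 0 \<Rightarrow> (\<forall>u. \<not> cand u)
    | Suc u \<Rightarrow> cand u \<and> (nats s ''near'' u = 0 \<longrightarrow> (\<forall>w. cand w \<longrightarrow> nats s ''near'' w = 0))"
proof -
  let ?I = "\<lambda>k s'. case nats s' ''s'' 0 of 0 \<Rightarrow> (\<forall>u<k. \<not> cand u)
    | Suc u \<Rightarrow> u < k \<and> cand u \<and> (nats s ''near'' u = 0 \<longrightarrow> (\<forall>w<k. cand w \<longrightarrow> nats s ''near'' w = 0))"
  have "?I n (sem select s)"
    unfolding select_def sem.simps(4)
  proof (rule loop_induct[where I = ?I], goal_cases)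
    case (5 k s')
    have eq: "nats s' ''D'' = nats s ''D''" "nats s' ''cov'' = nats s ''cov''" "nats s' ''near'' = nats s ''near''"
      by (subst 5(5); simp)+
    have c: "cand k \<longleftrightarrow> l \<le> nats s ''D'' k \<and> nats s ''cov'' k = 0"
      using D 5(1) by (simp add: cand_def dense_def dense_known_def)
    show ?case
      using 5(1-4) c
      by (auto simp: eq readyD less_Suc_eq not_less split: nat.splits)
  qed (use assms in auto)
  then show ?thesis
    using dense_less by (auto simp: cand_def split: nat.splits)
qed

lemma sem_mark_vertex:
  assumes "ready s" "nats s ''s'' 0 = Suc u" "u < n" "nats s ''v'' 0 = v" "v < n"
  shows "nats (sem mark_vertex s) ''cov'' w =
      (if w = v \<and> d u v \<le> 2 * r then 1 else nats s ''cov'' w)"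
    and "nats (sem mark_vertex s) ''near'' w =
      (if w = v \<and> d u v \<le> 4 * r then nats s ''K'' 0 else nats s ''near'' w)"
    and "nats (sem mark_vertex s) ''home'' w =
      (if w = v \<and> (d u v \<le> r \<or> nats s ''home'' v = 0 \<and> d u v \<le> 3 * r) then nats s ''K'' 0
       else nats s ''home'' w)"
    and "nats (sem mark_vertex s) ''ball'' w =
      (if w = v \<and> d u v \<le> r then 1 else nats s ''ball'' w)"
  using assms
  by (cases "d u v \<le> r"; cases "d u v \<le> 2 * r"; cases "d u v \<le> 3 * r";
      cases "d u v \<le> 4 * r"; simp add: mark_vertex_def bval_dist_le)+

lemma sem_mark:
  assumes "ready s" and s: "nats s ''s'' 0 = Suc u" "u < n" and K: "nats s ''K'' 0 = K" and v: "v < n"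
  shows "nats (sem mark s) ''cov'' v = (if d u v \<le> 2 * r then 1 else nats s ''cov'' v)"
    and "nats (sem mark s) ''near'' v = (if d u v \<le> 4 * r then K else nats s ''near'' v)"
    and "nats (sem mark s) ''home'' v = (if d u v \<le> r then K
       else if nats s ''home'' v = 0 \<and> d u v \<le> 3 * r then K else nats s ''home'' v)"
    and "nats (sem mark s) ''ball'' v = (if d u v \<le> r then 1 else nats s ''ball'' v)"
proof -
  let ?J = "\<lambda>k s' v.
    nats s' ''cov'' v = (if v < k \<and> d u v \<le> 2 * r then 1 else nats s ''cov'' v) \<and>
    nats s' ''near'' v = (if v < k \<and> d u v \<le> 4 * r then K else nats s ''near'' v) \<and>
    nats s' ''home'' v = (if v < k \<and> (d u v \<le> r \<or> nats s ''home'' v = 0 \<and> d u v \<le> 3 * r) then K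
       else nats s ''home'' v) \<and>
    nats s' ''ball'' v = (if v < k \<and> d u v \<le> r then 1 else nats s ''ball'' v)"
  let ?I = "\<lambda>k s'. \<forall>v<n. ?J k s' v"
  have "?I n (sem mark s)"
    unfolding mark_def
  proof (rule loop_induct[where I = ?I, OF assms(1)], goal_cases)
    case (4 k s')
    have [simp]: "nats s' ''s'' 0 = Suc u" "nats s' ''K'' 0 = K"
      using 4(5)[of "''s''"] 4(5)[of "''K''"] s K by (simp_all add: mark_vertex_def)
    show ?case
    proof (intro allI impI)
      fix v assume "v < n"
      with 4(2) have v: "nats s' ''cov'' v = (if v < k \<and> d u v \<le> 2 * r then 1 else nats s ''cov'' v)"
        "nats s' ''near'' v = (if v < k \<and> d u v \<le> 4 * r then K else nats s ''near'' v)"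
        "nats s' ''home'' v = (if v < k \<and> (d u v \<le> r \<or> nats s ''home'' v = 0 \<and> d u v \<le> 3 * r) then K
           else nats s ''home'' v)"
        "nats s' ''ball'' v = (if v < k \<and> d u v \<le> r then 1 else nats s ''ball'' v)"
        by blast+
      show "?J (Suc k) (set_nat ''v'' 0 (Suc k) (sem mark_vertex s')) v"
        using sem_mark_vertex[OF 4(4) _ s(2) 4(3,1), of v] v by (auto simp: less_Suc_eq)
    qed
  qed (simp_all add: mark_vertex_def)
  then show "nats (sem mark s) ''cov'' v = (if d u v \<le> 2 * r then 1 else nats s ''cov'' v)"
    and "nats (sem mark s) ''near'' v = (if d u v \<le> 4 * r then K else nats s ''near'' v)"
    and "nats (sem mark s) ''home'' v = (if d u v \<le> r then K
       else if nats s ''home'' v = 0 \<and> d u v \<le> 3 * r then K else nats s ''home'' v)"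
    and "nats (sem mark s) ''ball'' v = (if d u v \<le> r then 1 else nats s ''ball'' v)"
    using v by auto
qed

abbreviation clustering_of :: "state \<Rightarrow> bool" where
  "clustering_of s \<equiv> clustering n l U d r (nats s ''K'' 0) (nats s ''ctr'') (nats s ''par'')
     (nats s ''cov'') (nats s ''near'') (nats s ''home'') (nats s ''ball'')"

abbreviation clustered_of :: "state \<Rightarrow> bool" where
  "clustered_of s \<equiv> clustered n l U d r (nats s ''K'' 0) (nats s ''ctr'') (nats s ''par'')
     (nats s ''cov'') (nats s ''near'') (nats s ''home'') (nats s ''ball'')"

lemma sem_add_center:
  assumes "ready s" and cl: "clustering_of s" and s: "nats s ''s'' 0 = Suc u"
    and u: "dense u" "nats s ''cov'' u = 0"
      "nats s ''near'' u = 0 \<longrightarrow> (\<forall>w. dense w \<and> nats s ''cov'' w = 0 \<longrightarrow> nats s ''near'' w = 0)"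
  shows "clustering_of (sem add_center s)"
    and "nats (sem add_center s) ''K'' 0 = Suc (nats s ''K'' 0)"
    and "{w. dense w \<and> nats (sem add_center s) ''cov'' w = 0} \<subset> {w. dense w \<and> nats s ''cov'' w = 0}"
proof -
  let ?K = "nats s ''K'' 0"
  define s1 where "s1 = set_nat ''K'' 0 (Suc ?K) (set_nat ''par'' ?K (nats s ''near'' u)
     (set_nat ''ctr'' ?K u s))"
  have eq: "sem add_center s = sem mark s1"
    using s by (simp add: add_center_def s1_def)
  have s1: "ready s1" "nats s1 ''s'' 0 = Suc u" "u < n" "nats s1 ''K'' 0 = Suc ?K"
    using assms(1) s u dense_less by (auto simp: s1_def)
  note m = sem_mark[OF s1]
  have fr: "nats (sem mark s1) ''ctr'' = (nats s ''ctr'')(?K := u)"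
    "nats (sem mark s1) ''par'' = (nats s ''par'')(?K := nats s ''near'' u)"
    "nats (sem mark s1) ''K'' 0 = Suc ?K"
    by (subst nats_sem; simp add: mark_def mark_vertex_def s1_def)+
  have s1': "nats s1 ''cov'' = nats s ''cov''" "nats s1 ''near'' = nats s ''near''"
    "nats s1 ''home'' = nats s ''home''" "nats s1 ''ball'' = nats s ''ball''"
    by (simp_all add: s1_def)
  show "clustering_of (sem add_center s)"
    unfolding eq fr
    by (rule clustering.clustering_extend[OF cl u(1,2)]) (use u(3) in \<open>auto simp: m s1'\<close>)
  show "nats (sem add_center s) ''K'' 0 = Suc ?K"
    by (simp add: eq fr)
  let ?A = "{w. dense w \<and> nats s ''cov'' w = 0}"
    and ?B = "{w. dense w \<and> nats (sem add_center s) ''cov'' w = 0}"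
  have "nats (sem add_center s) ''cov'' u \<noteq> 0"
    using m(1)[of u] dense_self[OF u(1)] s1(3) by (simp add: eq)
  then have mem: "u \<in> ?A" "u \<notin> ?B" using u(1,2) by simp_all
  have "nats s ''cov'' w = 0" if "dense w" "nats (sem add_center s) ''cov'' w = 0" for w
    using m(1)[of w] dense_less[OF that(1)] that(2) by (simp add: eq s1' split: if_splits)
  then have "?B \<subseteq> ?A" by (simp add: Collect_mono_iff)
  moreover have "?B \<noteq> ?A"
  proof
    assume e: "?B = ?A"
    have "u \<in> ?B" unfolding e by (rule mem(1))
    then show False using mem(2) by contradiction
  qed
  ultimately show "?B \<subset> ?A" by (rule psubsetI)
qed

text \<open>Each effective round covers at least its own pick, so at most \<open>n - k\<close>
  uncovered dense vertices remain after \<open>k\<close> rounds. This lets a loop of exactly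
  \<open>n\<close> rounds replace one that runs until no candidate is left.\<close>

lemma sem_cluster:
  assumes "ready s" "dense_known s"
    and z: "\<And>v. v < n \<Longrightarrow> nats s ''cov'' v = 0 \<and> nats s ''near'' v = 0 \<and> nats s ''home'' v = 0 \<and> nats s ''ball'' v = 0"
  shows "clustered_of (sem cluster s)" "nats (sem cluster s) ''K'' 0 \<le> n"
proof -
  let ?cand = "\<lambda>s. {w. dense w \<and> nats s ''cov'' w = 0}"
  have fin: "finite (?cand s)" for s
    by (rule finite_subset[of _ "{..<n}"]) (use dense_less in auto)
  let ?I = "\<lambda>k s. clustering_of s \<and> nats s ''K'' 0 \<le> k \<and> card (?cand s) \<le> n - k"
  have "?I n (sem cluster s)"
    unfolding cluster_def sem.simps(4)
  proof (rule loop_induct[where I = ?I], goal_cases)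
    case (5 k s')
    define s1 where "s1 = sem select s'"
    have "nats s' ''D'' = nats s ''D''" by (subst 5(5); simp add: select_def add_center_def mark_def mark_vertex_def)
    then have D: "dense_known s'" using assms(2) by (simp add: dense_known_def)
    have fr: "nats s1 a = nats s' a" if "a \<noteq> ''s''" "a \<noteq> ''u''" for a
      unfolding s1_def by (rule nats_sem) (use that in \<open>simp add: select_def\<close>)
    have r1: "ready s1" unfolding s1_def using 5(4) by (subst ready_sem) (simp_all add: select_def)
    have cl: "clustering_of s1" using 5(2) by (simp add: fr)
    note sel = sem_select[OF 5(4) D, folded s1_def]
    show ?case
    proof (cases "nats s1 ''s'' 0")
      case 0
      then have e: "?cand s' = {}" using sel by auto
      have "?cand s1 = ?cand s'" by (simp add: fr)
      then have "card (?cand s1) = 0" unfolding e by (simp only: card.empty)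
      then show ?thesis using 0 cl 5(2) by (simp add: s1_def[symmetric]) (simp add: fr)
    next
      case (Suc u)
      then have u: "dense u" "nats s1 ''cov'' u = 0"
        "nats s1 ''near'' u = 0 \<longrightarrow> (\<forall>w. dense w \<and> nats s1 ''cov'' w = 0 \<longrightarrow> nats s1 ''near'' w = 0)"
        using sel by (simp_all add: fr)
      note add = sem_add_center[OF r1 cl Suc u]
      have "card (?cand (sem add_center s1)) < card (?cand s1)"
        by (rule psubset_card_mono[OF fin add(3)])
      moreover have "card (?cand s1) = card (?cand s')" by (simp add: fr)
      moreover have "card (?cand s') \<le> n - k" using 5(2) by blast
      ultimately have "card (?cand (sem add_center s1)) \<le> n - Suc k" by linarith
      then show ?thesis
        using add(1,2) Suc 5(2) by (simp add: s1_def[symmetric]) (simp add: fr)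
    qed
  next
    case 4
    have "card (?cand s) \<le> card {..<n}" by (rule card_mono) (use dense_less in auto)
    then show ?case using z by (simp add: clustering_empty)
  qed (use assms in \<open>simp_all add: select_def add_center_def mark_def mark_vertex_def\<close>)
  then have I: "clustering_of (sem cluster s)" "nats (sem cluster s) ''K'' 0 \<le> n"
    "card (?cand (sem cluster s)) = 0" by simp_all
  from I(3) have "?cand (sem cluster s) = {}" unfolding card_0_eq[OF fin] .
  then have "nats (sem cluster s) ''cov'' w \<noteq> 0" if "dense w" for w using that by auto
  then show "clustered_of (sem cluster s)" using I(1) by (simp add: clustered_def clustered_axioms_def)
  show "nats (sem cluster s) ''K'' 0 \<le> n" by (rule I(2))
qed

end

section \<open>Computing the star sizes\<close>

text \<open>Division by \<open>l\<close> without a division: \<open>T j\<close> is kept below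
  \<open>l\<close> and the amount added is at most \<open>l\<close>, so one conditional subtraction
  restores the remainder. Every completed group of \<open>l\<close> adds one star to
  \<open>A\<close> and its spare capacity \<open>U - l\<close> to \<open>G\<close>.\<close>

definition bump :: prog where
  "bump = PN ''T'' (scal ''j'') (NPlus (NGet ''T'' (scal ''j'')) (scal ''k'')) ;;
     PIf (NLess (NGet ''T'' (scal ''j'')) (scal ''l'')) PSkip
       (PN ''T'' (scal ''j'') (NMinus (NGet ''T'' (scal ''j'')) (scal ''l'')) ;;
        PN ''A'' (scal ''j'') (NPlus (NGet ''A'' (scal ''j'')) (scal ''l'')) ;;
        PN ''G'' (scal ''j'') (NPlus (NGet ''G'' (scal ''j'')) (NMinus (scal ''U'') (scal ''l''))))"

definition count :: prog where
  "count = PFor ''v'' (PIf (Pos (NGet ''home'' (scal ''v'')))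
     (PN ''j'' Zero (Pred (NGet ''home'' (scal ''v''))) ;; PN ''k'' Zero One ;; bump) PSkip)"

text \<open>The scan runs downwards from \<open>n - 1\<close>. Parents have smaller indices than
  their children, so \<open>T\<close> at \<open>m\<close> is final when it is handed on.\<close>

definition ascend_node :: prog where
  "ascend_node = PN ''m'' Zero (NMinus (Pred (scal ''n'')) (scal ''u'')) ;;
     PIf (Conj (NLess (scal ''m'') (scal ''K'')) (Pos (NGet ''par'' (scal ''m''))))
       (PN ''j'' Zero (Pred (NGet ''par'' (scal ''m''))) ;;
        PN ''k'' Zero (NGet ''T'' (scal ''m'')) ;; bump) PSkip"

definition ascend :: prog where
  "ascend = PFor ''u'' ascend_node"

text \<open>One register \<open>e\<close> is enough because trees are blocks of indices: it is reset
  at each root to the remainder there and then consumed greedily by the clusters up to the next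
  root.\<close>

definition distribute_node :: prog where
  "distribute_node =
     PIf (NLess (scal ''i'') (scal ''K''))
       (PIf (Pos (NGet ''par'' (scal ''i''))) PSkip (PN ''e'' Zero (NGet ''T'' (scal ''i''))) ;;
        PIf (NLess (scal ''e'') (NGet ''G'' (scal ''i'')))
          (PN ''x'' (scal ''i'') (scal ''e'') ;; PN ''e'' Zero Zero)
          (PN ''x'' (scal ''i'') (NGet ''G'' (scal ''i'')) ;;
           PN ''e'' Zero (NMinus (scal ''e'') (NGet ''G'' (scal ''i'')))) ;;
        PN ''X'' (scal ''i'') (NGet ''x'' (scal ''i''))) PSkip"

definition distribute :: prog where
  "distribute = PFor ''i'' distribute_node"

definition accumulate_node :: prog where
  "accumulate_node = PN ''m'' Zero (NMinus (Pred (scal ''n'')) (scal ''u'')) ;;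
     PIf (Conj (NLess (scal ''m'') (scal ''K'')) (Pos (NGet ''par'' (scal ''m''))))
       (PN ''X'' (Pred (NGet ''par'' (scal ''m'')))
         (NPlus (NGet ''X'' (Pred (NGet ''par'' (scal ''m'')))) (NGet ''X'' (scal ''m'')))) PSkip"

definition accumulate :: prog where
  "accumulate = PFor ''u'' accumulate_node"

definition quota :: prog where
  "quota = count ;; ascend ;; distribute ;; accumulate"

lemmas quota_defs = count_def ascend_def ascend_node_def distribute_def distribute_node_def
  accumulate_def accumulate_node_def bump_def

context radius_instance
begin

text \<open>Here \<open>m i\<close> is the number of vertices credited to cluster \<open>i\<close>
  so far. The number \<open>a\<close> of its stars is never stored, only the multiples
  \<open>a * l\<close> and \<open>a * (U - l)\<close>.\<close>

definition balanced :: "nat \<Rightarrow> (nat \<Rightarrow> nat) \<Rightarrow> state \<Rightarrow> bool" where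
  "balanced K m s \<longleftrightarrow> (\<forall>i<K. nats s ''T'' i < l \<and>
     (\<exists>a. nats s ''A'' i = a * l \<and> nats s ''G'' i = a * (U - l)) \<and>
     nats s ''A'' i + nats s ''T'' i = m i)"

lemma balanced_cong:
  assumes "nats s' ''T'' = nats s ''T''" "nats s' ''A'' = nats s ''A''" "nats s' ''G'' = nats s ''G''"
    and "\<And>i. i < K \<Longrightarrow> m' i = m i"
  shows "balanced K m' s' \<longleftrightarrow> balanced K m s"
  using assms by (simp add: balanced_def)

lemma sem_bump:
  assumes "ready s" "nats s ''j'' 0 = j" "nats s ''k'' 0 = k" "k \<le> l" "nats s ''T'' j < l"
  shows "\<exists>c. nats (sem bump s) ''T'' = (nats s ''T'')(j := nats s ''T'' j + k - c * l) \<and>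
    nats (sem bump s) ''A'' = (nats s ''A'')(j := nats s ''A'' j + c * l) \<and>
    nats (sem bump s) ''G'' = (nats s ''G'')(j := nats s ''G'' j + c * (U - l)) \<and>
    c * l \<le> nats s ''T'' j + k \<and> nats s ''T'' j + k - c * l < l"
proof (cases "nats s ''T'' j + k < l")
  case True
  then show ?thesis
    using assms by (intro exI[of _ 0]) (simp add: bump_def readyD)
next
  case False
  then show ?thesis
    using assms by (intro exI[of _ 1]) (simp add: bump_def readyD)
qed

lemma balanced_bump:
  assumes "ready s" "balanced K m s" "nats s ''j'' 0 = j" "nats s ''k'' 0 = k" "k \<le> l" "j < K"
    and m': "\<And>i. i < K \<Longrightarrow> m' i = (if i = j then m i + k else m i)"
  shows "balanced K m' (sem bump s)"
proof -
  have "nats s ''T'' j < l" using assms(2,6) by (simp add: balanced_def)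
  from sem_bump[OF assms(1,3,4,5) this] obtain c where c:
    "nats (sem bump s) ''T'' = (nats s ''T'')(j := nats s ''T'' j + k - c * l)"
    "nats (sem bump s) ''A'' = (nats s ''A'')(j := nats s ''A'' j + c * l)"
    "nats (sem bump s) ''G'' = (nats s ''G'')(j := nats s ''G'' j + c * (U - l))"
    "c * l \<le> nats s ''T'' j + k" "nats s ''T'' j + k - c * l < l" by blast
  show ?thesis
    unfolding balanced_def
  proof (intro allI impI)
    fix i assume i: "i < K"
    with assms(2) obtain a where a: "nats s ''T'' i < l" "nats s ''A'' i = a * l"
      "nats s ''G'' i = a * (U - l)" "nats s ''A'' i + nats s ''T'' i = m i"
      by (auto simp: balanced_def)
    show "nats (sem bump s) ''T'' i < l \<and>
      (\<exists>a. nats (sem bump s) ''A'' i = a * l \<and> nats (sem bump s) ''G'' i = a * (U - l)) \<and>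
      nats (sem bump s) ''A'' i + nats (sem bump s) ''T'' i = m' i"
    proof (cases "i = j")
      case True
      have "\<exists>a'. nats (sem bump s) ''A'' i = a' * l \<and> nats (sem bump s) ''G'' i = a' * (U - l)"
        using True a c by (intro exI[of _ "a + c"]) (simp add: add_mult_distrib)
      then show ?thesis using True a c m'[OF i] by simp
    next
      case False
      then show ?thesis using a c m'[OF i] by auto
    qed
  qed
qed

lemma sem_count:
  assumes "ready s" and h: "\<And>v i. v < n \<Longrightarrow> nats s ''home'' v = Suc i \<Longrightarrow> i < K"
    and z: "\<And>i. i < K \<Longrightarrow> nats s ''T'' i = 0 \<and> nats s ''A'' i = 0 \<and> nats s ''G'' i = 0"
  shows "balanced K (\<lambda>i. card {v. v < n \<and> nats s ''home'' v = Suc i}) (sem count s)"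
  unfolding count_def
proof (rule loop_induct[where I = "\<lambda>k. balanced K (\<lambda>i. card {v. v < k \<and> nats s ''home'' v = Suc i})",
      OF assms(1)], goal_cases)
  case 3
  then show ?case using z l_pos by (simp add: balanced_def)
next
  case (4 k s')
  have home: "nats s' ''home'' = nats s ''home''" by (subst 4(5); simp add: bump_def)
  show ?case
  proof (cases "nats s ''home'' k")
    case 0
    then show ?thesis
      using 4(2,3) home by (auto simp: card_less_Suc intro: iffD2[OF balanced_cong])
  next
    case (Suc i)
    define s1 where "s1 = set_nat ''k'' 0 1 (set_nat ''j'' 0 i s')"
    have "sem (PIf (Pos (NGet ''home'' (scal ''v'')))
      (PN ''j'' Zero (Pred (NGet ''home'' (scal ''v''))) ;; PN ''k'' Zero One ;; bump) PSkip) s' = sem bump s1"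
      using Suc 4(3) home by (simp add: s1_def)
    moreover have "balanced K (\<lambda>i. card {v. v < Suc k \<and> nats s ''home'' v = Suc i}) (sem bump s1)"
    proof (rule balanced_bump)
      show "balanced K (\<lambda>i. card {v. v < k \<and> nats s ''home'' v = Suc i}) s1"
        by (rule iffD2[OF balanced_cong 4(2)]) (simp_all add: s1_def)
      show "i < K" using h[OF 4(1) Suc] .
    qed (use 4(4) Suc l_pos in \<open>auto simp: s1_def card_less_Suc\<close>)
    ultimately show ?thesis
      by (simp add: balanced_def)
  qed
qed (simp_all add: bump_def)

text \<open>These are the children of \<open>i\<close> that a downward scan from
  \<open>n - 1\<close> has processed after \<open>k\<close> rounds.\<close>

definition late :: "nat \<Rightarrow> (nat \<Rightarrow> nat) \<Rightarrow> nat \<Rightarrow> nat \<Rightarrow> nat set" where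
  "late K par k i = {c. c < K \<and> n - k \<le> c \<and> par c = Suc i}"

lemma late_0: "K \<le> n \<Longrightarrow> late K par 0 i = {}"
  and late_n: "late K par n i = children K par i"
  and finite_late: "finite (late K par k i)"
  and notin_late: "k < n \<Longrightarrow> n - 1 - k \<notin> late K par k i"
  by (auto simp: late_def children_def)

lemma late_Suc:
  assumes "k < n"
  shows "late K par (Suc k) i =
    (if n - 1 - k < K \<and> par (n - 1 - k) = Suc i then insert (n - 1 - k) (late K par k i)
     else late K par k i)"
proof -
  have "n - Suc k \<le> c \<longleftrightarrow> c = n - 1 - k \<or> n - k \<le> c" for c using assms by linarith
  then show ?thesis by (auto simp: late_def)
qed

text \<open>Processing index \<open>n - 1 - k\<close> alters the array only at its parent
  \<open>p\<close>, which lies below all processed indices. Sums over processed children therefore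
  change only by the newly processed term.\<close>

lemma sum_late_Suc:
  assumes k: "k < n" and "\<And>j. j \<noteq> p \<Longrightarrow> f' j = f j" "p < n - 1 - k"
  shows "sum f' (late K par (Suc k) i) =
    (if n - 1 - k < K \<and> par (n - 1 - k) = Suc i then sum f (late K par k i) + f (n - 1 - k)
     else sum f (late K par k i))"
proof -
  have "p \<notin> late K par k i" using assms by (auto simp: late_def)
  then have "sum f' (late K par k i) = sum f (late K par k i)"
    by (metis assms(2) sum.cong)
  moreover have "sum f' (insert (n - 1 - k) (late K par k i)) = f' (n - 1 - k) + sum f' (late K par k i)"
    by (rule sum.insert[OF finite_late notin_late[OF k]])
  ultimately show ?thesis
    using assms(2)[of "n - 1 - k"] assms(3) by (auto simp: late_Suc[OF k] add.commute)
qed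

lemma sem_ascend:
  assumes "ready s" "nats s ''K'' 0 = K" "K \<le> n" and par: "\<And>i j. i < K \<Longrightarrow> nats s ''par'' i = Suc j \<Longrightarrow> j < i"
    and m: "balanced K m s"
  shows "balanced K (\<lambda>i. m i + sum (nats (sem ascend s) ''T'') (children K (nats s ''par'') i)) (sem ascend s)"
proof -
  let ?p = "nats s ''par''"
  let ?I = "\<lambda>k s'. balanced K (\<lambda>i. m i + sum (nats s' ''T'') (late K ?p k i)) s'"
  have "?I n (sem ascend s)"
    unfolding ascend_def
  proof (rule loop_induct[where I = ?I, OF assms(1)], goal_cases)
    case 3
    then show ?case using m assms(3) by (simp add: late_0 balanced_def)
  next
    case (4 k s')
    have fr: "nats s' ''par'' = ?p" "nats s' ''K'' = nats s ''K''"
      by (subst 4(5); simp add: ascend_node_def bump_def)+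
    let ?c = "n - 1 - k"
    define s1 where "s1 = set_nat ''m'' 0 ?c s'"
    have n: "nats s' ''n'' 0 = n" using 4(4) by (simp add: readyD)
    show ?case
    proof (cases "?c < K \<and> 0 < ?p ?c")
      case False
      then have "late K ?p (Suc k) i = late K ?p k i" for i
        using 4(1) by (auto simp: late_Suc)
      moreover have "sem ascend_node s' = s1"
        using False 4(3) n fr assms(2) by (auto simp: ascend_node_def s1_def)
      ultimately show ?thesis using 4(2) by (simp add: balanced_def s1_def)
    next
      case True
      then obtain j where j: "?p ?c = Suc j" by (cases "?p ?c") auto
      then have "j < ?c" using par True by blast
      define s2 where "s2 = set_nat ''k'' 0 (nats s' ''T'' ?c) (set_nat ''j'' 0 j s1)"
      have eq: "sem ascend_node s' = sem bump s2"
        using True j 4(3) n fr assms(2) by (simp add: ascend_node_def s1_def s2_def)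
      have T: "nats s2 ''T'' = nats s' ''T''" "nats s2 ''A'' = nats s' ''A''" "nats s2 ''G'' = nats s' ''G''"
        by (simp_all add: s1_def s2_def)
      have r2: "ready s2" using 4(4) by (simp add: s1_def s2_def)
      have j2: "nats s2 ''j'' 0 = j" "nats s2 ''k'' 0 = nats s' ''T'' ?c"
        by (simp_all add: s2_def)
      have Tl: "nats s' ''T'' ?c < l" "nats s' ''T'' j < l"
        using 4(2) True \<open>j < ?c\<close> by (simp_all add: balanced_def)
      obtain c where "nats (sem bump s2) ''T'' = (nats s' ''T'')(j := c)"
        using sem_bump[OF r2 j2] Tl T by auto
      then have sum': "sum (nats (sem bump s2) ''T'') (late K ?p (Suc k) i) =
        (if i = j then sum (nats s' ''T'') (late K ?p k i) + nats s' ''T'' ?c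
         else sum (nats s' ''T'') (late K ?p k i))" for i
        using sum_late_Suc[OF 4(1) _ \<open>j < ?c\<close>, of "nats (sem bump s2) ''T''" "nats s' ''T''" K ?p i] True j
        by simp
      have "balanced K (\<lambda>i. m i + sum (nats (sem bump s2) ''T'') (late K ?p (Suc k) i)) (sem bump s2)"
      proof (rule balanced_bump[OF r2 _ j2])
        show "balanced K (\<lambda>i. m i + sum (nats s' ''T'') (late K ?p k i)) s2"
          by (rule iffD2[OF balanced_cong 4(2)]) (simp_all add: T)
        show "j < K" using \<open>j < ?c\<close> True by simp
      qed (use Tl sum' in auto)
      then show ?thesis unfolding eq by (simp add: balanced_def)
    qed
  qed (simp_all add: ascend_node_def bump_def)
  then show ?thesis by (simp add: late_n)
qed

lemma sem_accumulate:
  assumes "ready s" "nats s ''K'' 0 = K" "K \<le> n" and par: "\<And>i j. i < K \<Longrightarrow> nats s ''par'' i = Suc j \<Longrightarrow> j < i"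
    and X: "\<And>i. i < K \<Longrightarrow> nats s ''X'' i = x i"
  shows "\<forall>i<K. nats (sem accumulate s) ''X'' i =
    x i + sum (nats (sem accumulate s) ''X'') (children K (nats s ''par'') i)"
proof -
  let ?p = "nats s ''par''"
  let ?I = "\<lambda>k s'. \<forall>i<K. nats s' ''X'' i = x i + sum (nats s' ''X'') (late K ?p k i)"
  have "?I n (sem accumulate s)"
    unfolding accumulate_def
  proof (rule loop_induct[where I = ?I, OF assms(1)], goal_cases)
    case 3
    then show ?case using X assms(3) by (simp add: late_0)
  next
    case (4 k s')
    have fr: "nats s' ''par'' = ?p" "nats s' ''K'' = nats s ''K''"
      by (subst 4(5); simp add: accumulate_node_def)+
    let ?c = "n - 1 - k"
    have n: "nats s' ''n'' 0 = n" using 4(4) by (simp add: readyD)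
    show ?case
    proof (cases "?c < K \<and> 0 < ?p ?c")
      case False
      then have "late K ?p (Suc k) i = late K ?p k i" for i
        using 4(1) by (auto simp: late_Suc)
      moreover have "sem accumulate_node s' = set_nat ''m'' 0 ?c s'"
        using False 4(3) n fr assms(2) by (auto simp: accumulate_node_def)
      ultimately show ?thesis using 4(2) by simp
    next
      case True
      then obtain j where j: "?p ?c = Suc j" by (cases "?p ?c") auto
      then have "j < ?c" using par True by blast
      have X': "nats (sem accumulate_node s') ''X'' = (nats s' ''X'')(j := nats s' ''X'' j + nats s' ''X'' ?c)"
        using True j 4(3) n fr assms(2) by (simp add: accumulate_node_def)
      have sum': "sum (nats (sem accumulate_node s') ''X'') (late K ?p (Suc k) i) =
        (if i = j then sum (nats s' ''X'') (late K ?p k i) + nats s' ''X'' ?c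
         else sum (nats s' ''X'') (late K ?p k i))" for i
        using sum_late_Suc[OF 4(1) _ \<open>j < ?c\<close>, of "nats (sem accumulate_node s') ''X''" "nats s' ''X''" K ?p i]
          True j X' by simp
      show ?thesis
      proof (intro allI impI)
        fix i assume "i < K"
        then have "nats s' ''X'' i = x i + sum (nats s' ''X'') (late K ?p k i)" using 4(2) by blast
        then have "nats (sem accumulate_node s') ''X'' i =
            x i + sum (nats (sem accumulate_node s') ''X'') (late K ?p (Suc k) i)"
          using sum'[of i] by (cases "i = j") (simp_all add: X')
        then show "nats (set_nat ''u'' 0 (Suc k) (sem accumulate_node s')) ''X'' i = x i +
            sum (nats (set_nat ''u'' 0 (Suc k) (sem accumulate_node s')) ''X'') (late K ?p (Suc k) i)"
          by simp
      qed
    qed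
  qed (simp_all add: accumulate_node_def)
  then show ?thesis by (simp add: late_n)
qed

lemma sem_distribute_node:
  assumes "nats s ''i'' 0 = k" "k < nats s ''K'' 0"
    and e: "e = (if nats s ''par'' k = 0 then nats s ''T'' k else nats s ''e'' 0)"
  shows "nats (sem distribute_node s) ''x'' = (nats s ''x'')(k := min e (nats s ''G'' k))"
    and "nats (sem distribute_node s) ''X'' = (nats s ''X'')(k := min e (nats s ''G'' k))"
    and "nats (sem distribute_node s) ''e'' 0 = e - min e (nats s ''G'' k)"
  using assms by (cases "nats s ''par'' k = 0"; cases "e < nats s ''G'' k"; simp add: distribute_node_def)+

lemma sem_distribute:
  assumes "ready s" "nats s ''K'' 0 = K" "K \<le> n" and p0: "0 < K \<Longrightarrow> nats s ''par'' 0 = 0"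
  defines "s' \<equiv> sem distribute s"
  shows "\<forall>i<K. nats s' ''x'' i \<le> nats s ''G'' i \<and> nats s' ''X'' i = nats s' ''x'' i"
    and "\<forall>q<K. nats s ''par'' q = 0 \<longrightarrow> (\<exists>e. e + sum (nats s' ''x'') (component K (nats s ''par'') q) = nats s ''T'' q \<and>
       (0 < e \<longrightarrow> (\<forall>i\<in>component K (nats s ''par'') q. nats s' ''x'' i = nats s ''G'' i)))"
proof -
  let ?p = "nats s ''par''" and ?G = "nats s ''G''" and ?T = "nats s ''T''"
  let ?c = "\<lambda>k q. {j \<in> component K ?p q. j < k}"
  \<comment> \<open>Only for the tree of the last processed index is the leftover still in the
    register. For earlier trees \<open>e\<close> has been overwritten, and their leftover survives
    as an existential witness.\<close>
  let ?J = "\<lambda>k s' q. \<exists>e. e + sum (nats s' ''x'') (?c k q) = ?T q \<and>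
      (0 < e \<longrightarrow> (\<forall>i\<in>?c k q. nats s' ''x'' i = ?G i)) \<and>
      (k \<le> K \<longrightarrow> root_of ?p (k - 1) = q \<longrightarrow> e = nats s' ''e'' 0)"
  let ?I = "\<lambda>k s'. (\<forall>i<K. i < k \<longrightarrow> nats s' ''x'' i \<le> ?G i \<and> nats s' ''X'' i = nats s' ''x'' i) \<and>
     (\<forall>q<K. q < k \<longrightarrow> ?p q = 0 \<longrightarrow> ?J k s' q)"
  have "?I n (sem distribute s)"
    unfolding distribute_def
  proof (rule loop_induct[where I = ?I, OF assms(1)], goal_cases)
    case (4 k s1)
    have fr: "nats s1 ''par'' = ?p" "nats s1 ''K'' = nats s ''K''" "nats s1 ''G'' = ?G" "nats s1 ''T'' = ?T"
      by (subst 4(5); simp add: distribute_node_def)+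
    let ?s = "sem distribute_node s1"
    have J: "?J k s1 q" if "q < K" "q < k" "?p q = 0" for q
      using 4(2) that by blast
    show ?case
    proof (cases "k < K")
      case False
      then have "?s = s1" using 4(3) fr assms(2) by (simp add: distribute_node_def)
      moreover have "?c (Suc k) q = ?c k q" for q using False by (auto simp: component_def)
      ultimately show ?thesis using 4(2) False by (auto simp: less_Suc_eq)
    next
      case True
      define e where "e = (if ?p k = 0 then ?T k else nats s1 ''e'' 0)"
      note node = sem_distribute_node[of s1 k e, unfolded fr, OF 4(3)]
      have x: "nats ?s ''x'' = (nats s1 ''x'')(k := min e (?G k))"
        and X: "nats ?s ''X'' = (nats s1 ''X'')(k := min e (?G k))"
        and e': "nats ?s ''e'' 0 = e - min e (?G k)"
        using node True assms(2) e_def by auto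
      have "?J (Suc k) ?s q" if q: "q < K" "q < Suc k" "?p q = 0" for q
      proof (cases "root_of ?p k = q")
        case False
        then have c: "?c (Suc k) q = ?c k q" by (auto simp: component_def less_Suc_eq)
        have "q \<noteq> k" using False q root_of_id by metis
        then have "q < k" using q by simp
        obtain e0 where e0: "e0 + sum (nats s1 ''x'') (?c k q) = ?T q"
          "0 < e0 \<longrightarrow> (\<forall>i\<in>?c k q. nats s1 ''x'' i = ?G i)" using J[OF q(1) \<open>q < k\<close> q(3)] by blast
        have "sum (nats ?s ''x'') (?c k q) = sum (nats s1 ''x'') (?c k q)"
          by (intro sum.cong) (auto simp: x)
        then show ?thesis unfolding c using e0 False by (intro exI[of _ e0]) (auto simp: x)
      next
        case root: True
        have c: "?c (Suc k) q = insert k (?c k q)" using True root by (auto simp: component_def less_Suc_eq)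
        have "e + sum (nats s1 ''x'') (?c k q) = ?T q \<and> (0 < e \<longrightarrow> (\<forall>i\<in>?c k q. nats s1 ''x'' i = ?G i))"
        proof (cases "?p k = 0")
          case p: True
          then have "q = k" using root root_of_id by metis
          have "\<not> j < k" if "root_of ?p j = q" for j
            using root_of_le[of ?p j] that \<open>q = k\<close> by simp
          then have emp: "?c k q = {}" by (auto simp: component_def)
          show ?thesis unfolding emp using p \<open>q = k\<close> by (simp add: e_def)
        next
          case p: False
          then obtain k' where k': "k = Suc k'" using p0 True by (cases k) auto
          then have r: "root_of ?p (k - 1) = q" using root p by simp
          then have "q < k" using root_of_le[of ?p "k - 1"] k' by simp
          from J[OF q(1) this q(3)] show ?thesis using r p True by (auto simp: e_def)
        qed
        moreover have "sum (nats ?s ''x'') (?c k q) = sum (nats s1 ''x'') (?c k q)"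
          by (intro sum.cong) (auto simp: x)
        ultimately show ?thesis
          unfolding c using e' by (intro exI[of _ "e - min e (?G k)"]) (auto simp: x min_def)
      qed
      then show ?thesis using 4(2) x X by (auto simp: less_Suc_eq)
    qed
  qed (simp_all add: distribute_node_def)
  then have I: "?I n s'" unfolding s'_def .
  then show "\<forall>i<K. nats s' ''x'' i \<le> ?G i \<and> nats s' ''X'' i = nats s' ''x'' i"
    using assms(3) by (meson less_le_trans)
  have c: "?c n q = component K ?p q" for q using assms(3) by (auto simp: component_def)
  show "\<forall>q<K. ?p q = 0 \<longrightarrow> (\<exists>e. e + sum (nats s' ''x'') (component K ?p q) = ?T q \<and>
       (0 < e \<longrightarrow> (\<forall>i\<in>component K ?p q. nats s' ''x'' i = ?G i)))"
  proof (intro allI impI)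
    fix q assume q: "q < K" "?p q = 0"
    have "?J n s' q"
      by (rule conjunct2[OF I, rule_format, OF q(1) _ q(2)]) (use q(1) assms(3) in simp)
    then show "\<exists>e. e + sum (nats s' ''x'') (component K ?p q) = ?T q \<and>
       (0 < e \<longrightarrow> (\<forall>i\<in>component K ?p q. nats s' ''x'' i = ?G i))"
      unfolding c by (elim exE conjE) (intro exI conjI)
  qed
qed

abbreviation quotas_of :: "state \<Rightarrow> bool" where
  "quotas_of s \<equiv> quotas n l U d r (nats s ''K'' 0) (nats s ''ctr'') (nats s ''par'')
     (nats s ''cov'') (nats s ''near'') (nats s ''home'') (nats s ''ball'')
     (nats s ''T'') (nats s ''A'') (nats s ''G'') (nats s ''x'') (nats s ''X'')"

lemma sem_quota:
  assumes r0: "ready s" and cl: "clustered_of s" and K: "nats s ''K'' 0 \<le> n"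
    and z: "\<And>i. i < n \<Longrightarrow> nats s ''T'' i = 0 \<and> nats s ''A'' i = 0 \<and> nats s ''G'' i = 0"
  shows "quotas_of (sem quota s)"
proof -
  interpret clustered n l U d r "nats s ''K'' 0" "nats s ''ctr''" "nats s ''par''"
     "nats s ''cov''" "nats s ''near''" "nats s ''home''" "nats s ''ball''" by (rule cl)
  let ?K = "nats s ''K'' 0"
  define s1 where "s1 = sem count s"
  define s2 where "s2 = sem ascend s1"
  define s3 where "s3 = sem distribute s2"
  define s4 where "s4 = sem accumulate s3"
  have s4: "sem quota s = s4" by (simp add: quota_def s1_def s2_def s3_def s4_def)
  have r1: "ready s1" unfolding s1_def using r0 by (subst ready_sem) (simp_all add: quota_defs)
  have r2: "ready s2" unfolding s2_def using r1 by (subst ready_sem) (simp_all add: quota_defs)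
  have r3: "ready s3" unfolding s3_def using r2 by (subst ready_sem) (simp_all add: quota_defs)
  have f1: "nats s1 a = nats s a" if "a \<in> {''K'', ''ctr'', ''par'', ''cov'', ''near'', ''home'', ''ball''}" for a
    unfolding s1_def by (rule nats_sem) (use that in \<open>auto simp: quota_defs\<close>)
  have f2: "nats s2 a = nats s1 a" if "a \<in> {''K'', ''ctr'', ''par'', ''cov'', ''near'', ''home'', ''ball''}" for a
    unfolding s2_def by (rule nats_sem) (use that in \<open>auto simp: quota_defs\<close>)
  have f3: "nats s3 a = nats s2 a" if "a \<in> {''K'', ''ctr'', ''par'', ''cov'', ''near'', ''home'', ''ball'', ''T'', ''A'', ''G''}" for a
    unfolding s3_def by (rule nats_sem) (use that in \<open>auto simp: quota_defs\<close>)
  have f4: "nats s4 a = nats s3 a"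
    if "a \<in> {''K'', ''ctr'', ''par'', ''cov'', ''near'', ''home'', ''ball'', ''T'', ''A'', ''G'', ''x''}" for a
    unfolding s4_def by (rule nats_sem) (use that in \<open>auto simp: quota_defs\<close>)
  have b1: "balanced ?K (\<lambda>i. card {v. v < n \<and> nats s ''home'' v = Suc i}) s1"
    unfolding s1_def by (rule sem_count[OF r0]) (use home_Suc z K in auto)
  have b2: "balanced ?K (\<lambda>i. card {v. v < n \<and> nats s ''home'' v = Suc i} +
      sum (nats s2 ''T'') (children ?K (nats s ''par'') i)) s2"
    using sem_ascend[OF r1 _ K _ b1] par_Suc f1 by (simp add: s2_def)
  have K2: "nats s2 ''K'' 0 = ?K" and p2: "nats s2 ''par'' = nats s ''par''"
    using f1 f2 by simp_all
  note d3 = sem_distribute[OF r2 K2 K, unfolded p2, OF par_zero, folded s3_def]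
  have K3: "nats s3 ''K'' 0 = ?K" and p3: "nats s3 ''par'' = nats s ''par''"
    using f3 K2 p2 by simp_all
  have X4: "\<forall>i<?K. nats s4 ''X'' i = nats s3 ''x'' i + sum (nats s4 ''X'') (children ?K (nats s ''par'') i)"
    using sem_accumulate[OF r3 K3 K, unfolded p3, of "nats s3 ''x''", folded s4_def] par_Suc d3(1) by blast
  have e4: "nats s4 ''K'' = nats s ''K''" "nats s4 ''ctr'' = nats s ''ctr''" "nats s4 ''par'' = nats s ''par''"
    "nats s4 ''cov'' = nats s ''cov''" "nats s4 ''near'' = nats s ''near''" "nats s4 ''home'' = nats s ''home''"
    "nats s4 ''ball'' = nats s ''ball''" "nats s4 ''T'' = nats s2 ''T''" "nats s4 ''A'' = nats s2 ''A''"
    "nats s4 ''G'' = nats s2 ''G''" "nats s4 ''x'' = nats s3 ''x''"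
    by (simp_all add: f1 f2 f3 f4)
  show ?thesis
    unfolding s4 e4
    by unfold_locales (use b2 d3 X4 in \<open>auto simp: balanced_def\<close>)
qed

end

section \<open>Invariants for moving vertices and forming stars\<close>

text \<open>The two corrections stand on opposite sides because subtraction is truncated on
  \<open>nat\<close> and absent from a general commutative monoid.\<close>

lemma sum_point_update:
  fixes g g' :: "'a \<Rightarrow> 'b::comm_monoid_add"
  assumes "finite S" "\<And>c. c \<noteq> i \<Longrightarrow> g' c = g c"
  shows "sum g' S + (if i \<in> S then g i else 0) = sum g S + (if i \<in> S then g' i else 0)"
proof (cases "i \<in> S")
  case True
  have "sum g' (S - {i}) = sum g (S - {i})" by (rule sum.cong) (use assms(2) in auto)
  then show ?thesis
    using True sum.remove[OF assms(1) True, of g] sum.remove[OF assms(1) True, of g']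
    by (simp add: ac_simps)
next
  case False
  have "sum g' S = sum g S" by (metis False assms(2) sum.cong)
  then show ?thesis using False by simp
qed

lemma card_point_update:
  fixes v n :: nat
  assumes "v < n" "\<And>w. w \<noteq> v \<Longrightarrow> Q w = P w"
  shows "card {w. w < n \<and> Q w} + (if P v then 1 else 0) = card {w. w < n \<and> P w} + (if Q v then 1 else 0)"
proof -
  have c: "card {w. w < n \<and> R w} = (\<Sum>w<n. if R w then 1 else 0)" for R
    using sum.inter_filter[of "{..<n}" "\<lambda>_. 1 :: nat" R] by simp
  show ?thesis
    unfolding c
    using sum_point_update[of "{..<n}" v "\<lambda>w. if Q w then 1 else 0 :: nat" "\<lambda>w. if P w then 1 else 0"] assms
    by simp
qed

section \<open>Carrying out the net flow along the tree edges\<close>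

context clustered
begin

definition flow :: "(nat \<Rightarrow> nat) \<Rightarrow> (nat \<Rightarrow> nat) \<Rightarrow> nat \<Rightarrow> int" where
  "flow T X i = int (T i) - int (X i)"

text \<open>The size that pool \<open>q\<close> will have once all pending flow is carried out. A
  positive \<open>flow\<close> points to the parent; integers are used since either direction may
  prevail on an edge.\<close>

definition pool_balance :: "(nat \<Rightarrow> nat) \<Rightarrow> (nat \<Rightarrow> nat) \<Rightarrow> (nat \<Rightarrow> nat) \<Rightarrow> nat \<Rightarrow> int" where
  "pool_balance T X hm q = int (card {v. v < n \<and> hm v = Suc q}) +
     (\<Sum>c\<in>children K par q. flow T X c) - (if par q = 0 then 0 else flow T X q)"

text \<open>Truncated subtraction retains exactly the edges on which \<open>q\<close> is the
  sender.\<close>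

definition outflow :: "(nat \<Rightarrow> nat) \<Rightarrow> (nat \<Rightarrow> nat) \<Rightarrow> nat \<Rightarrow> nat" where
  "outflow T X q = (\<Sum>c\<in>children K par q. X c - T c) + (if par q = 0 then 0 else T q - X q)"

text \<open>Nonzero \<open>bl\<close> marks the movable stock: vertices that are still within
  \<open>r\<close> of the pick of their pool. The strict inequality keeps the stock of every pool
  nonempty, so a sender cannot run dry.\<close>

definition shift_inv ::
    "(nat \<Rightarrow> int) \<Rightarrow> (nat \<Rightarrow> nat) \<Rightarrow> (nat \<Rightarrow> nat) \<Rightarrow> (nat \<Rightarrow> nat) \<Rightarrow> (nat \<Rightarrow> nat) \<Rightarrow> bool" where
  "shift_inv W T X hm bl \<longleftrightarrow>
     (\<forall>q<K. pool_balance T X hm q = W q \<and>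
        outflow T X q < card {v. v < n \<and> bl v \<noteq> 0 \<and> hm v = Suc q}) \<and>
     (\<forall>v<n. \<forall>i. hm v = Suc i \<longrightarrow> i < K \<and> d (ctr i) v \<le> 5 * r \<and> (bl v \<noteq> 0 \<longrightarrow> d (ctr i) v \<le> r))"

text \<open>At both ends of the edge the change in pool size cancels against the change in pending
  flow. The sender loses one unit of stock and one unit of outflow. The receiver keeps both, since
  the arriving vertex loses its mark; so no vertex moves twice, and its distance to the new pick is
  at most \<open>r\<close> plus 4r.\<close>

lemma shift_move:
  assumes inv: "shift_inv W T X hm bl" and i: "i < K" "par i = Suc p" and v: "v < n" "bl v \<noteq> 0" "hm v = Suc a"
    and dir: "a = i \<and> b = p \<and> X i < T i \<and> T' = T \<and> X' = X(i := X i + 1) \<or>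
      a = p \<and> b = i \<and> T i < X i \<and> T' = T(i := T i + 1) \<and> X' = X"
  shows "shift_inv W T' X' (hm(v := Suc b)) (bl(v := 0))"
proof -
  let ?h = "hm(v := Suc b)" and ?b = "bl(v := 0)"
  have pi: "p < i" "d (ctr p) (ctr i) \<le> 4 * r" using par_Suc[OF i] by auto
  then have "p < K" using i by simp
  have child: "i \<in> children K par q \<longleftrightarrow> q = p" for q using i by (auto simp: children_def)
  have ab: "a = i \<and> b = p \<or> a = p \<and> b = i" using dir by blast
  have balance: "pool_balance T' X' ?h q = pool_balance T X hm q" for q
  proof -
    define C C' where "C = int (card {w. w < n \<and> hm w = Suc q})"
      and "C' = int (card {w. w < n \<and> ?h w = Suc q})"
    define D D' where "D = (\<Sum>c\<in>children K par q. flow T X c)"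
      and "D' = (\<Sum>c\<in>children K par q. flow T' X' c)"
    have "flow T' X' c = flow T X c" if "c \<noteq> i" for c using dir that by (auto simp: flow_def)
    note f' = this
    have 1: "D' + (if q = p then flow T X i else 0) = D + (if q = p then flow T' X' i else 0)"
      using sum_point_update[of "children K par q" i "flow T' X'" "flow T X"] f'
      by (simp add: child D_def D'_def)
    have "card {w. w < n \<and> ?h w = Suc q} + (if hm v = Suc q then 1 else 0) =
        card {w. w < n \<and> hm w = Suc q} + (if ?h v = Suc q then 1 else 0)"
      by (rule card_point_update) (use v in auto)
    then have "C' + int (if hm v = Suc q then 1 else 0) = C + int (if ?h v = Suc q then 1 else 0)"
      unfolding C_def C'_def of_nat_add[symmetric] by (rule arg_cong)
    then have 2: "C' + (if a = q then 1 else 0) = C + (if b = q then 1 else 0)"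
      using v(3) by (cases "a = q"; cases "b = q") simp_all
    have f: "flow T' X' i = flow T X i + (if a = i then - 1 else 1)"
      using dir
    proof (elim disjE conjE)
      assume "a = i" "T' = T" "X' = X(i := X i + 1)"
      then show ?thesis by (simp add: flow_def)
    next
      assume "a = p" "X' = X" "T' = T(i := T i + 1)"
      then show ?thesis using pi(1) by (simp add: flow_def)
    qed
    have "C' + D' - (if par q = 0 then 0 else flow T' X' q) = C + D - (if par q = 0 then 0 else flow T X q)"
      using ab
      by (elim disjE conjE; cases "q = i"; cases "q = p"; use 1 2 f f'[of q] pi(1) i(2) in simp)
    then show ?thesis by (simp only: pool_balance_def C_def C'_def D_def D'_def)
  qed
  have out: "outflow T' X' q < card {w. w < n \<and> ?b w \<noteq> 0 \<and> ?h w = Suc q}" if q: "q < K" for q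
  proof -
    define B B' where "B = card {w. w < n \<and> bl w \<noteq> 0 \<and> hm w = Suc q}"
      and "B' = card {w. w < n \<and> ?b w \<noteq> 0 \<and> ?h w = Suc q}"
    define D D' where "D = (\<Sum>c\<in>children K par q. X c - T c)"
      and "D' = (\<Sum>c\<in>children K par q. X' c - T' c)"
    have f': "T' c = T c" "X' c = X c" if "c \<noteq> i" for c using dir that by auto
    have 1: "D' + (if q = p then X i - T i else 0) = D + (if q = p then X' i - T' i else 0)"
      using sum_point_update[of "children K par q" i "\<lambda>c. X' c - T' c" "\<lambda>c. X c - T c"] f'
      by (simp add: child D_def D'_def)
    have "B' + (if bl v \<noteq> 0 \<and> hm v = Suc q then 1 else 0) = B + (if ?b v \<noteq> 0 \<and> ?h v = Suc q then 1 else 0)"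
      unfolding B_def B'_def by (rule card_point_update) (use v in auto)
    then have 2: "B' + (if a = q then 1 else 0) = B" using v by simp
    have old: "D + (if par q = 0 then 0 else T q - X q) < B"
      using inv q by (simp add: shift_inv_def outflow_def D_def B_def)
    have f: "a = i \<and> T' i - X' i + 1 = T i - X i \<and> X' i - T' i = X i - T i \<or>
        a = p \<and> X' i - T' i + 1 = X i - T i \<and> T' i - X' i = T i - X i"
      using dir
    proof (elim disjE conjE)
      assume "a = i" "T' = T" "X' = X(i := X i + 1)" "X i < T i"
      then show ?thesis by simp
    next
      assume "a = p" "X' = X" "T' = T(i := T i + 1)" "T i < X i"
      then show ?thesis by simp
    qed
    have "D' + (if par q = 0 then 0 else T' q - X' q) < B'"
      using f
      by (elim disjE conjE; cases "q = i"; cases "q = p"; cases "par q = 0"; use 1 2 old f'[of q] pi(1) i(2) in simp)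
    then show ?thesis by (simp only: outflow_def D'_def B'_def)
  qed
  have cn: "ctr i < n" "ctr p < n" using ctr_less i \<open>p < K\<close> by auto
  have av: "d (ctr a) v \<le> r" using inv v by (auto simp: shift_inv_def)
  have "b < K" using ab i \<open>p < K\<close> by auto
  moreover have "d (ctr b) v \<le> 5 * r"
    using dir
  proof
    assume "a = i \<and> b = p \<and> X i < T i \<and> T' = T \<and> X' = X(i := X i + 1)"
    then show ?thesis using tri[of "ctr p" "ctr i" v] cn v av pi by simp
  next
    assume "a = p \<and> b = i \<and> T i < X i \<and> T' = T(i := T i + 1) \<and> X' = X"
    then show ?thesis using tri[of "ctr i" "ctr p" v] sym[of "ctr i" "ctr p"] cn v av pi by simp
  qed
  ultimately show ?thesis
    using inv balance out unfolding shift_inv_def by simp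
qed

text \<open>The two last premises describe a completed scan: a sender that still owes vertices has
  no stock left. This contradicts the nonempty stock that the invariant grants to every
  pool.\<close>

lemma shift_done:
  assumes inv: "shift_inv W T X hm bl" and i: "i < K" "par i = Suc p"
    and "X i < T i \<Longrightarrow> \<forall>v<n. \<not> (bl v \<noteq> 0 \<and> hm v = Suc i)"
    and "T i < X i \<Longrightarrow> \<forall>v<n. \<not> (bl v \<noteq> 0 \<and> hm v = Suc p)"
  shows "T i = X i"
proof (rule ccontr)
  have pos: "\<exists>v<n. bl v \<noteq> 0 \<and> hm v = Suc q" if "q < K" for q
  proof (rule ccontr)
    assume "\<not> ?thesis"
    then have e: "{v. v < n \<and> bl v \<noteq> 0 \<and> hm v = Suc q} = {}" by blast
    have "outflow T X q < card {v. v < n \<and> bl v \<noteq> 0 \<and> hm v = Suc q}"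
      using inv that by (simp add: shift_inv_def)
    then show False unfolding e by simp
  qed
  assume "T i \<noteq> X i"
  then consider "X i < T i" | "T i < X i" by linarith
  then show False
  proof cases
    case 1
    then show False using pos[OF i(1)] assms(4) by blast
  next
    case 2
    have "p < K" using par_Suc[OF i] i by simp
    then show False using pos[of p] assms(5)[OF 2] by blast
  qed
qed

lemma shift_final:
  assumes inv: "shift_inv W T X hm bl" and "\<And>i. i < K \<Longrightarrow> par i \<noteq> 0 \<Longrightarrow> T i = X i" and q: "q < K"
  shows "int (card {v. v < n \<and> hm v = Suc q}) = W q"
proof -
  have "(\<Sum>c\<in>children K par q. flow T X c) = 0"
    by (rule sum.neutral) (use assms(2) in \<open>auto simp: children_def flow_def\<close>)
  moreover have "pool_balance T X hm q = W q" using inv q by (simp add: shift_inv_def)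
  ultimately show ?thesis using assms(2)[OF q] by (auto simp: pool_balance_def flow_def split: if_splits)
qed

end

context quotas
begin

lemma shift_inv_start: "shift_inv (pool_balance T X home) T X home ball"
proof -
  have "outflow T X q < card {v. v < n \<and> ball v \<noteq> 0 \<and> home v = Suc q}" if "q < K" for q
    using outflow_less[OF that] card_ball[OF that] by (simp add: outflow_def)
  moreover have "i < K \<and> d (ctr i) v \<le> 5 * r \<and> (ball v \<noteq> 0 \<longrightarrow> d (ctr i) v \<le> r)"
    if v: "v < n" "home v = Suc i" for v i
    using home_Suc[OF v] ball_1[of v] v r_nonneg by auto
  ultimately show ?thesis by (auto simp: shift_inv_def)
qed

text \<open>Inserting the laws \<open>AT\<close> and \<open>X_eq\<close> leaves exactly
  \<open>A q + x q\<close> when \<open>q\<close> has a parent. A root keeps \<open>T q - X q\<close>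
  more, the part of the remainder for which the stars of its tree have no capacity.\<close>

lemma pool_balance_ge:
  assumes q: "q < K"
  shows "int (A q + x q) \<le> pool_balance T X home q"
proof -
  have "(\<Sum>c\<in>children K par q. flow T X c) =
      int (\<Sum>c\<in>children K par q. T c) - int (\<Sum>c\<in>children K par q. X c)"
    by (simp add: flow_def sum_subtractf)
  moreover have "int (A q) + int (T q) = int (card {v. v < n \<and> home v = Suc q}) + int (\<Sum>c\<in>children K par q. T c)"
    using AT[OF q] by linarith
  moreover have "int (X q) = int (x q) + int (\<Sum>c\<in>children K par q. X c)"
    using X_eq[OF q] by linarith
  moreover have "X q \<le> T q" if "par q = 0"
    using X_root[OF q that] x_sum[OF q that] by auto
  ultimately show ?thesis by (auto simp: pool_balance_def flow_def)
qed

end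

section \<open>Forming stars within the pools by one scan of the vertices\<close>

context radius_instance
begin

text \<open>The vertices below \<open>k\<close> have been processed. The current star of cluster \<open>i\<close> has center \<open>y i\<close> and \<open>g i\<close>
  free places; \<open>A\<close> and \<open>x\<close> describe the stars that are not opened yet.\<close>

definition star_inv ::
    "nat \<Rightarrow> (nat \<Rightarrow> nat) \<Rightarrow> nat \<Rightarrow> nat \<Rightarrow> nat \<Rightarrow> nat \<Rightarrow> (nat \<Rightarrow> nat) \<Rightarrow> (nat \<Rightarrow> nat) \<Rightarrow> (nat \<Rightarrow> nat) \<Rightarrow>
      (nat \<Rightarrow> nat) \<Rightarrow> (nat \<Rightarrow> nat) \<Rightarrow> (nat \<Rightarrow> nat) \<Rightarrow> (nat \<Rightarrow> nat) \<Rightarrow> bool" where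
  "star_inv K hm N k k' t A x g y S Op f \<longleftrightarrow>
     (\<forall>i<K. A i + g i + x i \<le> card {v. v < n \<and> k \<le> v \<and> hm v = Suc i}) \<and>
     (\<forall>i<K. \<exists>a. A i = a * l \<and> x i \<le> a * (U - l)) \<and>
     t + (\<Sum>i<K. A i + g i + x i) = N \<and>
     t = card {v. v < n \<and> S v \<noteq> 0} \<and>
     (\<forall>v<n. S v \<noteq> 0 \<longrightarrow> v < k \<and> hm v \<noteq> 0 \<and> f v < n \<and> Op (f v) \<noteq> 0 \<and> hm (f v) = hm v) \<and>
     (\<forall>u<n. Op u \<noteq> 0 \<longrightarrow> u < k' \<and> hm u \<noteq> 0 \<and> (\<forall>i. hm u = Suc i \<longrightarrow>
        (let F = card {v. v < n \<and> S v \<noteq> 0 \<and> f v = u} + (if 0 < g i \<and> y i = u then g i else 0)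
         in l \<le> F \<and> F \<le> U))) \<and>
     (\<forall>i<K. 0 < g i \<longrightarrow> y i < n \<and> Op (y i) \<noteq> 0 \<and> hm (y i) = Suc i)"

lemma star_invD:
  assumes "star_inv K hm N k k' t A x g y S Op f"
  shows "i < K \<Longrightarrow> A i + g i + x i \<le> card {v. v < n \<and> k \<le> v \<and> hm v = Suc i}"
    and "i < K \<Longrightarrow> \<exists>a. A i = a * l \<and> x i \<le> a * (U - l)"
    and "t + (\<Sum>i<K. A i + g i + x i) = N"
    and "t = card {v. v < n \<and> S v \<noteq> 0}"
    and "v < n \<Longrightarrow> S v \<noteq> 0 \<Longrightarrow> v < k \<and> hm v \<noteq> 0 \<and> f v < n \<and> Op (f v) \<noteq> 0 \<and> hm (f v) = hm v"
    and "u < n \<Longrightarrow> Op u \<noteq> 0 \<Longrightarrow> u < k' \<and> hm u \<noteq> 0"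
    and "u < n \<Longrightarrow> Op u \<noteq> 0 \<Longrightarrow> hm u = Suc i \<Longrightarrow>
        l \<le> card {v. v < n \<and> S v \<noteq> 0 \<and> f v = u} + (if 0 < g i \<and> y i = u then g i else 0) \<and>
        card {v. v < n \<and> S v \<noteq> 0 \<and> f v = u} + (if 0 < g i \<and> y i = u then g i else 0) \<le> U"
    and "i < K \<Longrightarrow> 0 < g i \<Longrightarrow> y i < n \<and> Op (y i) \<noteq> 0 \<and> hm (y i) = Suc i"
  using assms unfolding star_inv_def Let_def by simp_all

lemma star_invI:
  assumes "\<And>i. i < K \<Longrightarrow> A i + g i + x i \<le> card {v. v < n \<and> k \<le> v \<and> hm v = Suc i}"
    and "\<And>i. i < K \<Longrightarrow> \<exists>a. A i = a * l \<and> x i \<le> a * (U - l)"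
    and "t + (\<Sum>i<K. A i + g i + x i) = N"
    and "t = card {v. v < n \<and> S v \<noteq> 0}"
    and "\<And>v. v < n \<Longrightarrow> S v \<noteq> 0 \<Longrightarrow> v < k \<and> hm v \<noteq> 0 \<and> f v < n \<and> Op (f v) \<noteq> 0 \<and> hm (f v) = hm v"
    and "\<And>u. u < n \<Longrightarrow> Op u \<noteq> 0 \<Longrightarrow> u < k' \<and> hm u \<noteq> 0"
    and "\<And>u i. u < n \<Longrightarrow> Op u \<noteq> 0 \<Longrightarrow> hm u = Suc i \<Longrightarrow>
        l \<le> card {v. v < n \<and> S v \<noteq> 0 \<and> f v = u} + (if 0 < g i \<and> y i = u then g i else 0) \<and>
        card {v. v < n \<and> S v \<noteq> 0 \<and> f v = u} + (if 0 < g i \<and> y i = u then g i else 0) \<le> U"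
    and "\<And>i. i < K \<Longrightarrow> 0 < g i \<Longrightarrow> y i < n \<and> Op (y i) \<noteq> 0 \<and> hm (y i) = Suc i"
  shows "star_inv K hm N k k' t A x g y S Op f"
  unfolding star_inv_def Let_def using assms by (intro conjI allI impI) simp_all

lemma card_from_Suc:
  assumes "k < n"
  shows "card {v. v < n \<and> k \<le> v \<and> P v} =
    (if P k then 1 else 0) + card {v. v < n \<and> Suc k \<le> v \<and> P v}"
proof -
  have "{v. v < n \<and> k \<le> v \<and> P v} =
      (if P k then insert k {v. v < n \<and> Suc k \<le> v \<and> P v} else {v. v < n \<and> Suc k \<le> v \<and> P v})"
    using assms by (auto simp: Suc_le_eq le_less)
  then show ?thesis by simp
qed

text \<open>A vertex may stay unserved only if its pool has no place left. This follows from
  \<open>A i = 0\<close> and \<open>g i = 0\<close>, because the extra vertices \<open>x i\<close>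
  are bounded by the capacity of the unopened stars, of which there are none.\<close>

lemma star_skip:
  assumes inv: "star_inv K hm N k k t A x g y S Op f" and k: "k < n"
    and "\<And>i. hm k = Suc i \<Longrightarrow> i < K \<Longrightarrow> g i = 0 \<and> A i = 0"
  shows "star_inv K hm N (Suc k) (Suc k) t A x g y S Op f"
proof (rule star_invI)
  fix i assume i: "i < K"
  show "A i + g i + x i \<le> card {v. v < n \<and> Suc k \<le> v \<and> hm v = Suc i}"
  proof (cases "hm k = Suc i")
    case True
    then have "g i = 0" "A i = 0" using assms(3) i by auto
    moreover have "x i = 0" using star_invD(2)[OF inv i] \<open>A i = 0\<close> l_pos by auto
    ultimately show ?thesis by simp
  next
    case False
    then show ?thesis using star_invD(1)[OF inv i] card_from_Suc[OF k, of "\<lambda>v. hm v = Suc i"] by simp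
  qed
next
  show "\<exists>a. A i = a * l \<and> x i \<le> a * (U - l)" if "i < K" for i by (rule star_invD(2)[OF inv that])
  show "t + (\<Sum>i<K. A i + g i + x i) = N" by (rule star_invD(3)[OF inv])
  show "t = card {v. v < n \<and> S v \<noteq> 0}" by (rule star_invD(4)[OF inv])
  show "v < Suc k \<and> hm v \<noteq> 0 \<and> f v < n \<and> Op (f v) \<noteq> 0 \<and> hm (f v) = hm v"
    if "v < n" "S v \<noteq> 0" for v using star_invD(5)[OF inv that] by simp
  show "u < Suc k \<and> hm u \<noteq> 0" if "u < n" "Op u \<noteq> 0" for u using star_invD(6)[OF inv that] by simp
  show "l \<le> card {v. v < n \<and> S v \<noteq> 0 \<and> f v = u} + (if 0 < g i \<and> y i = u then g i else 0) \<and>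
        card {v. v < n \<and> S v \<noteq> 0 \<and> f v = u} + (if 0 < g i \<and> y i = u then g i else 0) \<le> U"
    if "u < n" "Op u \<noteq> 0" "hm u = Suc i" for u i by (rule star_invD(7)[OF inv that])
  show "y i < n \<and> Op (y i) \<noteq> 0 \<and> hm (y i) = Suc i" if "i < K" "0 < g i" for i
    by (rule star_invD(8)[OF inv that])
qed

text \<open>All \<open>l + w\<close> places are reserved at once, so the final size of the star,
  between \<open>l\<close> and \<open>U\<close>, is settled here. Taking \<open>w\<close> as large
  as possible leaves at most \<open>b * (U - l)\<close> extra vertices for the other
  \<open>b\<close> stars. The bound on opened vertices runs ahead to \<open>Suc k\<close> because
  \<open>k\<close> becomes a center before it is served.\<close>

lemma star_open:
  assumes inv: "star_inv K hm N k k t A x g y S Op f" and k: "k < n" "hm k = Suc i" "i < K"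
    and gA: "g i = 0" "0 < A i" and w: "w = min (x i) (U - l)"
  shows "star_inv K hm N k (Suc k) t (A(i := A i - l)) (x(i := x i - w)) (g(i := l + w)) (y(i := k)) S (Op(k := 1)) f"
proof -
  let ?A = "A(i := A i - l)" and ?x = "x(i := x i - w)" and ?g = "g(i := l + w)" and ?y = "y(i := k)"
  obtain a where a: "A i = a * l" "x i \<le> a * (U - l)" using star_invD(2)[OF inv k(3)] by blast
  then obtain b where b: "a = Suc b" using gA by (cases a) auto
  have "l \<le> A i" using a b by simp
  then have eq: "?A j + ?g j + ?x j = A j + g j + x j" for j
    using gA w by auto
  have nok: "Op k = 0" using star_invD(6)[OF inv k(1)] by auto
  show ?thesis
  proof (rule star_invI)
    show "?A j + ?g j + ?x j \<le> card {v. v < n \<and> k \<le> v \<and> hm v = Suc j}" if "j < K" for j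
      unfolding eq by (rule star_invD(1)[OF inv that])
    show "\<exists>a. ?A j = a * l \<and> ?x j \<le> a * (U - l)" if "j < K" for j
    proof (cases "j = i")
      case True
      then show ?thesis using a b w by (intro exI[of _ b]) auto
    next
      case False
      then show ?thesis using star_invD(2)[OF inv that] by simp
    qed
    show "t + (\<Sum>i<K. ?A i + ?g i + ?x i) = N" unfolding eq by (rule star_invD(3)[OF inv])
    show "t = card {v. v < n \<and> S v \<noteq> 0}" by (rule star_invD(4)[OF inv])
    show "v < k \<and> hm v \<noteq> 0 \<and> f v < n \<and> (Op(k := 1)) (f v) \<noteq> 0 \<and> hm (f v) = hm v"
      if "v < n" "S v \<noteq> 0" for v using star_invD(5)[OF inv that] by simp
    show "u < Suc k \<and> hm u \<noteq> 0" if "u < n" "(Op(k := 1)) u \<noteq> 0" for u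
      using star_invD(6)[OF inv that(1)] that k(2) by (auto split: if_splits)
    show "?y j < n \<and> (Op(k := 1)) (?y j) \<noteq> 0 \<and> hm (?y j) = Suc j" if "j < K" "0 < ?g j" for j
      using star_invD(8)[OF inv that(1)] that k by (auto split: if_splits)
    fix u j assume u: "u < n" "(Op(k := 1)) u \<noteq> 0" "hm u = Suc j"
    let ?F = "card {v. v < n \<and> S v \<noteq> 0 \<and> f v = u}"
    show "l \<le> ?F + (if 0 < ?g j \<and> ?y j = u then ?g j else 0) \<and>
        ?F + (if 0 < ?g j \<and> ?y j = u then ?g j else 0) \<le> U"
    proof (cases "u = k")
      case True
      then have "j = i" using u k by simp
      \<comment> \<open>Served vertices are assigned to centers that are already open, and
        \<open>k\<close> was not, so the new star starts empty.\<close>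
      have "\<not> (v < n \<and> S v \<noteq> 0 \<and> f v = u)" for v
        using star_invD(5)[OF inv, of v] nok True by auto
      then have F: "?F = 0" by simp
      show ?thesis unfolding F using True \<open>j = i\<close> w l_pos l_le by simp
    next
      case False
      then have "Op u \<noteq> 0" using u by simp
      from star_invD(7)[OF inv u(1) this u(3)] show ?thesis
        using False gA by (cases "j = i") auto
    qed
  qed
qed

text \<open>A reserved place turns into an occupied one. The sum of both, which is what the
  invariant bounds by \<open>l\<close> and \<open>U\<close>, does not change, and neither does the
  total of served vertices and open places.\<close>

lemma star_serve:
  assumes inv: "star_inv K hm N k (Suc k) t A x g y S Op f" and k: "k < n" "hm k = Suc i" "i < K"
    and g: "0 < g i"
  shows "star_inv K hm N (Suc k) (Suc k) (Suc t) A x (g(i := g i - 1)) y (S(k := 1)) Op (f(k := y i))"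
proof -
  let ?g = "g(i := g i - 1)" and ?S = "S(k := 1)" and ?f = "f(k := y i)"
  have Sk: "S k = 0" using star_invD(5)[OF inv k(1)] by auto
  note y = star_invD(8)[OF inv k(3) g]
  show ?thesis
  proof (rule star_invI)
    fix j assume j: "j < K"
    show "A j + ?g j + x j \<le> card {v. v < n \<and> Suc k \<le> v \<and> hm v = Suc j}"
      using star_invD(1)[OF inv j] card_from_Suc[OF k(1), of "\<lambda>v. hm v = Suc j"] g k by auto
    show "\<exists>a. A j = a * l \<and> x j \<le> a * (U - l)" by (rule star_invD(2)[OF inv j])
    show "y j < n \<and> Op (y j) \<noteq> 0 \<and> hm (y j) = Suc j" if "0 < ?g j"
      using star_invD(8)[OF inv j] that by (auto split: if_splits)
  next
    have "(\<Sum>j<K. A j + ?g j + x j) + (A i + g i + x i) = (\<Sum>j<K. A j + g j + x j) + (A i + ?g i + x i)"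
      using sum_point_update[of "{..<K}" i "\<lambda>j. A j + ?g j + x j" "\<lambda>j. A j + g j + x j"] k by simp
    then show "Suc t + (\<Sum>j<K. A j + ?g j + x j) = N" using star_invD(3)[OF inv] g by simp
  next
    have "card {v. v < n \<and> ?S v \<noteq> 0} = card {v. v < n \<and> S v \<noteq> 0} + 1"
      using card_point_update[of k n "\<lambda>v. ?S v \<noteq> 0" "\<lambda>v. S v \<noteq> 0"] k Sk by simp
    then show "Suc t = card {v. v < n \<and> ?S v \<noteq> 0}" using star_invD(4)[OF inv] by simp
  next
    show "v < Suc k \<and> hm v \<noteq> 0 \<and> ?f v < n \<and> Op (?f v) \<noteq> 0 \<and> hm (?f v) = hm v"
      if "v < n" "?S v \<noteq> 0" for v
      using star_invD(5)[OF inv that(1)] that y k by (cases "v = k") auto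
    show "u < Suc k \<and> hm u \<noteq> 0" if "u < n" "Op u \<noteq> 0" for u
      by (rule star_invD(6)[OF inv that])
    fix u j assume u: "u < n" "Op u \<noteq> 0" "hm u = Suc j"
    let ?F = "card {v. v < n \<and> S v \<noteq> 0 \<and> f v = u}" and ?F' = "card {v. v < n \<and> ?S v \<noteq> 0 \<and> ?f v = u}"
    have F: "?F' = ?F + (if y i = u then 1 else 0)"
      using card_point_update[of k n "\<lambda>v. ?S v \<noteq> 0 \<and> ?f v = u" "\<lambda>v. S v \<noteq> 0 \<and> f v = u"] k Sk by simp
    have "j = i" if "y i = u" using that y u by simp
    then have "?F' + (if 0 < ?g j \<and> y j = u then ?g j else 0) = ?F + (if 0 < g j \<and> y j = u then g j else 0)"
      unfolding F using g by (cases "j = i") auto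
    then show "l \<le> ?F' + (if 0 < ?g j \<and> y j = u then ?g j else 0) \<and>
        ?F' + (if 0 < ?g j \<and> y j = u then ?g j else 0) \<le> U"
      using star_invD(7)[OF inv u] by simp
  qed
qed

end

section \<open>Moving vertices and forming stars\<close>

text \<open>The smaller of \<open>T\<close> and \<open>X\<close> at \<open>i\<close> is raised by
  one per move; only their difference, the flow still pending on the edge, has a meaning
  here.\<close>

definition shift_vertex :: prog where
  "shift_vertex = PIf (Pos (NGet ''ball'' (scal ''v'')))
     (PIf (Conj (NLess (NGet ''X'' (scal ''i'')) (NGet ''T'' (scal ''i'')))
           (Eq (NGet ''home'' (scal ''v'')) (NPlus (scal ''i'') One)))
       (PN ''home'' (scal ''v'') (NGet ''par'' (scal ''i'')) ;; PN ''ball'' (scal ''v'') Zero ;;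
        PN ''X'' (scal ''i'') (NPlus (NGet ''X'' (scal ''i'')) One))
       (PIf (Conj (NLess (NGet ''T'' (scal ''i'')) (NGet ''X'' (scal ''i'')))
             (Eq (NGet ''home'' (scal ''v'')) (NGet ''par'' (scal ''i''))))
         (PN ''home'' (scal ''v'') (NPlus (scal ''i'') One) ;; PN ''ball'' (scal ''v'') Zero ;;
          PN ''T'' (scal ''i'') (NPlus (NGet ''T'' (scal ''i'')) One)) PSkip)) PSkip"

definition shift_node :: prog where
  "shift_node = PIf (Conj (NLess (scal ''i'') (scal ''K'')) (Pos (NGet ''par'' (scal ''i''))))
     (PFor ''v'' shift_vertex) PSkip"

definition shift :: prog where
  "shift = PFor ''i'' shift_node"

definition open_star :: prog where
  "open_star =
     PN ''A'' (scal ''m'') (NMinus (NGet ''A'' (scal ''m'')) (scal ''l'')) ;;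
     PN ''y'' (scal ''m'') (scal ''v'') ;; PN ''O'' (scal ''v'') One ;;
     PIf (NLess (NGet ''x'' (scal ''m'')) (NMinus (scal ''U'') (scal ''l'')))
       (PN ''g'' (scal ''m'') (NPlus (scal ''l'') (NGet ''x'' (scal ''m''))) ;;
        PN ''x'' (scal ''m'') Zero)
       (PN ''g'' (scal ''m'') (scal ''U'') ;;
        PN ''x'' (scal ''m'') (NMinus (NGet ''x'' (scal ''m'')) (NMinus (scal ''U'') (scal ''l''))))"

definition serve :: prog where
  "serve = PN ''S'' (scal ''v'') One ;; PN ''f'' (scal ''v'') (NGet ''y'' (scal ''m'')) ;;
     PN ''g'' (scal ''m'') (Pred (NGet ''g'' (scal ''m''))) ;; PN ''t'' Zero (NPlus (scal ''t'') One)"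

text \<open>After opening a star the vertex falls through to the second test, so a center is the
  first vertex served by its own star.\<close>

definition star_vertex :: prog where
  "star_vertex = PIf (Pos (NGet ''home'' (scal ''v'')))
     (PN ''m'' Zero (Pred (NGet ''home'' (scal ''v''))) ;;
      PIf (Conj (Neg (Pos (NGet ''g'' (scal ''m'')))) (Pos (NGet ''A'' (scal ''m'')))) open_star PSkip ;;
      PIf (Pos (NGet ''g'' (scal ''m''))) serve PSkip) PSkip"

definition stars :: prog where
  "stars = PN ''t'' Zero Zero ;; PFor ''v'' star_vertex"

context clustered
begin

abbreviation shift_inv_of :: "(nat \<Rightarrow> int) \<Rightarrow> state \<Rightarrow> bool" where
  "shift_inv_of W s \<equiv> shift_inv W (nats s ''T'') (nats s ''X'') (nats s ''home'') (nats s ''ball'')"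

lemma sem_shift_vertex:
  assumes inv: "shift_inv_of W s" and i: "i < K" "par i = Suc p" and v: "v < n"
    and s: "nats s ''i'' 0 = i" "nats s ''v'' 0 = v" "nats s ''par'' i = Suc p"
  defines "s' \<equiv> sem shift_vertex s"
  shows "shift_inv_of W s'"
    and "nats s' ''X'' i < nats s' ''T'' i \<Longrightarrow> nats s ''X'' i < nats s ''T'' i \<and>
       \<not> (nats s' ''ball'' v \<noteq> 0 \<and> nats s' ''home'' v = Suc i)"
    and "nats s' ''T'' i < nats s' ''X'' i \<Longrightarrow> nats s ''T'' i < nats s ''X'' i \<and>
       \<not> (nats s' ''ball'' v \<noteq> 0 \<and> nats s' ''home'' v = Suc p)"
    and "\<And>j. j \<noteq> i \<Longrightarrow> nats s' ''T'' j = nats s ''T'' j \<and> nats s' ''X'' j = nats s ''X'' j"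
    and "\<And>w. w \<noteq> v \<Longrightarrow> nats s' ''ball'' w = nats s ''ball'' w \<and> nats s' ''home'' w = nats s ''home'' w"
proof -
  let ?T = "nats s ''T''" and ?X = "nats s ''X''" and ?h = "nats s ''home''" and ?b = "nats s ''ball''"
  have "p < i" using par_Suc[OF i] by simp
  consider (up) "?b v \<noteq> 0" "?X i < ?T i" "?h v = Suc i"
    | (down) "?b v \<noteq> 0" "?T i < ?X i" "?h v = Suc p"
    | (stay) "?b v = 0 \<or> \<not> (?X i < ?T i \<and> ?h v = Suc i) \<and> \<not> (?T i < ?X i \<and> ?h v = Suc p)"
    by satx
  then have "shift_inv_of W s' \<and>
    (nats s' ''X'' i < nats s' ''T'' i \<longrightarrow> ?X i < ?T i \<and> \<not> (nats s' ''ball'' v \<noteq> 0 \<and> nats s' ''home'' v = Suc i)) \<and>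
    (nats s' ''T'' i < nats s' ''X'' i \<longrightarrow> ?T i < ?X i \<and> \<not> (nats s' ''ball'' v \<noteq> 0 \<and> nats s' ''home'' v = Suc p)) \<and>
    (\<forall>j. j \<noteq> i \<longrightarrow> nats s' ''T'' j = ?T j \<and> nats s' ''X'' j = ?X j) \<and>
    (\<forall>w. w \<noteq> v \<longrightarrow> nats s' ''ball'' w = ?b w \<and> nats s' ''home'' w = ?h w)"
  proof cases
    case up
    have e: "nats s' ''T'' = ?T" "nats s' ''X'' = ?X(i := ?X i + 1)" "nats s' ''home'' = ?h(v := Suc p)"
      "nats s' ''ball'' = ?b(v := 0)"
      using up s by (simp_all add: s'_def shift_vertex_def)
    have "shift_inv W ?T (?X(i := ?X i + 1)) (?h(v := Suc p)) (?b(v := 0))"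
      by (rule shift_move[OF inv i v up(1,3)]) (use up in simp)
    then show ?thesis unfolding e using up(2) by simp
  next
    case down
    have e: "nats s' ''X'' = ?X" "nats s' ''T'' = ?T(i := ?T i + 1)" "nats s' ''home'' = ?h(v := Suc i)"
      "nats s' ''ball'' = ?b(v := 0)"
      using down s by (simp_all add: s'_def shift_vertex_def)
    have "shift_inv W (?T(i := ?T i + 1)) ?X (?h(v := Suc i)) (?b(v := 0))"
      by (rule shift_move[OF inv i v down(1,3)]) (use down in simp)
    then show ?thesis unfolding e using down(2) by simp
  next
    case stay
    have "s' = s"
    proof (cases "?b v = 0")
      case False
      then show ?thesis
        using stay s by (cases "?X i < ?T i"; cases "?T i < ?X i"; simp add: s'_def shift_vertex_def)
    qed (use s in \<open>simp add: s'_def shift_vertex_def\<close>)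
    then show ?thesis using inv stay by auto
  qed
  then show "shift_inv_of W s'"
    and "nats s' ''X'' i < nats s' ''T'' i \<Longrightarrow> nats s ''X'' i < nats s ''T'' i \<and>
       \<not> (nats s' ''ball'' v \<noteq> 0 \<and> nats s' ''home'' v = Suc i)"
    and "nats s' ''T'' i < nats s' ''X'' i \<Longrightarrow> nats s ''T'' i < nats s ''X'' i \<and>
       \<not> (nats s' ''ball'' v \<noteq> 0 \<and> nats s' ''home'' v = Suc p)"
    and "\<And>j. j \<noteq> i \<Longrightarrow> nats s' ''T'' j = nats s ''T'' j \<and> nats s' ''X'' j = nats s ''X'' j"
    and "\<And>w. w \<noteq> v \<Longrightarrow> nats s' ''ball'' w = nats s ''ball'' w \<and> nats s' ''home'' w = nats s ''home'' w"
    by simp_all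
qed

lemma sem_shift_node:
  assumes "ready s" and inv: "shift_inv_of W s" and i: "i < K" "par i \<noteq> 0"
    and s: "nats s ''i'' 0 = i" "nats s ''par'' = par" "nats s ''K'' 0 = K"
  defines "s' \<equiv> sem shift_node s"
  shows "shift_inv_of W s'" and "nats s' ''T'' i = nats s' ''X'' i"
    and "\<And>j. j \<noteq> i \<Longrightarrow> nats s' ''T'' j = nats s ''T'' j \<and> nats s' ''X'' j = nats s ''X'' j"
proof -
  obtain p where p: "par i = Suc p" using i by (cases "par i") auto
  \<comment> \<open>While flow is pending in a direction, no scanned vertex is still movable in the
    sending pool, as it would have been moved when met. At the end of the scan this is what
    \<open>shift_done\<close> asks for.\<close>
  let ?I = "\<lambda>k s1. shift_inv_of W s1 \<and>
    (nats s1 ''X'' i < nats s1 ''T'' i \<longrightarrow> (\<forall>v<k. \<not> (nats s1 ''ball'' v \<noteq> 0 \<and> nats s1 ''home'' v = Suc i))) \<and>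
    (nats s1 ''T'' i < nats s1 ''X'' i \<longrightarrow> (\<forall>v<k. \<not> (nats s1 ''ball'' v \<noteq> 0 \<and> nats s1 ''home'' v = Suc p))) \<and>
    (\<forall>j. j \<noteq> i \<longrightarrow> nats s1 ''T'' j = nats s ''T'' j \<and> nats s1 ''X'' j = nats s ''X'' j)"
  have "?I n (sem (PFor ''v'' shift_vertex) s)"
  proof (rule loop_induct[where I = ?I, OF assms(1)], goal_cases)
    case (4 k s1)
    have s1: "nats s1 ''i'' 0 = i" "nats s1 ''par'' i = Suc p"
      using 4(5)[of "''i''"] 4(5)[of "''par''"] s p by (simp_all add: shift_vertex_def)
    note I = 4(2)
    note v = sem_shift_vertex[OF conjunct1[OF I] i(1) p 4(1) s1(1) 4(3) s1(2)]
    have less: "\<not> (nats (sem shift_vertex s1) ''ball'' w \<noteq> 0 \<and> nats (sem shift_vertex s1) ''home'' w = Suc q)"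
      if "w < k" "\<not> (nats s1 ''ball'' w \<noteq> 0 \<and> nats s1 ''home'' w = Suc q)" for w q
      using v(5)[of w] that by simp
    show ?case
      using v(1-4) I less by (simp add: less_Suc_eq)
  qed (use inv in \<open>simp_all add: shift_vertex_def\<close>)
  moreover have "s' = sem (PFor ''v'' shift_vertex) s"
    using i s by (simp add: s'_def shift_node_def)
  ultimately have I: "?I n s'" by simp
  then show "shift_inv_of W s'" by (rule conjunct1)
  show "nats s' ''T'' i = nats s' ''X'' i"
    by (rule shift_done[OF conjunct1[OF I] i(1) p]) (use I in simp_all)
  show "\<And>j. j \<noteq> i \<Longrightarrow> nats s' ''T'' j = nats s ''T'' j \<and> nats s' ''X'' j = nats s ''X'' j"
    using I by simp
qed

lemma sem_shift:
  assumes "ready s" and inv: "shift_inv_of W s" and s: "nats s ''par'' = par" "nats s ''K'' 0 = K" and "K \<le> n"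
  shows "shift_inv_of W (sem shift s)"
    and "i < K \<Longrightarrow> par i \<noteq> 0 \<Longrightarrow> nats (sem shift s) ''T'' i = nats (sem shift s) ''X'' i"
proof -
  let ?I = "\<lambda>k s1. shift_inv_of W s1 \<and> (\<forall>i<k. i < K \<longrightarrow> par i \<noteq> 0 \<longrightarrow> nats s1 ''T'' i = nats s1 ''X'' i)"
  have "?I n (sem shift s)"
    unfolding shift_def
  proof (rule loop_induct[where I = ?I, OF assms(1)], goal_cases)
    case (4 k s1)
    have s1: "nats s1 ''par'' = par" "nats s1 ''K'' 0 = K"
      using 4(5)[of "''par''"] 4(5)[of "''K''"] s by (simp_all add: shift_node_def shift_vertex_def)
    show ?case
    proof (cases "k < K \<and> par k \<noteq> 0")
      case False
      then have "sem shift_node s1 = s1" using 4(3) s1 by (auto simp: shift_node_def)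
      then show ?thesis using 4(2) False by (auto simp: less_Suc_eq)
    next
      case True
      note node = sem_shift_node[OF 4(4) conjunct1[OF 4(2)] _ _ 4(3) s1]
      show ?thesis using node True 4(2) by (simp add: less_Suc_eq)
    qed
  qed (use inv in \<open>simp_all add: shift_node_def shift_vertex_def\<close>)
  then show "shift_inv_of W (sem shift s)"
    and "i < K \<Longrightarrow> par i \<noteq> 0 \<Longrightarrow> nats (sem shift s) ''T'' i = nats (sem shift s) ''X'' i"
    using \<open>K \<le> n\<close> by simp_all
qed

end

context radius_instance
begin

abbreviation star_inv_of :: "nat \<Rightarrow> nat \<Rightarrow> nat \<Rightarrow> nat \<Rightarrow> state \<Rightarrow> bool" where
  "star_inv_of K N k k' s \<equiv> star_inv K (nats s ''home'') N k k' (nats s ''t'' 0) (nats s ''A'') (nats s ''x'')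
     (nats s ''g'') (nats s ''y'') (nats s ''S'') (nats s ''O'') (nats s ''f'')"

lemma sem_open_star:
  assumes "ready s" and inv: "star_inv_of K N k k s" and s: "nats s ''v'' 0 = k" "nats s ''m'' 0 = i"
    and k: "k < n" "nats s ''home'' k = Suc i" "i < K" and gA: "nats s ''g'' i = 0" "0 < nats s ''A'' i"
  shows "star_inv_of K N k (Suc k) (sem open_star s)" and "0 < nats (sem open_star s) ''g'' i"
proof -
  \<comment> \<open>In the branch where \<open>x\<close> is at least \<open>U - l\<close> the
    program writes \<open>U\<close>, which equals \<open>l + ?w\<close> because
    \<open>l \<le> U\<close>.\<close>
  let ?w = "min (nats s ''x'' i) (U - l)"
  have e: "nats (sem open_star s) ''A'' = (nats s ''A'')(i := nats s ''A'' i - l)"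
    "nats (sem open_star s) ''x'' = (nats s ''x'')(i := nats s ''x'' i - ?w)"
    "nats (sem open_star s) ''g'' = (nats s ''g'')(i := l + ?w)"
    "nats (sem open_star s) ''y'' = (nats s ''y'')(i := k)"
    "nats (sem open_star s) ''O'' = (nats s ''O'')(k := 1)"
    using assms(1) s l_le by (cases "nats s ''x'' i < U - l"; simp add: open_star_def readyD)+
  have e': "nats (sem open_star s) a = nats s a" if "a \<in> {''home'', ''t'', ''S'', ''f''}" for a
    by (rule nats_sem) (use that in \<open>auto simp: open_star_def\<close>)
  show "star_inv_of K N k (Suc k) (sem open_star s)"
    unfolding e using star_open[OF inv k gA refl] by (simp add: e')
  show "0 < nats (sem open_star s) ''g'' i" using l_pos by (simp add: e)
qed

lemma sem_serve:
  assumes inv: "star_inv_of K N k (Suc k) s" and s: "nats s ''v'' 0 = k" "nats s ''m'' 0 = i"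
    and k: "k < n" "nats s ''home'' k = Suc i" "i < K" and g: "0 < nats s ''g'' i"
  shows "star_inv_of K N (Suc k) (Suc k) (sem serve s)"
proof -
  have e: "nats (sem serve s) ''S'' = (nats s ''S'')(k := 1)"
    "nats (sem serve s) ''f'' = (nats s ''f'')(k := nats s ''y'' i)"
    "nats (sem serve s) ''g'' = (nats s ''g'')(i := nats s ''g'' i - 1)"
    "nats (sem serve s) ''t'' 0 = Suc (nats s ''t'' 0)"
    using s by (simp_all add: serve_def)
  have e': "nats (sem serve s) a = nats s a" if "a \<in> {''home'', ''A'', ''x'', ''y'', ''O''}" for a
    by (rule nats_sem) (use that in \<open>auto simp: serve_def\<close>)
  show ?thesis
    unfolding e using star_serve[OF inv k g] by (simp add: e')
qed

lemma star_inv_Suc: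
  "star_inv K hm N k k' t A x g y S Op f \<Longrightarrow> star_inv K hm N k (Suc k') t A x g y S Op f"
  unfolding star_inv_def by (simp add: less_SucI)

lemma sem_star_vertex:
  assumes "ready s" and inv: "star_inv_of K N k k s" and s: "nats s ''v'' 0 = k" and k: "k < n"
    and hK: "\<And>i. nats s ''home'' k = Suc i \<Longrightarrow> i < K"
  shows "star_inv_of K N (Suc k) (Suc k) (sem star_vertex s)"
proof (cases "nats s ''home'' k")
  case 0
  then have "sem star_vertex s = s" using s by (simp add: star_vertex_def)
  then show ?thesis using star_skip[OF inv k] 0 by simp
next
  case (Suc i)
  have iK: "i < K" using hK[OF Suc] .
  define s1 where "s1 = set_nat ''m'' 0 i s"
  have inv1: "star_inv_of K N k k s1" using inv by (simp add: s1_def)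
  have s1: "ready s1" "nats s1 ''v'' 0 = k" "nats s1 ''m'' 0 = i" "nats s1 ''home'' k = Suc i"
    using assms(1) s Suc by (simp_all add: s1_def)
  define s2 where "s2 = sem (PIf (Conj (Neg (Pos (NGet ''g'' (scal ''m'')))) (Pos (NGet ''A'' (scal ''m'')))) open_star PSkip) s1"
  have eq: "sem star_vertex s = sem (PIf (Pos (NGet ''g'' (scal ''m''))) serve PSkip) s2"
    using s Suc by (simp add: star_vertex_def s1_def s2_def del: sem.simps(5)) (simp add: s1_def)
  have fr: "nats s2 a = nats s1 a" if "a \<in> {''v'', ''m'', ''home''}" for a
    unfolding s2_def by (rule nats_sem) (use that in \<open>auto simp: open_star_def\<close>)
  have s2: "nats s2 ''v'' 0 = k" "nats s2 ''m'' 0 = i" "nats s2 ''home'' k = Suc i"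
    using s1 by (simp_all add: fr)
  show ?thesis
  proof (cases "nats s1 ''g'' i = 0 \<and> 0 < nats s1 ''A'' i")
    case True
    then have "s2 = sem open_star s1" using s1 by (simp add: s2_def)
    then have "star_inv_of K N k (Suc k) s2" "0 < nats s2 ''g'' i"
      using sem_open_star[OF s1(1) inv1 s1(2,3) k s1(4) iK] True by simp_all
    from sem_serve[OF this(1) s2(1,2) k s2(3) iK this(2)] this(2) show ?thesis
      using s2 by (simp add: eq)
  next
    case False
    then have e: "s2 = s1" using s1 by (auto simp: s2_def)
    show ?thesis
    proof (cases "nats s1 ''g'' i = 0")
      case True
      then have "sem star_vertex s = s1" using s1 by (simp add: eq e)
      then show ?thesis
        using star_skip[OF inv1 k] True False s1(4) by simp
    next
      case g: False
      from sem_serve[OF star_inv_Suc[OF inv1] s1(2,3) k s1(4) iK] g show ?thesis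
        using s1 by (simp add: eq e)
    qed
  qed
qed

lemma sem_stars:
  assumes "ready s" and z: "\<And>i. i < n \<Longrightarrow> nats s ''g'' i = 0 \<and> nats s ''S'' i = 0 \<and> nats s ''O'' i = 0"
    and K: "K \<le> n" and hK: "\<And>v i. v < n \<Longrightarrow> nats s ''home'' v = Suc i \<Longrightarrow> i < K"
    and pool: "\<And>i. i < K \<Longrightarrow> nats s ''A'' i + nats s ''x'' i \<le> card {v. v < n \<and> nats s ''home'' v = Suc i}"
    and A: "\<And>i. i < K \<Longrightarrow> \<exists>a. nats s ''A'' i = a * l \<and> nats s ''x'' i \<le> a * (U - l)"
  shows "star_inv_of K (\<Sum>i<K. nats s ''A'' i + nats s ''x'' i) n n (sem stars s)"
proof -
  let ?N = "\<Sum>i<K. nats s ''A'' i + nats s ''x'' i"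
  have "star_inv_of K ?N n n (sem (PFor ''v'' star_vertex) (sem (PN ''t'' Zero Zero) s))"
  proof (rule loop_induct[where I = "\<lambda>k s. star_inv_of K ?N k k s"], goal_cases)
    case 4
    have g: "nats s ''g'' i = 0" if "i < K" for i using z[of i] K that by simp
    have e: "{v. v < n \<and> nats s ''S'' v \<noteq> 0} = {}" using z by auto
    show ?case
      by (rule star_invI) (use z g e pool A in \<open>auto simp: z\<close>)
  next
    case (5 k s')
    have h: "nats s' ''home'' = nats s ''home''"
      by (subst 5(5); simp add: star_vertex_def open_star_def serve_def)
    have "star_inv_of K ?N (Suc k) (Suc k) (sem star_vertex s')"
      by (rule sem_star_vertex[OF 5(4,2,3,1)]) (use hK 5(1) h in simp)
    then show ?case by simp
  qed (use assms(1) in \<open>simp_all add: star_vertex_def open_star_def serve_def\<close>)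
  then show ?thesis by (simp add: stars_def)
qed

end

section \<open>The algorithm\<close>

definition run :: prog where
  "run = clear [''D'', ''cov'', ''near'', ''home'', ''ball'', ''T'', ''A'', ''G'', ''g'', ''S'', ''O''] ;;
     density ;; cluster ;; quota ;; shift ;; stars"

definition copy :: prog where
  "copy = PFor ''v'' (PN ''C'' (scal ''v'') (NGet ''S'' (scal ''v'')) ;;
     PN ''F'' (scal ''v'') (NGet ''O'' (scal ''v'')) ;;
     PN ''phi'' (scal ''v'') (NGet ''f'' (scal ''v'')))"

text \<open>\<open>z\<close> tells whether a solution is stored and \<open>B\<close> is the radius
  it was found at. Success is not claimed to be monotone in the radius, so all pairs are tried and
  the smallest successful radius is kept.\<close>

definition try_radius :: prog where
  "try_radius = PR ''r'' Zero (RGet ''d'' (NPlus (NGet ''row'' (scal ''a'')) (scal ''b''))) ;; run ;;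
     PIf (Conj (Neg (NLess (scal ''t'') (scal ''p'')))
          (Neg (Conj (Pos (scal ''z'')) (Neg (RLess (scalR ''r'') (scalR ''B''))))))
       (PN ''z'' Zero One ;; PR ''B'' Zero (scalR ''r'') ;; copy) PSkip"

definition init :: prog where
  "init = PIf (Pos (scal ''L'')) (PN ''l'' Zero (scal ''L'')) (PN ''l'' Zero One) ;;
     PN ''row'' Zero Zero ;;
     PFor ''u'' (PN ''row'' (NPlus (scal ''u'') One) (NPlus (NGet ''row'' (scal ''u'')) (scal ''n'')))"

text \<open>For \<open>p = 0\<close> the zero-initialised output arrays already are the empty
  solution. The clustering itself relies on a nonempty solution, which is what gives
  \<open>l \<le> U\<close> after a lower bound 0 is raised to 1.\<close>

definition algorithm :: prog where
  "algorithm = PIf (Pos (scal ''p'')) (init ;; PFor ''a'' (PFor ''b'' try_radius)) PSkip"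

lemmas cluster_defs = density_def density_row_def cluster_def select_def add_center_def mark_def mark_vertex_def
lemmas star_defs = shift_def shift_node_def shift_vertex_def stars_def star_vertex_def open_star_def serve_def

lemma notin_writes_run:
  assumes a: "a \<in> {''a'', ''b'', ''n'', ''l'', ''U'', ''p'', ''row'', ''z'', ''C'', ''F'', ''phi''}"
  shows "a \<notin> writes run"
proof -
  have "a \<notin> writes (clear [''D'', ''cov'', ''near'', ''home'', ''ball'', ''T'', ''A'', ''G'', ''g'', ''S'', ''O''])"
    using a by (elim insertE emptyE; simp)
  moreover have "a \<notin> writes density" "a \<notin> writes cluster"
    using a by (elim insertE emptyE; simp add: cluster_defs)+
  moreover have "a \<notin> writes count" "a \<notin> writes ascend" "a \<notin> writes distribute" "a \<notin> writes accumulate"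
    using a by (elim insertE emptyE; simp add: quota_defs)+
  moreover have "a \<notin> writes shift" "a \<notin> writes stars"
    using a by (elim insertE emptyE; simp add: star_defs)+
  ultimately show ?thesis by (simp only: run_def quota_def writes.simps(4) Un_iff simp_thms)
qed

lemma writesR_run: "writesR run = {}"
  by (simp add: run_def quota_def quota_defs cluster_defs star_defs)

lemma well_formed_algorithm: "well_formed algorithm"
  by (simp add: algorithm_def init_def try_radius_def copy_def run_def quota_def quota_defs cluster_defs star_defs)

context radius_instance
begin

text \<open>The last claim is the comparison with an arbitrary assignment of radius at most
  \<open>r\<close>: the run serves at least as many vertices, so a correct guess of the radius
  always reaches \<open>p\<close>.\<close>

lemma sem_run:
  assumes r0: "ready s"
  defines "s' \<equiv> sem run s"
  shows "v < n \<Longrightarrow> nats s' ''S'' v \<noteq> 0 \<Longrightarrow>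
      nats s' ''f'' v < n \<and> nats s' ''O'' (nats s' ''f'' v) \<noteq> 0 \<and> d v (nats s' ''f'' v) \<le> 10 * r"
    and "u < n \<Longrightarrow> nats s' ''O'' u \<noteq> 0 \<Longrightarrow>
      l \<le> card {v. v < n \<and> nats s' ''S'' v \<noteq> 0 \<and> nats s' ''f'' v = u} \<and>
      card {v. v < n \<and> nats s' ''S'' v \<noteq> 0 \<and> nats s' ''f'' v = u} \<le> U"
    and "nats s' ''t'' 0 = card {v. v < n \<and> nats s' ''S'' v \<noteq> 0}"
    and "C \<subseteq> {..<n} \<Longrightarrow> (\<And>v. v \<in> C \<Longrightarrow> \<phi> v < n \<and> d v (\<phi> v) \<le> r) \<Longrightarrow>
      (\<And>u. u \<in> \<phi> ` C \<Longrightarrow> l \<le> card {v\<in>C. \<phi> v = u} \<and> card {v\<in>C. \<phi> v = u} \<le> U) \<Longrightarrow>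
      card C \<le> nats s' ''t'' 0"
proof -
  let ?as = "[''D'', ''cov'', ''near'', ''home'', ''ball'', ''T'', ''A'', ''G'', ''g'', ''S'', ''O'']"
  define s1 where "s1 = sem (clear ?as) s"
  define s2 where "s2 = sem density s1"
  define s3 where "s3 = sem cluster s2"
  define s4 where "s4 = sem quota s3"
  define s5 where "s5 = sem shift s4"
  have s': "s' = sem stars s5"
    by (simp add: s'_def run_def s1_def s2_def s3_def s4_def s5_def del: clear.simps)
  have r1: "ready s1" unfolding s1_def using r0 by (subst ready_clear) auto
  have r2: "ready s2" unfolding s2_def using r1 by (subst ready_sem) (simp_all add: cluster_defs)
  have r3: "ready s3" unfolding s3_def using r2 by (subst ready_sem) (simp_all add: cluster_defs)
  have r4: "ready s4" unfolding s4_def using r3 by (subst ready_sem) (simp_all add: quota_def quota_defs)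
  have r5: "ready s5" unfolding s5_def using r4 by (subst ready_sem) (simp_all add: star_defs)
  have z1: "nats s1 a v = 0" if "a \<in> set ?as" "v < n" for a v
    unfolding s1_def by (rule sem_clear[OF r0 _ that]) simp
  have D: "dense_known s2"
    unfolding s2_def dense_known_def by (rule sem_density[OF r1]) (use z1[of "''D''"] in simp)
  have f2: "nats s2 a = nats s1 a" if "a \<in> set (tl ?as)" for a
    unfolding s2_def by (rule nats_sem) (use that in \<open>auto simp: cluster_defs\<close>)
  have cl3: "clustered_of s3" and K3: "nats s3 ''K'' 0 \<le> n"
    unfolding s3_def by (rule sem_cluster[OF r2 D]; simp add: f2 z1)+
  have f3: "nats s3 a = nats s2 a" if "a \<in> {''T'', ''A'', ''G'', ''g'', ''S'', ''O''}" for a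
    unfolding s3_def by (rule nats_sem) (use that in \<open>auto simp: cluster_defs\<close>)
  have q4: "quotas_of s4"
    unfolding s4_def by (rule sem_quota[OF r3 cl3 K3]) (simp add: f3 f2 z1)
  have f4: "nats s4 a = nats s3 a" if "a \<in> {''K'', ''g'', ''S'', ''O''}" for a
    unfolding s4_def by (rule nats_sem) (use that in \<open>auto simp: quota_def quota_defs\<close>)
  let ?K = "nats s4 ''K'' 0" and ?A = "nats s4 ''A''" and ?x = "nats s4 ''x''" and ?ctr = "nats s4 ''ctr''"
  interpret quotas n l U d r ?K ?ctr "nats s4 ''par''" "nats s4 ''cov''" "nats s4 ''near''"
    "nats s4 ''home''" "nats s4 ''ball''" "nats s4 ''T''" ?A "nats s4 ''G''" ?x "nats s4 ''X''"
    by (rule q4)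
  have K: "?K \<le> n" using K3 by (simp add: f4)
  let ?W = "pool_balance (nats s4 ''T'') (nats s4 ''X'') (nats s4 ''home'')"
  note sh = sem_shift[OF r4 shift_inv_start refl refl K, folded s5_def]
  have f5: "nats s5 a = nats s4 a" if "a \<in> {''A'', ''x'', ''g'', ''S'', ''O''}" for a
    unfolding s5_def by (rule nats_sem) (use that in \<open>auto simp: star_defs\<close>)
  let ?h = "nats s5 ''home''"
  have pool: "?A i + ?x i \<le> card {v. v < n \<and> ?h v = Suc i}" if "i < ?K" for i
  proof -
    have "int (card {v. v < n \<and> ?h v = Suc i}) = ?W i"
      by (rule shift_final[OF sh(1) sh(2) that])
    then show ?thesis using pool_balance_ge[OF that] by linarith
  qed
  have h5: "i < ?K \<and> d (?ctr i) v \<le> 5 * r" if "v < n" "?h v = Suc i" for v i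
    using sh(1) that unfolding shift_inv_def by simp
  have A: "\<exists>a. ?A i = a * l \<and> ?x i \<le> a * (U - l)" if "i < ?K" for i
    using AG[OF that] x_le[OF that] by auto
  have st: "star_inv_of ?K (\<Sum>i<?K. ?A i + ?x i) n n s'"
    unfolding s' using sem_stars[OF r5, of ?K] h5 pool A K by (simp add: f5 f4 f3 f2 z1)
  have h': "nats s' ''home'' = ?h" unfolding s' by (rule nats_sem) (simp add: star_defs)
  \<comment> \<open>Unfilled places never outnumber the vertices still to be scanned, and none are
    left at \<open>n\<close>. Hence all planned stars are opened and all their places
    filled.\<close>
  have zero: "nats s' ''A'' i + nats s' ''g'' i + nats s' ''x'' i = 0" if "i < ?K" for i
  proof -
    have "{v. v < n \<and> n \<le> v \<and> nats s' ''home'' v = Suc i} = {}" by auto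
    then show ?thesis using star_invD(1)[OF st that] by (metis card.empty le_zero_eq)
  qed
  show "nats s' ''f'' v < n \<and> nats s' ''O'' (nats s' ''f'' v) \<noteq> 0 \<and> d v (nats s' ''f'' v) \<le> 10 * r"
    if v: "v < n" "nats s' ''S'' v \<noteq> 0"
  proof -
    let ?u = "nats s' ''f'' v"
    have u: "?u < n" "nats s' ''O'' ?u \<noteq> 0" "?h ?u = ?h v" "?h v \<noteq> 0"
      using star_invD(5)[OF st v] h' by auto
    then obtain i where i: "?h v = Suc i" by (cases "?h v") auto
    have "i < ?K" "d (?ctr i) v \<le> 5 * r" "d (?ctr i) ?u \<le> 5 * r"
      using h5[OF v(1) i] h5[OF u(1)] i u by auto
    moreover have "?ctr i < n" using ctr_less \<open>i < ?K\<close> by blast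
    \<comment> \<open>A vertex and its center lie in the same pool, so the path through the pick of
      that pool costs at most 5r + 5r.\<close>
    ultimately have "d v ?u \<le> 10 * r"
      using tri[of v "?ctr i" ?u] sym[of v "?ctr i"] v(1) u(1) by simp
    then show ?thesis using u by simp
  qed
  show "l \<le> card {v. v < n \<and> nats s' ''S'' v \<noteq> 0 \<and> nats s' ''f'' v = u} \<and>
      card {v. v < n \<and> nats s' ''S'' v \<noteq> 0 \<and> nats s' ''f'' v = u} \<le> U"
    if u: "u < n" "nats s' ''O'' u \<noteq> 0"
  proof -
    have "nats s' ''home'' u \<noteq> 0" using star_invD(6)[OF st u] by simp
    then obtain i where i: "nats s' ''home'' u = Suc i" by (cases "nats s' ''home'' u") auto
    then have "i < ?K" using h5[OF u(1)] h' by simp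
    then have "nats s' ''g'' i = 0" using zero by simp
    then show ?thesis using star_invD(7)[OF st u i] by simp
  qed
  show "nats s' ''t'' 0 = card {v. v < n \<and> nats s' ''S'' v \<noteq> 0}"
    by (rule star_invD(4)[OF st])
  have t: "nats s' ''t'' 0 = (\<Sum>i<?K. ?A i + ?x i)"
    using star_invD(3)[OF st] zero by simp
  show "card C \<le> nats s' ''t'' 0"
    if "C \<subseteq> {..<n}" "\<And>v. v \<in> C \<Longrightarrow> \<phi> v < n \<and> d v (\<phi> v) \<le> r"
      "\<And>u. u \<in> \<phi> ` C \<Longrightarrow> l \<le> card {v\<in>C. \<phi> v = u} \<and> card {v\<in>C. \<phi> v = u} \<le> U"
    unfolding t by (rule served_bound[OF that])
qed

end

section \<open>Search over the guessed radius\<close>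

locale center_input =
  fixes n L U p :: nat and d :: "nat \<Rightarrow> nat \<Rightarrow> real"
  assumes inst: "center_instance {..<n} d L U" and p_pos: "0 < p"
    and feas: "\<exists>C F \<phi>. feasible {..<n} L U p C F \<phi>"
begin

text \<open>Centers that serve nobody can be closed, so the fibres that matter have at least one
  element even if \<open>L = 0\<close>.\<close>

definition l :: nat where "l = (if 0 < L then L else 1)"

lemma feasible_fibre:
  assumes "feasible {..<n} L U p C F \<phi>" "u \<in> \<phi> ` C"
  shows "l \<le> card {v\<in>C. \<phi> v = u} \<and> card {v\<in>C. \<phi> v = u} \<le> U"
proof -
  have fin: "finite C" using assms(1) finite_subset unfolding feasible_def by blast
  have "u \<in> F" using assms unfolding feasible_def by blast
  then have "L \<le> card {v\<in>C. \<phi> v = u} \<and> card {v\<in>C. \<phi> v = u} \<le> U"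
    using assms(1) unfolding feasible_def by blast
  moreover have "{v\<in>C. \<phi> v = u} \<noteq> {}" using assms(2) by auto
  then have "0 < card {v\<in>C. \<phi> v = u}" using fin by (simp add: card_gt_0_iff)
  ultimately show ?thesis by (auto simp: l_def)
qed

lemma feasible_nonempty:
  "feasible {..<n} L U p C F \<phi> \<Longrightarrow> C \<noteq> {}"
  using p_pos by (auto simp: feasible_def)

lemma l_le_U: "l \<le> U"
proof -
  obtain C F \<phi> where f: "feasible {..<n} L U p C F \<phi>" using feas by blast
  then obtain v where "v \<in> C" using feasible_nonempty by blast
  then show ?thesis using feasible_fibre[OF f, of "\<phi> v"] by fastforce
qed

lemma radius: "0 \<le> r \<Longrightarrow> radius_instance n l U d r"
  using inst l_le_U by unfold_locales (auto simp: center_instance_def l_def)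

definition base :: "state \<Rightarrow> bool" where
  "base s \<longleftrightarrow> nats s ''n'' 0 = n \<and> nats s ''l'' 0 = l \<and> nats s ''U'' 0 = U \<and> nats s ''p'' 0 = p \<and>
     (\<forall>i<n. nats s ''row'' i = i * n) \<and> (\<forall>u<n. \<forall>v<n. reals s ''d'' (u * n + v) = d u v)"

lemma base_cong:
  assumes "\<And>a. a \<in> {''n'', ''l'', ''U'', ''p'', ''row''} \<Longrightarrow> nats s' a = nats s a"
    and "reals s' ''d'' = reals s ''d''"
  shows "base s' \<longleftrightarrow> base s"
  using assms by (simp add: base_def)

lemma ready_base:
  "base s \<Longrightarrow> reals s ''r'' 0 = r \<Longrightarrow> 0 \<le> r \<Longrightarrow> radius_instance.ready n l U d r s"
  using radius_instance.ready_def[OF radius] by (simp add: base_def)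

definition solution :: "real \<Rightarrow> (nat \<Rightarrow> nat) \<Rightarrow> (nat \<Rightarrow> nat) \<Rightarrow> (nat \<Rightarrow> nat) \<Rightarrow> bool" where
  "solution \<rho> S Op f \<longleftrightarrow> p \<le> card {v. v < n \<and> S v \<noteq> 0} \<and>
     (\<forall>v<n. S v \<noteq> 0 \<longrightarrow> f v < n \<and> Op (f v) \<noteq> 0 \<and> d v (f v) \<le> \<rho>) \<and>
     (\<forall>u<n. Op u \<noteq> 0 \<longrightarrow> L \<le> card {v. v < n \<and> S v \<noteq> 0 \<and> f v = u} \<and>
        card {v. v < n \<and> S v \<noteq> 0 \<and> f v = u} \<le> U)"

lemma solution_cong:
  assumes "\<And>v. v < n \<Longrightarrow> S' v = S v \<and> Op' v = Op v \<and> f' v = f v"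
  shows "solution \<rho> S' Op' f' \<longleftrightarrow> solution \<rho> S Op f"
proof -
  have "{v. v < n \<and> S' v \<noteq> 0} = {v. v < n \<and> S v \<noteq> 0}" using assms by auto
  moreover have "{v. v < n \<and> S' v \<noteq> 0 \<and> f' v = u} = {v. v < n \<and> S v \<noteq> 0 \<and> f v = u}" for u
    using assms by auto
  ultimately show ?thesis using assms by (auto simp: solution_def)
qed

definition solvable :: "real \<Rightarrow> bool" where
  "solvable r \<longleftrightarrow> (\<exists>C F \<phi>. feasible {..<n} L U p C F \<phi> \<and> (\<forall>v\<in>C. d v (\<phi> v) \<le> r))"

text \<open>\<open>Q\<close> is the set of pairs tried so far. The optimum is itself one of the
  distances, so once all pairs are in \<open>Q\<close> the last clause bounds the stored radius by
  the optimum.\<close>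

definition progress :: "(nat \<times> nat) set \<Rightarrow> state \<Rightarrow> bool" where
  "progress Q s \<longleftrightarrow> base s \<and>
     (nats s ''z'' 0 \<noteq> 0 \<longrightarrow> solution (10 * reals s ''B'' 0) (nats s ''C'') (nats s ''F'') (nats s ''phi'')) \<and>
     (\<forall>(a, b)\<in>Q. solvable (d a b) \<longrightarrow> nats s ''z'' 0 \<noteq> 0 \<and> reals s ''B'' 0 \<le> d a b)"

lemma sem_run_solution:
  assumes "base s" "reals s ''r'' 0 = r" "0 \<le> r"
  shows "p \<le> nats (sem run s) ''t'' 0 \<Longrightarrow>
      solution (10 * r) (nats (sem run s) ''S'') (nats (sem run s) ''O'') (nats (sem run s) ''f'')"
    and "solvable r \<Longrightarrow> p \<le> nats (sem run s) ''t'' 0"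
proof -
  interpret radius_instance n l U d r by (rule radius[OF assms(3)])
  note run = sem_run[OF ready_base[OF assms]]
  have "L \<le> l" by (simp add: l_def)
  show "solution (10 * r) (nats (sem run s) ''S'') (nats (sem run s) ''O'') (nats (sem run s) ''f'')"
    if "p \<le> nats (sem run s) ''t'' 0"
    unfolding solution_def
  proof (intro conjI allI impI)
    show "p \<le> card {v. v < n \<and> nats (sem run s) ''S'' v \<noteq> 0}" using that run(3) by simp
    fix v assume v: "v < n" "nats (sem run s) ''S'' v \<noteq> 0"
    show "nats (sem run s) ''f'' v < n" "nats (sem run s) ''O'' (nats (sem run s) ''f'' v) \<noteq> 0"
      "d v (nats (sem run s) ''f'' v) \<le> 10 * r" using run(1)[OF v] by simp_all
  next
    fix u assume u: "u < n" "nats (sem run s) ''O'' u \<noteq> 0"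
    show "L \<le> card {v. v < n \<and> nats (sem run s) ''S'' v \<noteq> 0 \<and> nats (sem run s) ''f'' v = u}"
      "card {v. v < n \<and> nats (sem run s) ''S'' v \<noteq> 0 \<and> nats (sem run s) ''f'' v = u} \<le> U"
      using run(2)[OF u] \<open>L \<le> l\<close> by simp_all
  qed
  assume "solvable r"
  then obtain C F \<phi> where f: "feasible {..<n} L U p C F \<phi>" and r: "\<And>v. v \<in> C \<Longrightarrow> d v (\<phi> v) \<le> r"
    unfolding solvable_def by blast
  have "card C \<le> nats (sem run s) ''t'' 0"
  proof (rule run(4))
    show "C \<subseteq> {..<n}" using f by (simp add: feasible_def)
    show "\<phi> v < n \<and> d v (\<phi> v) \<le> r" if "v \<in> C" for v
      using f r[OF that] that unfolding feasible_def by blast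
    show "l \<le> card {v\<in>C. \<phi> v = u} \<and> card {v\<in>C. \<phi> v = u} \<le> U" if "u \<in> \<phi> ` C" for u
      by (rule feasible_fibre[OF f that])
  qed
  then show "p \<le> nats (sem run s) ''t'' 0" using f by (simp add: feasible_def)
qed

lemma sem_copy:
  assumes "nats s ''n'' 0 = n" "v < n"
  shows "nats (sem copy s) ''C'' v = nats s ''S'' v" "nats (sem copy s) ''F'' v = nats s ''O'' v"
    "nats (sem copy s) ''phi'' v = nats s ''f'' v"
proof -
  have "\<forall>v<n. nats (sem copy s) ''C'' v = nats s ''S'' v \<and> nats (sem copy s) ''F'' v = nats s ''O'' v \<and>
      nats (sem copy s) ''phi'' v = nats s ''f'' v"
    unfolding copy_def
  proof (rule sem_PFor_induct[where N = n and I = "\<lambda>k s'. \<forall>v<k. nats s' ''C'' v = nats s ''S'' v \<and>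
      nats s' ''F'' v = nats s ''O'' v \<and> nats s' ''phi'' v = nats s ''f'' v"], goal_cases)
    case (1 k s')
    have "nats s' ''S'' = nats s ''S''" "nats s' ''O'' = nats s ''O''" "nats s' ''f'' = nats s ''f''"
      by (subst 1(4); simp)+
    then show ?case using 1(2,3) by (simp add: less_Suc_eq)
  qed (use assms in simp_all)
  then show "nats (sem copy s) ''C'' v = nats s ''S'' v" "nats (sem copy s) ''F'' v = nats s ''O'' v"
    "nats (sem copy s) ''phi'' v = nats s ''f'' v"
    using assms by simp_all
qed

lemma writes_try: "writes try_radius = writes run \<union> {''z'', ''v'', ''C'', ''F'', ''phi''}"
  "writesR try_radius = {''r'', ''B''}"
  by (auto simp: try_radius_def copy_def writesR_run)

lemma notin_writes_try:
  assumes a: "a \<in> {''a'', ''n'', ''l'', ''U'', ''p'', ''row''}"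
  shows "a \<notin> writes try_radius"
proof -
  have "a \<notin> writes run"
    by (rule notin_writes_run) (use a in \<open>elim insertE emptyE; simp\<close>)
  moreover have "a \<notin> {''z'', ''v'', ''C'', ''F'', ''phi''}"
    using a by (elim insertE emptyE; simp)
  ultimately show ?thesis by (simp only: writes_try Un_iff simp_thms)
qed

lemma base_try: "base (sem try_radius s) \<longleftrightarrow> base s"
proof (rule base_cong)
  fix a assume a: "a \<in> {''n'', ''l'', ''U'', ''p'', ''row''}"
  show "nats (sem try_radius s) a = nats s a"
    by (rule nats_sem, rule notin_writes_try) (use a in \<open>elim insertE emptyE; simp\<close>)
qed (simp add: reals_sem writes_try)

lemma sem_try_radius:
  assumes pr: "progress Q s" and ab: "nats s ''a'' 0 = a" "nats s ''b'' 0 = b" "a < n" "b < n"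
  shows "progress (insert (a, b) Q) (sem try_radius s)"
proof -
  let ?r = "d a b"
  have b0: "base s" using pr by (simp add: progress_def)
  have r0: "0 \<le> ?r" using inst ab by (simp add: center_instance_def)
  define s1 where "s1 = set_real ''r'' 0 ?r s"
  define s2 where "s2 = sem run s1"
  have b1: "base s1" using b0 by (simp add: s1_def base_def)
  have r1: "reals s1 ''r'' 0 = ?r" by (simp add: s1_def)
  note run = sem_run_solution[OF b1 r1 r0, folded s2_def]
  have fr: "nats s2 a = nats s a" if "a \<in> {''z'', ''p'', ''n'', ''C'', ''F'', ''phi''}" for a
  proof -
    have "nats s2 a = nats s1 a" 
      unfolding s2_def by (rule nats_sem, rule notin_writes_run) (use that in \<open>elim insertE emptyE; simp\<close>)
    then show ?thesis by (simp add: s1_def)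
  qed
  have frR: "reals s2 ''r'' 0 = ?r" "reals s2 ''B'' 0 = reals s ''B'' 0"
    unfolding s2_def by (simp_all add: reals_sem writesR_run s1_def)
  have p: "nats s2 ''p'' 0 = p" and n2: "nats s2 ''n'' 0 = n" using b0 fr by (simp_all add: base_def)
  let ?upd = "p \<le> nats s2 ''t'' 0 \<and> (nats s ''z'' 0 = 0 \<or> ?r < reals s ''B'' 0)"
  let ?R = "RGet ''d'' (NPlus (NGet ''row'' (scal ''a'')) (scal ''b''))"
    and ?cond = "Conj (Neg (NLess (scal ''t'') (scal ''p'')))
          (Neg (Conj (Pos (scal ''z'')) (Neg (RLess (scalR ''r'') (scalR ''B'')))))"
    and ?save = "PN ''z'' Zero One ;; PR ''B'' Zero (scalR ''r'') ;; copy"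
  have "rval ?R s = ?r"
    using b0 ab by (simp add: base_def)
  then have e1: "sem (PR ''r'' Zero ?R) s = s1" by (simp only: sem.simps(3) s1_def nval.simps)
  have "sem try_radius s = sem (PIf ?cond ?save PSkip) s2"
    unfolding try_radius_def sem.simps(4) e1 s2_def ..
  moreover have "bval ?cond s2 \<longleftrightarrow> ?upd"
    using p frR fr[of "''z''"] by (auto simp: not_less)
  moreover have "sem ?save s2 = sem copy (set_real ''B'' 0 ?r (set_nat ''z'' 0 1 s2))"
    using frR by simp
  ultimately have eq: "sem try_radius s =
      (if ?upd then sem copy (set_real ''B'' 0 ?r (set_nat ''z'' 0 1 s2)) else s2)"
    by (simp only: sem.simps(1,5))
  have base': "base (sem try_radius s)" using b0 by (simp add: base_try)
  show ?thesis
  proof (cases ?upd)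
    case True
    define s3 where "s3 = set_real ''B'' 0 ?r (set_nat ''z'' 0 1 s2)"
    have e: "sem try_radius s = sem copy s3" unfolding eq s3_def using True by (rule if_P)
    have z: "nats (sem copy s3) ''z'' 0 = 1" "reals (sem copy s3) ''B'' 0 = ?r"
      by (simp_all add: nats_sem reals_sem copy_def s3_def)
    have "solution (10 * ?r) (nats s3 ''S'') (nats s3 ''O'') (nats s3 ''f'')"
      using run(1) True by (simp add: s3_def)
    moreover have "nats s3 ''n'' 0 = n" using n2 by (simp add: s3_def)
    ultimately have "solution (10 * ?r) (nats (sem copy s3) ''C'') (nats (sem copy s3) ''F'') (nats (sem copy s3) ''phi'')"
      using sem_copy[of s3] by (subst solution_cong) auto
    moreover have "?r \<le> d a' b'" if "(a', b') \<in> Q" "solvable (d a' b')" for a' b'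
      using pr that True unfolding progress_def by fastforce
    ultimately show ?thesis
      using base' z unfolding e progress_def by auto
  next
    case False
    have e: "sem try_radius s = s2" unfolding eq using False by (rule if_not_P)
    have "nats s ''z'' 0 \<noteq> 0 \<and> reals s ''B'' 0 \<le> ?r" if "solvable ?r"
      using run(2)[OF that] False by auto
    then show ?thesis
      using base' pr unfolding e progress_def by (auto simp: fr frR)
  qed
qed

lemma sem_search:
  assumes "progress {} s"
  shows "progress ({..<n} \<times> {..<n}) (sem (PFor ''a'' (PFor ''b'' try_radius)) s)"
proof (rule sem_PFor_induct[where N = n and I = "\<lambda>k. progress ({..<k} \<times> {..<n})"], goal_cases)
  case (1 k s1)
  have "progress ({..<k} \<times> {..<n} \<union> {k} \<times> {..<n}) (sem (PFor ''b'' try_radius) s1)"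
  proof (rule sem_PFor_induct[where N = n and I = "\<lambda>j. progress ({..<k} \<times> {..<n} \<union> {k} \<times> {..<j})"], goal_cases)
    case (1 j s2)
    have "nats s2 ''a'' 0 = k"
      using 1(4)[of "''a''"] \<open>nats s1 ''a'' 0 = k\<close> by (simp add: notin_writes_try)
    from sem_try_radius[OF 1(2) this 1(3) \<open>k < n\<close> 1(1)]
    have "progress ({..<k} \<times> {..<n} \<union> {k} \<times> {..<Suc j}) (sem try_radius s2)"
      by (simp add: lessThan_Suc)
    then show ?case by (simp add: progress_def base_def)
  qed (use 1(2) in \<open>simp_all add: progress_def base_def\<close>)
  moreover have "{..<k} \<times> {..<n} \<union> {k} \<times> {..<n} = {..<Suc k} \<times> {..<n}" by auto
  ultimately show ?case by (simp add: progress_def base_def)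
qed (use assms in \<open>simp_all add: progress_def base_def\<close>)

lemma sem_init:
  "progress {} (sem init (input_state n d L U p))"
proof -
  let ?s = "input_state n d L U p"
  define s1 where "s1 = set_nat ''row'' 0 0 (set_nat ''l'' 0 l ?s)"
  have n: "nats ?s ''n'' 0 = n" "nats ?s ''L'' 0 = L" "nats ?s ''U'' 0 = U" "nats ?s ''p'' 0 = p" "nats ?s ''z'' 0 = 0"
    by (simp_all add: input_state_def)
  define loop where "loop = PFor ''u'' (PN ''row'' (NPlus (scal ''u'') One) (NPlus (NGet ''row'' (scal ''u'')) (scal ''n'')))"
  have eq: "sem init ?s = sem loop s1"
    using n by (simp add: init_def s1_def l_def loop_def)
  have "\<forall>i\<le>n. nats (sem loop s1) ''row'' i = i * n"
    unfolding loop_def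
  proof (rule sem_PFor_induct[where N = n and I = "\<lambda>k s. \<forall>i\<le>k. nats s ''row'' i = i * n"], goal_cases)
    case (1 k s')
    have "nats s' ''n'' 0 = n" using 1(4)[of "''n''"] n by (simp add: s1_def)
    then show ?case using 1(2,3) by (auto simp: le_Suc_eq)
  qed (simp_all add: s1_def n)
  moreover have "nats (sem loop s1) a = nats s1 a" if "a \<in> {''n'', ''l'', ''U'', ''p'', ''z''}" for a
    by (rule nats_sem) (use that in \<open>auto simp: loop_def\<close>)
  moreover have "reals (sem loop s1) = reals ?s"
    by (rule ext) (subst reals_sem; simp add: loop_def s1_def)
  \<comment> \<open>Row-major indices must stay inside the matrix, beyond which the input array has
    the default value 0.\<close>
  moreover have "u * n + v < n * n" if "u < n" "v < n" for u v
    using mult_le_mono1[of "Suc u" n n] that by simp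
  ultimately show ?thesis
    unfolding eq progress_def base_def by (simp add: s1_def n) (simp add: input_state_def)
qed

text \<open>As \<open>p\<close> is positive, every feasible solution serves somebody and its value
  is a distance between two vertices. The infimum thus ranges over a finite nonempty set.\<close>

lemma opt_attained:
  "\<exists>C F \<phi>. feasible {..<n} L U p C F \<phi> \<and> sol_value d C \<phi> = opt_value {..<n} d L U p"
proof -
  let ?V = "{sol_value d C \<phi> | C F \<phi>. feasible {..<n} L U p C F \<phi>}"
  have "?V \<subseteq> (\<lambda>(u, v). d u v) ` ({..<n} \<times> {..<n})"
  proof
    fix y assume "y \<in> ?V"
    then obtain C F \<phi> where f: "feasible {..<n} L U p C F \<phi>" and y: "y = sol_value d C \<phi>" by blast
    have "finite C" "C \<noteq> {}"
      using f feasible_nonempty[OF f] finite_subset unfolding feasible_def by blast+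
    then have "y \<in> (\<lambda>v. d v (\<phi> v)) ` C"
      using Max_in[of "(\<lambda>v. d v (\<phi> v)) ` C"] by (simp add: y sol_value_def)
    then show "y \<in> (\<lambda>(u, v). d u v) ` ({..<n} \<times> {..<n})"
      using f unfolding feasible_def by blast
  qed
  then have fin: "finite ?V" by (rule finite_subset) simp
  have ne: "?V \<noteq> {}" using feas by blast
  have "Inf ?V \<in> ?V" unfolding cInf_eq_Min[OF fin ne] by (rule Min_in[OF fin ne])
  then have "\<exists>C F \<phi>. Inf ?V = sol_value d C \<phi> \<and> feasible {..<n} L U p C F \<phi>" by (rule CollectD)
  then show ?thesis
    unfolding opt_value_def by (elim exE conjE) (intro exI conjI, assumption, erule sym)
qed

lemma algorithm_correct:
  defines "s \<equiv> sem algorithm (input_state n d L U p)"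
  shows "feasible {..<n} L U p (out_served n s) (out_centers n s) (out_assignment s)"
    and "sol_value d (out_served n s) (out_assignment s) \<le> 10 * opt_value {..<n} d L U p"
proof -
  let ?C = "out_served n s" and ?F = "out_centers n s" and ?\<phi> = "out_assignment s"
  have "nats (input_state n d L U p) ''p'' 0 = p" by (simp add: input_state_def)
  then have "progress ({..<n} \<times> {..<n}) s"
    using sem_search[OF sem_init] p_pos by (simp add: s_def algorithm_def)
  then have sol: "nats s ''z'' 0 \<noteq> 0 \<longrightarrow> solution (10 * reals s ''B'' 0) (nats s ''C'') (nats s ''F'') (nats s ''phi'')"
    and best: "\<And>a b. a < n \<Longrightarrow> b < n \<Longrightarrow> solvable (d a b) \<Longrightarrow> nats s ''z'' 0 \<noteq> 0 \<and> reals s ''B'' 0 \<le> d a b"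
    by (auto simp: progress_def)
  obtain C F \<phi> where f: "feasible {..<n} L U p C F \<phi>" and opt: "sol_value d C \<phi> = opt_value {..<n} d L U p"
    using opt_attained by blast
  have C: "finite C" "C \<noteq> {}"
    using f feasible_nonempty[OF f] finite_subset unfolding feasible_def by blast+
  then have max: "opt_value {..<n} d L U p = Max ((\<lambda>v. d v (\<phi> v)) ` C)"
    using opt by (simp add: sol_value_def)
  then have "opt_value {..<n} d L U p \<in> (\<lambda>v. d v (\<phi> v)) ` C"
    using Max_in[of "(\<lambda>v. d v (\<phi> v)) ` C"] C by simp
  then obtain v where v: "v \<in> C" "opt_value {..<n} d L U p = d v (\<phi> v)" by blast
  \<comment> \<open>The correct guess is the distance at which the optimal solution attains its
    maximum.\<close>
  have "solvable (d v (\<phi> v))"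
    unfolding solvable_def
  proof (intro exI conjI ballI)
    show "feasible {..<n} L U p C F \<phi>" by (rule f)
    fix w assume "w \<in> C"
    then have "d w (\<phi> w) \<le> Max ((\<lambda>v. d v (\<phi> v)) ` C)" using C by (intro Max_ge) auto
    then show "d w (\<phi> w) \<le> d v (\<phi> v)" using max v(2) by simp
  qed
  moreover have "v < n" "\<phi> v < n" using f v(1) unfolding feasible_def by blast+
  ultimately have B: "nats s ''z'' 0 \<noteq> 0" "reals s ''B'' 0 \<le> opt_value {..<n} d L U p"
    using best v(2) by auto
  have S: "solution (10 * reals s ''B'' 0) (nats s ''C'') (nats s ''F'') (nats s ''phi'')"
    using sol B(1) by simp
  have fib: "{v \<in> ?C. ?\<phi> v = u} = {v. v < n \<and> nats s ''C'' v \<noteq> 0 \<and> nats s ''phi'' v = u}" for u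
    by (auto simp: out_served_def out_assignment_def)
  show feas': "feasible {..<n} L U p ?C ?F ?\<phi>"
    unfolding feasible_def fib
    using S by (auto simp: solution_def out_served_def out_centers_def out_assignment_def)
  have "sol_value d ?C ?\<phi> \<le> 10 * reals s ''B'' 0"
  proof -
    have "finite ?C" "?C \<noteq> {}" using feasible_nonempty[OF feas'] by (simp_all add: out_served_def)
    then show ?thesis
      using S by (auto simp: sol_value_def solution_def out_served_def out_assignment_def)
  qed
  then show "sol_value d ?C ?\<phi> \<le> 10 * opt_value {..<n} d L U p" using B(2) by simp
qed

end

text \<open>Without served vertices the value is 0 by convention, and the optimum is nonnegative
  because all distances are.\<close>

lemma empty_solution:
  assumes "center_instance {..<n} d L U"
  defines "s \<equiv> sem algorithm (input_state n d L U 0)"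
  shows "feasible {..<n} L U 0 (out_served n s) (out_centers n s) (out_assignment s)"
    and "sol_value d (out_served n s) (out_assignment s) \<le> 10 * opt_value {..<n} d L U 0"
proof -
  let ?V = "{sol_value d C \<phi> | C F \<phi>. feasible {..<n} L U 0 C F \<phi>}"
  have s: "s = input_state n d L U 0" by (simp add: s_def algorithm_def input_state_def)
  have out: "out_served n s = {}" "out_centers n s = {}"
    by (simp_all add: s out_served_def out_centers_def input_state_def)
  show f: "feasible {..<n} L U 0 (out_served n s) (out_centers n s) (out_assignment s)"
    by (simp add: out feasible_def)
  have "0 \<le> y" if y: "y \<in> ?V" for y
  proof -
    obtain C F \<phi> where f: "feasible {..<n} L U 0 C F \<phi>" and y: "y = sol_value d C \<phi>" using y by blast
    show ?thesis
    proof (cases "C = {}")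
      case False
      then obtain v where v: "v \<in> C" by blast
      have "finite C" using f finite_subset unfolding feasible_def by blast
      moreover have "v < n" "\<phi> v < n" using f v unfolding feasible_def by blast+
      then have "0 \<le> d v (\<phi> v)" using assms(1) by (simp add: center_instance_def)
      moreover have "d v (\<phi> v) \<le> Max ((\<lambda>v. d v (\<phi> v)) ` C)"
        using \<open>finite C\<close> v by (intro Max_ge) auto
      ultimately have "0 \<le> Max ((\<lambda>v. d v (\<phi> v)) ` C)" by linarith
      then show ?thesis using False by (simp add: y sol_value_def)
    qed (simp add: y sol_value_def)
  qed
  moreover have "?V \<noteq> {}" using f by blast
  ultimately have "0 \<le> Inf ?V" by (intro cInf_greatest) auto
  then show "sol_value d (out_served n s) (out_assignment s) \<le> 10 * opt_value {..<n} d L U 0"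
    by (simp add: out sol_value_def opt_value_def)
qed

theorem theorem11: "\<exists>c. polynomial_time c \<and> approximation_algorithm 10 c"
proof (intro exI conjI)
  show "polynomial_time (com_of algorithm)"
    by (rule polynomial_time_prog[OF well_formed_algorithm])
  show "approximation_algorithm 10 (com_of algorithm)"
    unfolding approximation_algorithm_def
  proof (intro allI impI)
    fix n L U p :: nat and d :: "nat \<Rightarrow> nat \<Rightarrow> real"
    assume inst: "center_instance {..<n} d L U" and feas: "\<exists>C F \<phi>. feasible {..<n} L U p C F \<phi>"
    let ?s = "sem algorithm (input_state n d L U p)"
    have "feasible {..<n} L U p (out_served n ?s) (out_centers n ?s) (out_assignment ?s) \<and>
      sol_value d (out_served n ?s) (out_assignment ?s) \<le> 10 * opt_value {..<n} d L U p"
    proof (cases "p = 0")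
      case True
      then show ?thesis using empty_solution[OF inst] by simp
    next
      case False
      then interpret center_input n L U p d using inst feas by unfold_locales auto
      show ?thesis using algorithm_correct by simp
    qed
    then show "\<exists>t s. exec (com_of algorithm) (input_state n d L U p) t s \<and>
           feasible {..<n} L U p (out_served n s) (out_centers n s) (out_assignment s) \<and>
           sol_value d (out_served n s) (out_assignment s) \<le> 10 * opt_value {..<n} d L U p"
      using exec_sem[OF well_formed_algorithm] by blast
  qed
qed

end
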